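(* Let $g\ge 2$ and $k\ge 1$ be integers. There exists a primitive $k$-differential with a unique zero, of order $k(2g-2)$, on some totally real hyperelliptic curve of genus $g$ if and only if $(g,k)\neq(2,2)$.
   Context: A totally real hyperelliptic curve of genus $g$ is the smooth projective complex curve (compact Riemann surface) $C_D$ with affine equation $y^2=D(x)$, where $D$ is a polynomial of degree $2g+2$ with simple roots, all of which are real. For $k\ge1$, a $k$-differential on a compact Riemann surface $X$ is a nonzero (here holomorphic) section of the $k$-th tensor power $K_X^{\otimes k}$ of the canonical bundle. A $k$-differential is primitive if it is not a (tensor) power of a $k'$-differential with $0<k'<k$. *)

theory Defs
  imports "HOL-Complex_Analysis.Complex_Analysis"
    "HOL-Computational_Algebra.Fundamental_Theorem_Algebra"
begin

section \<open>Riemann surfaces\<close>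

text \<open>A chart consists of its domain and its coordinate function. The values of the coordinate
  function outside of the domain are irrelevant.\<close>

type_synonym 'a chart = "'a set \<times> ('a \<Rightarrow> complex)"

record 'a surface =
  points :: "'a topology"
  atlas :: "'a chart set"

definition transition :: "'a chart \<Rightarrow> 'a chart \<Rightarrow> complex \<Rightarrow> complex" where
  "transition c d = (\<lambda>z. snd d (inv_into (fst c) (snd c) z))"

definition riemann_surface :: "'a surface \<Rightarrow> bool" where
  "riemann_surface X \<longleftrightarrow>
     Hausdorff_space (points X) \<and> connected_space (points X) \<and>
     (\<Union>c\<in>atlas X. fst c) = topspace (points X) \<and>
     (\<forall>c\<in>atlas X. openin (points X) (fst c) \<and> open (snd c ` fst c) \<and>
        homeomorphic_map (subtopology (points X) (fst c)) (top_of_set (snd c ` fst c)) (snd c)) \<and>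
     (\<forall>c\<in>atlas X. \<forall>d\<in>atlas X. transition c d holomorphic_on snd c ` (fst c \<inter> fst d))"

definition compact_riemann_surface :: "'a surface \<Rightarrow> bool" where
  "compact_riemann_surface X \<longleftrightarrow> riemann_surface X \<and> compact_space (points X)"


section \<open>k-differentials\<close>

text \<open>A section of the \<open>k\<close>-th tensor power of the canonical bundle is given by its local
  expressions \<open>\<omega> c z (dz)\<^sup>k\<close>, where \<open>z\<close> is the coordinate of the chart \<open>c\<close>. The
  values \<open>\<omega> c z\<close> for \<open>c\<close> not in the atlas or \<open>z\<close> not in the image of \<open>c\<close> are irrelevant.\<close>

type_synonym 'a k_form = "'a chart \<Rightarrow> complex \<Rightarrow> complex"

definition holomorphic_section :: "'a surface \<Rightarrow> nat \<Rightarrow> 'a k_form \<Rightarrow> bool" where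
  "holomorphic_section X k \<omega> \<longleftrightarrow>
     (\<forall>c\<in>atlas X. \<omega> c holomorphic_on snd c ` fst c) \<and>
     (\<forall>c\<in>atlas X. \<forall>d\<in>atlas X. \<forall>z\<in>snd c ` (fst c \<inter> fst d).
        \<omega> c z = \<omega> d (transition c d z) * deriv (transition c d) z ^ k)"

definition k_differential :: "'a surface \<Rightarrow> nat \<Rightarrow> 'a k_form \<Rightarrow> bool" where
  "k_differential X k \<omega> \<longleftrightarrow>
     holomorphic_section X k \<omega> \<and> (\<exists>c\<in>atlas X. \<exists>z\<in>snd c ` fst c. \<omega> c z \<noteq> 0)"

definition is_tensor_power :: "'a surface \<Rightarrow> 'a k_form \<Rightarrow> nat \<Rightarrow> 'a k_form \<Rightarrow> bool" where
  "is_tensor_power X \<eta> m \<omega> \<longleftrightarrow> (\<forall>c\<in>atlas X. \<forall>z\<in>snd c ` fst c. \<omega> c z = \<eta> c z ^ m)"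

text \<open>The \<open>m\<close>-th power of a \<open>k'\<close>-differential is an \<open>(m * k')\<close>-differential.\<close>

definition primitive_k_differential :: "'a surface \<Rightarrow> nat \<Rightarrow> 'a k_form \<Rightarrow> bool" where
  "primitive_k_differential X k \<omega> \<longleftrightarrow>
     k_differential X k \<omega> \<and>
     \<not> (\<exists>k' m \<eta>. 0 < k' \<and> k' < k \<and> m * k' = k \<and>
          k_differential X k' \<eta> \<and> is_tensor_power X \<eta> m \<omega>)"

definition zeros :: "'a surface \<Rightarrow> 'a k_form \<Rightarrow> 'a set" where
  "zeros X \<omega> = {p \<in> topspace (points X). \<exists>c\<in>atlas X. p \<in> fst c \<and> \<omega> c (snd c p) = 0}"

definition has_order_at :: "'a surface \<Rightarrow> 'a k_form \<Rightarrow> 'a \<Rightarrow> nat \<Rightarrow> bool" where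
  "has_order_at X \<omega> p n \<longleftrightarrow>
     (\<exists>c\<in>atlas X. p \<in> fst c \<and> zorder (\<omega> c) (snd c p) = int n)"

definition has_unique_zero_of_order :: "'a surface \<Rightarrow> 'a k_form \<Rightarrow> nat \<Rightarrow> bool" where
  "has_unique_zero_of_order X \<omega> n \<longleftrightarrow> (\<exists>p. zeros X \<omega> = {p} \<and> has_order_at X \<omega> p n)"


section \<open>Hyperelliptic curves\<close>

definition affine_curve :: "complex poly \<Rightarrow> (complex \<times> complex) set" where
  "affine_curve P = {(x, y). y\<^sup>2 = poly P x}"

text \<open>The partial derivatives of \<open>y\<^sup>2 - P x\<close> are \<open>2 * y\<close> and \<open>- P' x\<close>: the function \<open>x\<close> is a local
  coordinate where \<open>y \<noteq> 0\<close>, and \<open>y\<close> is one where \<open>P' x \<noteq> 0\<close>.\<close>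

definition affine_charts :: "complex poly \<Rightarrow> (complex \<times> complex) chart set" where
  "affine_charts P =
     {(V, fst) | V. openin (top_of_set (affine_curve P)) V \<and> inj_on fst V \<and>
                    (\<forall>(x, y)\<in>V. y \<noteq> 0)} \<union>
     {(V, snd) | V. openin (top_of_set (affine_curve P)) V \<and> inj_on snd V \<and>
                    (\<forall>(x, y)\<in>V. poly (pderiv P) x \<noteq> 0)}"

text \<open>For \<open>D\<close> of degree \<open>2 * n\<close>, the smooth projective model of \<open>y\<^sup>2 = D x\<close> is obtained by gluing
  it to the affine curve \<open>v\<^sup>2 = u ^ (2 * n) * D (1 / u)\<close>, the right-hand side being the reflected
  polynomial of \<open>D\<close>, by means of \<open>u = 1 / x\<close> and \<open>v = y / x ^ n\<close>.
  The points at infinity are those with \<open>u = 0\<close>.\<close>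

datatype curve_point = Finite complex complex | Infinite complex

definition finite_patch :: "complex \<times> complex \<Rightarrow> curve_point" where
  "finite_patch = (\<lambda>(x, y). Finite x y)"

definition infinite_patch :: "nat \<Rightarrow> complex \<times> complex \<Rightarrow> curve_point" where
  "infinite_patch n = (\<lambda>(u, v). if u = 0 then Infinite v else Finite (1 / u) (v / u ^ n))"

definition patches :: "complex poly \<Rightarrow> (complex poly \<times> (complex \<times> complex \<Rightarrow> curve_point)) set" where
  "patches D = {(D, finite_patch), (reflect_poly D, infinite_patch (degree D div 2))}"

definition curve_topology :: "complex poly \<Rightarrow> curve_point topology" where
  "curve_topology D = topology (\<lambda>W.
     W \<subseteq> (\<Union>(P, \<iota>)\<in>patches D. \<iota> ` affine_curve P) \<and>
     (\<forall>(P, \<iota>)\<in>patches D. openin (top_of_set (affine_curve P)) {p \<in> affine_curve P. \<iota> p \<in> W}))"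

definition hyperelliptic_curve :: "complex poly \<Rightarrow> curve_point surface" where
  "hyperelliptic_curve D =
     \<lparr>points = curve_topology D,
      atlas = {(\<iota> ` V, \<lambda>p. \<phi> (inv_into V \<iota> p)) | P \<iota> V \<phi>.
                 (P, \<iota>) \<in> patches D \<and> (V, \<phi>) \<in> affine_charts P}\<rparr>"

definition totally_real :: "nat \<Rightarrow> complex poly \<Rightarrow> bool" where
  "totally_real g D \<longleftrightarrow> degree D = 2 * g + 2 \<and> rsquarefree D \<and> (\<forall>x. poly D x = 0 \<longrightarrow> x \<in> \<real>)"


section \<open>The curve is a compact Riemann surface\<close>

lemma affine_chart_local:
  assumes P: "rsquarefree P" and c: "(V, \<phi>) \<in> affine_charts P" and p: "p \<in> V"
  obtains X Y r where "r > 0" "X holomorphic_on ball (\<phi> p) r" "Y holomorphic_on ball (\<phi> p) r"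
    "\<And>z. z \<in> ball (\<phi> p) r \<Longrightarrow> (X z, Y z) \<in> V \<and> \<phi> (X z, Y z) = z"
proof -
  obtain T where T: "open T" "V = affine_curve P \<inter> T"
    using c by (auto simp: affine_charts_def openin_open)
  obtain x0 y0 where p0: "p = (x0, y0)" by fastforce
  have S0: "y0\<^sup>2 = poly P x0" and T0: "(x0, y0) \<in> T"
    using p T p0 by (auto simp: affine_curve_def)
  note main = that
  have key: thesis
    if "open B" "\<phi> p \<in> B" "X holomorphic_on B" "Y holomorphic_on B" "(X (\<phi> p), Y (\<phi> p)) = p"
      "\<And>z. z \<in> B \<Longrightarrow> (Y z)\<^sup>2 = poly P (X z)" "\<And>z. z \<in> B \<Longrightarrow> \<phi> (X z, Y z) = z" for X Y B
  proof -
    have cont: "continuous_on B (\<lambda>z. (X z, Y z))"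
      using that by (intro continuous_intros holomorphic_on_imp_continuous_on)
    have "open (B \<inter> (\<lambda>z. (X z, Y z)) -` T)"
      using continuous_open_preimage[OF cont \<open>open B\<close> \<open>open T\<close>] .
    moreover have "\<phi> p \<in> B \<inter> (\<lambda>z. (X z, Y z)) -` T"
      using that T0 p0 by auto
    ultimately obtain r where r: "r > 0" "ball (\<phi> p) r \<subseteq> B \<inter> (\<lambda>z. (X z, Y z)) -` T"
      by (meson open_contains_ball)
    show thesis
    proof (rule main[of r X Y])
      show "X holomorphic_on ball (\<phi> p) r" "Y holomorphic_on ball (\<phi> p) r"
        using that r by (auto intro: holomorphic_on_subset)
      fix z assume "z \<in> ball (\<phi> p) r"
      then have "z \<in> B" "(X z, Y z) \<in> T" using r by auto
      then show "(X z, Y z) \<in> V \<and> \<phi> (X z, Y z) = z"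
        using that T by (auto simp: affine_curve_def)
    qed (use r in auto)
  qed
  consider (x) "\<phi> = fst" "y0 \<noteq> 0" | (y) "\<phi> = snd" "poly (pderiv P) x0 \<noteq> 0"
    using c p p0 by (auto simp: affine_charts_def)
  then show thesis
  proof cases
    case x
    define q where "q = (\<lambda>z. poly P z / poly P x0)"
    have nz: "poly P x0 \<noteq> 0" using x S0 by auto
    have hq: "q holomorphic_on UNIV" unfolding q_def using nz by (intro holomorphic_intros) auto
    define B where "B = q -` (- \<real>\<^sub>\<le>\<^sub>0)"
    have oB: "open B" unfolding B_def
      using hq by (intro open_vimage) (auto intro: holomorphic_on_imp_continuous_on)
    show thesis
    proof (rule key[of B "\<lambda>z. z" "\<lambda>z. y0 * csqrt (q z)"])
      show "\<phi> p \<in> B" using nz by (simp add: B_def q_def x p0)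
      show "(\<lambda>z. y0 * csqrt (q z)) holomorphic_on B"
        by (intro holomorphic_intros holomorphic_on_subset[OF hq]) (auto simp: B_def)
    qed (use oB nz S0 in \<open>auto simp: x p0 q_def power_mult_distrib\<close>)
  next
    case y
    have "deriv (poly P) x0 = poly (pderiv P) x0"
      by (intro DERIV_imp_deriv poly_DERIV)
    with y obtain r where r: "r > 0" "inj_on (poly P) (ball x0 r)" "open (poly P ` ball x0 r)"
      using has_complex_derivative_locally_invertible[of "poly P" UNIV x0, OF poly_holomorphic_on[OF holomorphic_on_ident]]
      by auto
    have hP: "poly P holomorphic_on ball x0 r" by (intro holomorphic_intros)
    obtain h where h: "h holomorphic_on poly P ` ball x0 r" "\<And>z. z \<in> ball x0 r \<Longrightarrow> h (poly P z) = z"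
      using holomorphic_has_inverse[OF hP open_ball r(2)] by metis
    define B where "B = (\<lambda>z. z\<^sup>2) -` (poly P ` ball x0 r)"
    have oB: "open B" unfolding B_def by (intro open_vimage r continuous_intros)
    show thesis
    proof (rule key[of B "\<lambda>z. h (z\<^sup>2)" "\<lambda>z. z"])
      show "\<phi> p \<in> B" using r S0 by (auto simp: B_def y p0)
      have "(h \<circ> (\<lambda>z. z\<^sup>2)) holomorphic_on B"
        by (rule holomorphic_on_compose_gen[OF _ h(1)]) (auto simp: B_def intro: holomorphic_intros)
      then show "(\<lambda>z. h (z\<^sup>2)) holomorphic_on B" by (simp add: o_def)
      show "(h ((\<phi> p)\<^sup>2), \<phi> p) = p" using h(2)[of x0] r S0 by (simp add: y p0)
      show "z\<^sup>2 = poly P (h (z\<^sup>2))" if "z \<in> B" for z using that h by (auto simp: B_def)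
    qed (use oB in \<open>auto simp: y\<close>)
  qed
qed

lemma affine_charts_inj: "(V, \<phi>) \<in> affine_charts P \<Longrightarrow> inj_on \<phi> V"
  by (auto simp: affine_charts_def)

lemma affine_charts_openin: "(V, \<phi>) \<in> affine_charts P \<Longrightarrow> openin (top_of_set (affine_curve P)) V"
  by (auto simp: affine_charts_def)

lemma affine_charts_fst_snd: "(V, \<phi>) \<in> affine_charts P \<Longrightarrow> \<phi> = fst \<or> \<phi> = snd"
  by (auto simp: affine_charts_def)

lemma affine_charts_subset:
  assumes "(V, \<phi>) \<in> affine_charts P" "openin (top_of_set (affine_curve P)) W" "W \<subseteq> V"
  shows "(W, \<phi>) \<in> affine_charts P"
  using assms by (auto simp: affine_charts_def intro: inj_on_subset)

lemma affine_chart_open: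
  assumes P: "rsquarefree P" and c: "(V, \<phi>) \<in> affine_charts P"
  shows "open (\<phi> ` V)"
  unfolding open_contains_ball
proof clarsimp
  fix a b assume "(a, b) \<in> V"
  then obtain X Y r where "r > 0"
    "\<And>z. z \<in> ball (\<phi> (a,b)) r \<Longrightarrow> (X z, Y z) \<in> V \<and> \<phi> (X z, Y z) = z"
    using affine_chart_local[OF P c] by metis
  then show "\<exists>e>0. ball (\<phi> (a, b)) e \<subseteq> \<phi> ` V"
    by (intro exI[of _ r]) (metis image_eqI subsetI)
qed

lemma affine_chart_inverse:
  assumes P: "rsquarefree P" and c: "(V, \<phi>) \<in> affine_charts P"
  shows "(\<lambda>z. fst (inv_into V \<phi> z)) holomorphic_on \<phi> ` V"
    and "(\<lambda>z. snd (inv_into V \<phi> z)) holomorphic_on \<phi> ` V"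
proof -
  have "(\<lambda>z. fst (inv_into V \<phi> z)) field_differentiable (at z) \<and>
        (\<lambda>z. snd (inv_into V \<phi> z)) field_differentiable (at z)" if z: "z \<in> \<phi> ` V" for z
  proof -
    obtain p where p: "p \<in> V" "z = \<phi> p" using z by blast
    then obtain X Y r where r: "r > 0" "X holomorphic_on ball z r" "Y holomorphic_on ball z r"
      "\<And>w. w \<in> ball z r \<Longrightarrow> (X w, Y w) \<in> V \<and> \<phi> (X w, Y w) = w"
      using affine_chart_local[OF P c] by metis
    have eq: "inv_into V \<phi> w = (X w, Y w)" if "w \<in> ball z r" for w
      using inv_into_f_f[OF affine_charts_inj[OF c]] r(4)[OF that] by metis
    have "(\<lambda>z. fst (inv_into V \<phi> z)) holomorphic_on ball z r"
         "(\<lambda>z. snd (inv_into V \<phi> z)) holomorphic_on ball z r"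
      using r(2,3) holomorphic_cong[of "ball z r" "ball z r" "\<lambda>z. fst (inv_into V \<phi> z)" X]
        holomorphic_cong[of "ball z r" "ball z r" "\<lambda>z. snd (inv_into V \<phi> z)" Y] eq by auto
    with \<open>r > 0\<close> show ?thesis
      by (meson centre_in_ball holomorphic_on_imp_differentiable_at open_ball)
  qed
  then show "(\<lambda>z. fst (inv_into V \<phi> z)) holomorphic_on \<phi> ` V"
    "(\<lambda>z. snd (inv_into V \<phi> z)) holomorphic_on \<phi> ` V"
    by (auto simp: holomorphic_on_def field_differentiable_at_within)
qed

lemma affine_chart_fst:
  assumes p: "(x, y) \<in> affine_curve P" "y \<noteq> 0"
  obtains V where "(V, fst) \<in> affine_charts P" "(x, y) \<in> V"
proof -
  define V where "V = affine_curve P \<inter> UNIV \<times> ball y (norm y)"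
  have "openin (top_of_set (affine_curve P)) V"
    unfolding V_def by (intro openin_open_Int open_Times) auto
  moreover have "inj_on fst V"
  proof (rule inj_onI)
    fix a b assume ab: "a \<in> V" "b \<in> V" "fst a = fst b"
    then have "(snd a)\<^sup>2 = (snd b)\<^sup>2" by (auto simp: V_def affine_curve_def)
    then have "snd a = snd b \<or> snd a = - snd b" by (simp add: power2_eq_iff)
    moreover have "snd a \<noteq> - snd b"
    proof
      assume eq: "snd a = - snd b"
      have "norm (2 * y) \<le> norm (y - snd a) + norm (y - snd b)"
        using norm_triangle_ineq[of "y - snd a" "y - snd b"] eq by simp
      also have "\<dots> < 2 * norm y" using ab by (auto simp: V_def dist_norm)
      finally show False by (simp add: norm_mult)
    qed
    ultimately show "a = b" using ab by (simp add: prod_eq_iff)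
  qed
  moreover have "\<forall>(x, y)\<in>V. y \<noteq> 0" by (auto simp: V_def)
  ultimately have "(V, fst) \<in> affine_charts P" by (auto simp: affine_charts_def)
  then show thesis using that p by (auto simp: V_def)
qed

lemma affine_charts_cover:
  assumes P: "rsquarefree P" and p: "p \<in> affine_curve P"
  obtains V \<phi> where "(V, \<phi>) \<in> affine_charts P" "p \<in> V"
proof -
  obtain x y where xy: "p = (x, y)" by fastforce
  have S: "y\<^sup>2 = poly P x" using p by (simp add: xy affine_curve_def)
  show thesis
  proof (cases "y = 0")
    case False
    then show thesis using affine_chart_fst p that xy by metis
  next
    case True
    with S P have d: "poly (pderiv P) x \<noteq> 0" by (auto simp: rsquarefree_roots)
    moreover have "deriv (poly P) x = poly (pderiv P) x"
      by (intro DERIV_imp_deriv poly_DERIV)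
    ultimately obtain r where r: "r > 0" "inj_on (poly P) (ball x r)"
      using has_complex_derivative_locally_injective[of "poly P" UNIV x, OF poly_holomorphic_on[OF holomorphic_on_ident]]
      by auto
    define B where "B = ball x r \<inter> {z. poly (pderiv P) z \<noteq> 0}"
    have "open {z. poly (pderiv P) z \<noteq> 0}"
      by (intro open_Collect_neq continuous_intros)
    then have "open B" by (auto simp: B_def)
    define V where "V = affine_curve P \<inter> B \<times> UNIV"
    have "openin (top_of_set (affine_curve P)) V"
      unfolding V_def using \<open>open B\<close> by (intro openin_open_Int open_Times) auto
    moreover have "inj_on snd V"
      using r(2) by (auto simp: V_def B_def affine_curve_def inj_on_def)
    moreover have "\<forall>(x, y)\<in>V. poly (pderiv P) x \<noteq> 0" by (auto simp: V_def B_def)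
    ultimately have "(V, snd) \<in> affine_charts P" by (auto simp: affine_charts_def)
    then show thesis using that p d r by (auto simp: V_def B_def xy)
  qed
qed

lemma affine_curve_connected:
  assumes P: "rsquarefree P" "degree P > 0"
  shows "connected (affine_curve P)"
proof (rule connectedI)
  have img: "fst ` (A \<inter> affine_curve P) = UNIV"
    if A: "open A" and B: "open B" and cov: "affine_curve P \<subseteq> A \<union> B"
      and disj: "A \<inter> B \<inter> affine_curve P = {}" and ne: "A \<inter> affine_curve P \<noteq> {}" for A B
  proof -
    define C where "C = A \<inter> affine_curve P"
    have cl: "closed (affine_curve P)"
    proof -
      have "affine_curve P = {p. (snd p)\<^sup>2 = poly P (fst p)}" by (auto simp: affine_curve_def)
      then show ?thesis by (auto intro!: closed_Collect_eq continuous_intros)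
    qed
    have "C = affine_curve P - B" using cov disj by (auto simp: C_def)
    then have clC: "closed C" using cl B by (simp add: closed_Diff)
    have "closed (fst ` C)"
      unfolding closed_sequential_limits
    proof (intro allI impI, elim conjE)
      fix s l assume s: "\<forall>n. s n \<in> fst ` C" and l: "s \<longlonglongrightarrow> l"
      have "\<forall>n. \<exists>y. (s n, y) \<in> C" using s by force
      then obtain t where t: "\<And>n. (s n, t n) \<in> C" by metis
      have e: "(t n)\<^sup>2 = poly P (s n)" for n using t[of n] by (auto simp: C_def affine_curve_def)
      have "(\<lambda>n. poly P (s n)) \<longlonglongrightarrow> poly P l" using l by (intro tendsto_intros)
      then have "bounded (range (\<lambda>n. poly P (s n)))" by (rule convergent_imp_bounded)
      then obtain M where M: "\<And>n. norm (poly P (s n)) \<le> M" by (auto simp: bounded_iff)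
      have "norm (t n) \<le> M + 1" for n
      proof -
        have "(norm (t n))\<^sup>2 \<le> M" using M[of n] e[of n] by (metis norm_power)
        moreover have "norm (t n) \<le> (norm (t n))\<^sup>2 + 1"
          using zero_le_power2[of "norm (t n) - 1/2"] by (simp add: power2_eq_square algebra_simps)
        ultimately show ?thesis by linarith
      qed
      then have "bounded (range t)" by (auto simp: bounded_iff)
      then obtain m r where r: "strict_mono (r :: nat \<Rightarrow> nat)" "(t \<circ> r) \<longlonglongrightarrow> m"
        using bounded_imp_convergent_subsequence by blast
      have "(\<lambda>n. ((s \<circ> r) n, (t \<circ> r) n)) \<longlonglongrightarrow> (l, m)"
        using tendsto_Pair[OF LIMSEQ_subseq_LIMSEQ[OF l r(1)] r(2)] by (simp add: o_def)
      then have "(l, m) \<in> C"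
        using clC t unfolding closed_sequential_limits
        by (metis (no_types, lifting) comp_apply)
      then show "l \<in> fst ` C" by force
    qed
    moreover have "open (fst ` C)"
      unfolding open_contains_ball
    proof clarsimp
      fix x y assume xy: "(x, y) \<in> C"
      then have e: "y\<^sup>2 = poly P x" by (auto simp: C_def affine_curve_def)
      show "\<exists>e>0. ball x e \<subseteq> fst ` C"
      proof (cases "y = 0")
        case False
        obtain V \<phi> where c: "(V, \<phi>) \<in> affine_charts P" and V: "V \<subseteq> C" "(x,y) \<in> V" "\<phi> = fst"
        proof -
          obtain V where V: "(V, fst) \<in> affine_charts P" "(x, y) \<in> V"
            using affine_chart_fst[of x y P] xy False by (auto simp: C_def)
          have oV: "openin (top_of_set (affine_curve P)) V" by (rule affine_charts_openin[OF V(1)])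
          then have "V \<subseteq> affine_curve P" using openin_imp_subset by blast
          moreover have "openin (top_of_set (affine_curve P)) (V \<inter> A)"
            using oV A by (rule openin_Int_open)
          then have "(V \<inter> A, fst) \<in> affine_charts P" using V affine_charts_subset by blast
          ultimately show thesis using that[of "V \<inter> A" fst] V xy by (auto simp: C_def)
        qed
        have "open (fst ` V)" using affine_chart_open[OF P(1) c] V by simp
        moreover have "x \<in> fst ` V" "fst ` V \<subseteq> fst ` C" using V by force+
        ultimately show ?thesis by (meson open_contains_ball subset_trans)
      next
        case True
        obtain \<epsilon> where \<epsilon>: "\<epsilon> > 0" "ball (x, y) \<epsilon> \<subseteq> A"
          using A xy by (auto simp: C_def open_contains_ball)
        have "((\<lambda>z. dist (x, 0) (z, csqrt (poly P z))) \<longlongrightarrow> 0) (at x)"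
        proof -
          have "((\<lambda>z. poly P z) \<longlongrightarrow> poly P x) (at x)"
            by (intro tendsto_intros)
          then have "((\<lambda>z. sqrt (norm (poly P z))) \<longlongrightarrow> sqrt (norm (poly P x))) (at x)"
            by (intro tendsto_intros)
          then have "((\<lambda>z. norm (csqrt (poly P z))) \<longlongrightarrow> 0) (at x)"
            using e True by (simp add: norm_csqrt)
          then have "((\<lambda>z. csqrt (poly P z)) \<longlongrightarrow> 0) (at x)"
            by (rule tendsto_norm_zero_cancel)
          then have "((\<lambda>z. dist (x, 0) (z, csqrt (poly P z))) \<longlongrightarrow> dist (x, 0::complex) (x, 0)) (at x)"
            by (intro tendsto_intros)
          then show ?thesis by simp
        qed
        then have "\<forall>\<^sub>F z in at x. dist (x, 0) (z, csqrt (poly P z)) < \<epsilon>"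
          using \<epsilon>(1) by (rule order_tendstoD)
        then obtain d where d: "d > 0"
          "\<And>z. z \<noteq> x \<Longrightarrow> dist z x < d \<Longrightarrow> dist (x, 0) (z, csqrt (poly P z)) < \<epsilon>"
          by (auto simp: eventually_at)
        have "z \<in> fst ` C" if "z \<in> ball x d" for z
        proof (cases "z = x")
          case True then show ?thesis using xy by force
        next
          case False
          then have "(z, csqrt (poly P z)) \<in> ball (x, y) \<epsilon>"
            using d(2)[of z] that True by (simp add: dist_commute)
          then have "(z, csqrt (poly P z)) \<in> C" using \<epsilon> by (auto simp: C_def affine_curve_def)
          then show ?thesis by force
        qed
        then show ?thesis using d(1) by blast
      qed
    qed
    ultimately have "fst ` C = {} \<or> fst ` C = UNIV" by (intro clopen[THEN iffD1] conjI)
    moreover have "C \<noteq> {}" using ne by (simp add: C_def)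
    ultimately show ?thesis unfolding C_def by (simp only: image_is_empty simp_thms)
  qed
  fix A B :: "(complex \<times> complex) set"
  assume AB: "open A" "open B" "A \<inter> affine_curve P \<noteq> {}" "B \<inter> affine_curve P \<noteq> {}"
    "A \<inter> B \<inter> affine_curve P = {}" "affine_curve P \<subseteq> A \<union> B"
  obtain e where e: "poly P e = 0"
    using P(2) by (metis alg_closed_imp_poly_has_root)
  have "e \<in> fst ` (A \<inter> affine_curve P)" "e \<in> fst ` (B \<inter> affine_curve P)"
    using img[of A B] img[of B A] AB by (auto simp: Int_commute Un_commute)
  then have "(e, 0) \<in> A \<inter> affine_curve P" "(e, 0) \<in> B \<inter> affine_curve P"
    using e by (auto simp: affine_curve_def)
  with AB show False by auto
qed

lemma rsquarefree_reflect_poly: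
  fixes D :: "complex poly"
  assumes "rsquarefree D"
  shows "rsquarefree (reflect_poly D)"
  unfolding rsquarefree_roots
proof (intro allI notI, elim conjE)
  fix u assume r: "poly (reflect_poly D) u = 0" "poly (pderiv (reflect_poly D)) u = 0"
  have D0: "D \<noteq> 0" using assms by (auto simp: rsquarefree_def)
  have u: "u \<noteq> 0" using r D0 by (metis reflect_poly_at_0_eq_0_iff)
  have root: "poly D (inverse u) = 0" using r u by (simp add: poly_reflect_poly_nz)
  have "((\<lambda>z. z ^ degree D * poly D (inverse z)) has_field_derivative
          u ^ degree D * (poly (pderiv D) (inverse u) * (- (inverse u * inverse u)))) (at u)"
    using u root by (auto intro!: derivative_eq_intros DERIV_chain2[OF poly_DERIV] simp: power2_eq_square)
  moreover have "\<forall>\<^sub>F z in nhds u. z ^ degree D * poly D (inverse z) = poly (reflect_poly D) z"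
    using t1_space_nhds[OF u] by eventually_elim (simp add: poly_reflect_poly_nz)
  ultimately have "(poly (reflect_poly D) has_field_derivative
      u ^ degree D * (poly (pderiv D) (inverse u) * (- (inverse u * inverse u)))) (at u)"
    by (subst (asm) DERIV_cong_ev[OF refl _ refl]) auto
  then have "u ^ degree D * (poly (pderiv D) (inverse u) * (- (inverse u * inverse u))) = 0"
    using poly_DERIV[of "reflect_poly D" u] r DERIV_unique by metis
  then have "poly (pderiv D) (inverse u) = 0" using u by simp
  with root assms show False by (auto simp: rsquarefree_roots)
qed

lemma degree_reflect_poly_pos:
  fixes D :: "complex poly"
  assumes "rsquarefree D" "degree D \<ge> 2"
  shows "degree (reflect_poly D) > 0"
proof (cases "coeff D 0 = 0")
  case True
  then have "coeff D 1 \<noteq> 0"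
    using assms(1) by (auto simp: rsquarefree_roots poly_0_coeff_0 coeff_pderiv dest!: spec[of _ 0])
  then have "coeff (reflect_poly D) (degree D - 1) \<noteq> 0"
    using assms(2) by (simp add: coeff_reflect_poly)
  then have "degree D - 1 \<le> degree (reflect_poly D)" by (rule le_degree)
  with assms(2) show ?thesis by linarith
qed (use assms in auto)


context
  fixes D :: "complex poly" and n :: nat
  assumes rsq: "rsquarefree D" and deg: "degree D = 2 * n" and n: "n > 0"
begin

private definition J :: "complex \<times> complex \<Rightarrow> complex \<times> complex" where
  "J = (\<lambda>(x, y). (1 / x, y / x ^ n))"

private definition K :: "curve_point set" where
  "K = (\<Union>(P, \<iota>)\<in>patches D. \<iota> ` affine_curve P)"

lemma patches_eq: "patches D = {(D, finite_patch), (reflect_poly D, infinite_patch n)}"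
  by (simp add: patches_def deg)

lemma patch_good: "(P, \<iota>) \<in> patches D \<Longrightarrow> rsquarefree P \<and> degree P > 0 \<and> inj \<iota>"
  using rsq rsquarefree_reflect_poly[OF rsq] degree_reflect_poly_pos[OF rsq] deg n
  by (auto simp: patches_eq finite_patch_def infinite_patch_def inj_def split: if_splits)

lemma J_affine:
  assumes "(x, y) \<in> affine_curve D" "x \<noteq> 0" shows "J (x, y) \<in> affine_curve (reflect_poly D)"
proof -
  have "(y / x ^ n)\<^sup>2 = y\<^sup>2 / x ^ (2 * n)" by (simp add: power_divide mult.commute flip: power_mult)
  moreover have "poly (reflect_poly D) (1 / x) = poly D x / x ^ (2 * n)"
    using assms by (simp add: poly_reflect_poly_nz deg power_divide)
  ultimately show ?thesis using assms by (simp add: J_def affine_curve_def)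
qed

lemma J_affine':
  assumes "(x, y) \<in> affine_curve (reflect_poly D)" "x \<noteq> 0" shows "J (x, y) \<in> affine_curve D"
proof -
  have "(y / x ^ n)\<^sup>2 = y\<^sup>2 / x ^ (2 * n)" by (simp add: power_divide mult.commute flip: power_mult)
  moreover have "y\<^sup>2 = x ^ (2 * n) * poly D (1 / x)"
    using assms by (simp add: affine_curve_def poly_reflect_poly_nz deg inverse_eq_divide)
  ultimately show ?thesis using assms by (simp add: J_def affine_curve_def)
qed

lemma patch_overlap:
  assumes "(P, \<iota>) \<in> patches D" "(Q, \<kappa>) \<in> patches D"
  shows "\<iota> = \<kappa> \<and> P = Q \<or>
    (\<forall>p. fst p \<noteq> 0 \<longrightarrow> (J p \<in> affine_curve Q \<longleftrightarrow> p \<in> affine_curve P)) \<and>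
    (\<forall>p q. \<iota> p = \<kappa> q \<longleftrightarrow> fst p \<noteq> 0 \<and> q = J p)"
proof -
  have JJ: "J (J (x,y)) = (x,y)" if "x \<noteq> 0" for x y using that by (simp add: J_def power_divide)
  have nz: "fst (J (x,y)) \<noteq> 0" if "x \<noteq> 0" for x y using that by (simp add: J_def)
  have J1: "J p \<in> affine_curve (reflect_poly D) \<longleftrightarrow> p \<in> affine_curve D" if "fst p \<noteq> 0" for p
    using that J_affine J_affine' JJ nz by (metis prod.collapse)
  have J2: "J p \<in> affine_curve D \<longleftrightarrow> p \<in> affine_curve (reflect_poly D)" if "fst p \<noteq> 0" for p
    using that J_affine J_affine' JJ nz by (metis prod.collapse)
  have J3: "finite_patch p = infinite_patch n q \<longleftrightarrow> fst p \<noteq> 0 \<and> q = J p" for p q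
  proof -
    obtain a b c d where [simp]: "p = (a, b)" "q = (c, d)" by fastforce
    have "a = 1 / c \<longleftrightarrow> c = 1 / a" by (auto simp: field_simps)
    moreover have "b = d / c ^ n \<longleftrightarrow> d = b / a ^ n" if "a \<noteq> 0" "c = 1 / a"
      using that(1) by (auto simp: that(2) field_simps power_divide)
    ultimately show ?thesis by (auto simp: finite_patch_def infinite_patch_def J_def)
  qed
  have J4: "infinite_patch n p = finite_patch q \<longleftrightarrow> fst p \<noteq> 0 \<and> q = J p" for p q
    by (cases p; cases q) (auto simp: finite_patch_def infinite_patch_def J_def)
  consider "\<iota> = \<kappa>" "P = Q"
    | "\<iota> = finite_patch" "P = D" "\<kappa> = infinite_patch n" "Q = reflect_poly D"
    | "\<iota> = infinite_patch n" "P = reflect_poly D" "\<kappa> = finite_patch" "Q = D"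
    using assms by (auto simp: patches_eq)
  then show ?thesis
  proof cases
    case 2
    show ?thesis unfolding 2 using J1 J3 by blast
  next
    case 3
    show ?thesis unfolding 3 using J2 J4 by blast
  qed blast
qed

lemma openin_curve:
  "openin (curve_topology D) W \<longleftrightarrow> W \<subseteq> K \<and>
     (\<forall>(P, \<iota>)\<in>patches D. openin (top_of_set (affine_curve P)) {p \<in> affine_curve P. \<iota> p \<in> W})"
proof -
  have "istopology (\<lambda>W. W \<subseteq> K \<and>
     (\<forall>(P, \<iota>)\<in>patches D. openin (top_of_set (affine_curve P)) {p \<in> affine_curve P. \<iota> p \<in> W}))"
    (is "istopology ?T")
    unfolding istopology_def
  proof (rule conjI; intro allI impI)
    fix S T assume ST: "?T S" "?T T"
    have "openin (top_of_set (affine_curve P)) {p \<in> affine_curve P. \<iota> p \<in> S \<inter> T}"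
      if "(P, \<iota>) \<in> patches D" for P \<iota>
    proof -
      have "{p \<in> affine_curve P. \<iota> p \<in> S \<inter> T} =
        {p \<in> affine_curve P. \<iota> p \<in> S} \<inter> {p \<in> affine_curve P. \<iota> p \<in> T}" by auto
      then show ?thesis using ST that by (metis (mono_tags, lifting) openin_Int case_prodD)
    qed
    then show "?T (S \<inter> T)" using ST by auto
  next
    fix \<K> assume K: "\<forall>S\<in>\<K>. ?T S"
    have "openin (top_of_set (affine_curve P)) {p \<in> affine_curve P. \<iota> p \<in> \<Union>\<K>}"
      if "(P, \<iota>) \<in> patches D" for P \<iota>
    proof -
      have "{p \<in> affine_curve P. \<iota> p \<in> \<Union>\<K>} = (\<Union>S\<in>\<K>. {p \<in> affine_curve P. \<iota> p \<in> S})" by auto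
      moreover have "openin (top_of_set (affine_curve P)) \<dots>" using K that by (intro openin_Union) auto
      ultimately show ?thesis by simp
    qed
    then show "?T (\<Union>\<K>)" using K by auto
  qed
  then show ?thesis
    unfolding curve_topology_def K_def by (subst topology_inverse') auto
qed

lemma topspace_curve: "topspace (curve_topology D) = K"
proof -
  have "openin (curve_topology D) K"
    unfolding openin_curve
  proof (clarsimp simp only: subset_refl simp_thms)
    fix P \<iota> assume "(P, \<iota>) \<in> patches D"
    then have "{p \<in> affine_curve P. \<iota> p \<in> K} = affine_curve P" by (auto simp: K_def)
    then show "openin (top_of_set (affine_curve P)) {p \<in> affine_curve P. \<iota> p \<in> K}"
      by (metis openin_subtopology_self)
  qed
  then show ?thesis using openin_curve by (metis openin_subset openin_topspace subset_antisym)
qed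

lemma J_cont: "continuous_on (- ({0} \<times> UNIV)) J"
proof -
  have "J = (\<lambda>p. (1 / fst p, snd p / fst p ^ n))" by (auto simp: J_def)
  then show ?thesis by (auto intro!: continuous_intros)
qed

lemma patch_open:
  assumes c: "(P, \<iota>) \<in> patches D" and V: "openin (top_of_set (affine_curve P)) V"
  shows "openin (curve_topology D) (\<iota> ` V)"
proof -
  have VP: "V \<subseteq> affine_curve P" using V openin_imp_subset by blast
  then have sub: "\<iota> ` V \<subseteq> K" using c by (auto simp: K_def)
  have "openin (top_of_set (affine_curve Q)) {p \<in> affine_curve Q. \<kappa> p \<in> \<iota> ` V}"
    if d: "(Q, \<kappa>) \<in> patches D" for Q \<kappa>
    using patch_overlap[OF d c]
  proof (elim disjE conjE)
    assume "\<kappa> = \<iota>" "Q = P"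
    then have "{p \<in> affine_curve Q. \<kappa> p \<in> \<iota> ` V} = V"
      using VP patch_good[OF c] by (auto simp: inj_image_mem_iff)
    then show ?thesis using V \<open>Q = P\<close> by simp
  next
    assume a: "\<forall>p. fst p \<noteq> 0 \<longrightarrow> (J p \<in> affine_curve P \<longleftrightarrow> p \<in> affine_curve Q)"
      and b: "\<forall>p q. \<kappa> p = \<iota> q \<longleftrightarrow> fst p \<noteq> 0 \<and> q = J p"
    obtain T where T: "open T" "V = affine_curve P \<inter> T" using V by (auto simp: openin_open)
    have "{p \<in> affine_curve Q. \<kappa> p \<in> \<iota> ` V} = {p \<in> affine_curve Q. fst p \<noteq> 0 \<and> J p \<in> V}"
    proof -
      have "\<kappa> p \<in> \<iota> ` V \<longleftrightarrow> fst p \<noteq> 0 \<and> J p \<in> V" for p using b by (metis imageE image_eqI)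
      then show ?thesis by auto
    qed
    also have "\<dots> = affine_curve Q \<inter> (- ({0} \<times> UNIV) \<inter> J -` T)"
      using a T by (auto simp: )
    finally have eq: "{p \<in> affine_curve Q. \<kappa> p \<in> \<iota> ` V} = affine_curve Q \<inter> (- ({0} \<times> UNIV) \<inter> J -` T)" .
    have "open (- ({0::complex} \<times> (UNIV::complex set)))" by (intro open_Compl closed_Times) auto
    then have "open (- ({0} \<times> UNIV) \<inter> J -` T)"
      using continuous_open_preimage[OF J_cont _ T(1)] by blast
    then show ?thesis unfolding eq by (rule openin_open_Int)
  qed
  with sub show ?thesis unfolding openin_curve by auto
qed

lemma patch_continuous:
  assumes "(P, \<iota>) \<in> patches D"
  shows "continuous_map (top_of_set (affine_curve P)) (curve_topology D) \<iota>"
  unfolding continuous_map topspace_curve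
  using assms by (auto simp: openin_curve K_def)

lemma curve_charts:
  assumes "c \<in> atlas (hyperelliptic_curve D)"
  obtains P \<iota> V \<phi> where "(P, \<iota>) \<in> patches D" "(V, \<phi>) \<in> affine_charts P" "V \<subseteq> affine_curve P"
    "fst c = \<iota> ` V" "snd c = (\<lambda>p. \<phi> (inv_into V \<iota> p))" "\<And>p. p \<in> V \<Longrightarrow> snd c (\<iota> p) = \<phi> p"
    "snd c ` fst c = \<phi> ` V" "\<And>W. W \<subseteq> V \<Longrightarrow> snd c ` \<iota> ` W = \<phi> ` W"
    "\<And>z. z \<in> \<phi> ` V \<Longrightarrow> inv_into (fst c) (snd c) z = \<iota> (inv_into V \<phi> z)"
proof -
  obtain P \<iota> V \<phi> where c: "(P, \<iota>) \<in> patches D" "(V, \<phi>) \<in> affine_charts P"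
    "c = (\<iota> ` V, \<lambda>p. \<phi> (inv_into V \<iota> p))"
    using assms by (auto simp: hyperelliptic_curve_def)
  have inj: "inj_on \<iota> V" using patch_good[OF c(1)] by (auto intro: inj_on_subset)
  have e: "snd c (\<iota> p) = \<phi> p" if "p \<in> V" for p using inj that c by simp
  have inj2: "inj_on (snd c) (fst c)"
    using affine_charts_inj[OF c(2)] e c(3) by (auto simp: inj_on_def)
  have inv: "inv_into (fst c) (snd c) z = \<iota> (inv_into V \<phi> z)" if z: "z \<in> \<phi> ` V" for z
  proof -
    have "inv_into V \<phi> z \<in> V" "\<phi> (inv_into V \<phi> z) = z"
      using z by (auto intro: inv_into_into f_inv_into_f)
    then show ?thesis using inv_into_f_eq[OF inj2, of "\<iota> (inv_into V \<phi> z)" z] e c(3) by auto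
  qed
  have VP: "V \<subseteq> affine_curve P" using affine_charts_openin[OF c(2)] openin_imp_subset by blast
  have im: "snd c ` \<iota> ` W = \<phi> ` W" if "W \<subseteq> V" for W
  proof -
    have "snd c ` \<iota> ` W = (\<lambda>p. snd c (\<iota> p)) ` W" by (simp only: image_image)
    also have "\<dots> = \<phi> ` W" using e that by (intro image_cong) auto
    finally show ?thesis .
  qed
  have fc: "fst c = \<iota> ` V" "snd c = (\<lambda>p. \<phi> (inv_into V \<iota> p))" using c(3) by simp_all
  have "snd c ` fst c = \<phi> ` V" unfolding fc(1) by (rule im) simp
  from that[OF c(1,2) VP fc e this im inv] show thesis .
qed

lemma curve_transition:
  assumes c: "c \<in> atlas (hyperelliptic_curve D)" and d: "d \<in> atlas (hyperelliptic_curve D)"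
  shows "transition c d holomorphic_on snd c ` (fst c \<inter> fst d)"
proof -
  obtain P \<iota> V \<phi> where c': "(P, \<iota>) \<in> patches D" "(V, \<phi>) \<in> affine_charts P" "V \<subseteq> affine_curve P"
    "fst c = \<iota> ` V" "\<And>p. p \<in> V \<Longrightarrow> snd c (\<iota> p) = \<phi> p"
    "\<And>z. z \<in> \<phi> ` V \<Longrightarrow> inv_into (fst c) (snd c) z = \<iota> (inv_into V \<phi> z)"
    by (rule curve_charts[OF c]) (rule that; assumption)
  obtain Q \<kappa> W \<psi> where d': "(Q, \<kappa>) \<in> patches D" "(W, \<psi>) \<in> affine_charts Q" "W \<subseteq> affine_curve Q"
    "fst d = \<kappa> ` W" "\<And>p. p \<in> W \<Longrightarrow> snd d (\<kappa> p) = \<psi> p"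
    by (rule curve_charts[OF d]) (rule that; assumption)
  define S where "S = snd c ` (fst c \<inter> fst d)"
  define h where "h = inv_into V \<phi>"
  have SV: "S \<subseteq> \<phi> ` V" using c' by (auto simp: S_def)
  have hol: "(\<lambda>z. fst (h z)) holomorphic_on S" "(\<lambda>z. snd (h z)) holomorphic_on S"
    using affine_chart_inverse[OF _ c'(2)] patch_good[OF c'(1)] SV
    unfolding h_def by (auto intro: holomorphic_on_subset)
  have hS: "h z \<in> V \<and> \<iota> (h z) \<in> \<kappa> ` W \<and> transition c d z = snd d (\<iota> (h z))" if z: "z \<in> S" for z
  proof -
    obtain w where w: "w \<in> fst c" "w \<in> fst d" "z = snd c w" using z unfolding S_def by blast
    then obtain p where p0: "p \<in> V" "w = \<iota> p" using c'(4) by auto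
    have p: "p \<in> V" "\<iota> p \<in> \<kappa> ` W" "z = \<phi> p" using w p0 c'(5)[of p] d'(4) by simp_all
    have "h z = p" unfolding h_def using affine_charts_inj[OF c'(2)] p by simp
    then show ?thesis using p c'(6)[of z] by (auto simp: transition_def h_def)
  qed
  have \<psi>: "\<psi> = fst \<or> \<psi> = snd" using affine_charts_fst_snd[OF d'(2)] .
  from patch_overlap[OF c'(1) d'(1)] have "transition c d holomorphic_on S"
  proof (elim disjE conjE)
    assume eq: "\<iota> = \<kappa>" "P = Q"
    have *: "transition c d z = \<psi> (h z)" if "z \<in> S" for z
    proof -
      have "inj \<kappa>" using patch_good[OF d'(1)] by simp
      then have "h z \<in> W" using hS[OF that] eq(1) by (simp add: inj_image_mem_iff)
      then show ?thesis using hS[OF that] eq(1) d'(5)[of "h z"] by simp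
    qed
    have "(\<lambda>z. \<psi> (h z)) holomorphic_on S" using \<psi> hol by (elim disjE) simp_all
    then show ?thesis by (rule holomorphic_transform) (simp add: *)
  next
    assume b: "\<forall>p q. \<iota> p = \<kappa> q \<longleftrightarrow> fst p \<noteq> 0 \<and> q = J p"
    have *: "fst (h z) \<noteq> 0 \<and> transition c d z = \<psi> (J (h z))" if z: "z \<in> S" for z
    proof -
      obtain q where q: "q \<in> W" "\<iota> (h z) = \<kappa> q" using hS[OF z] by blast
      then have "fst (h z) \<noteq> 0" "q = J (h z)" using b by auto
      then show ?thesis using hS[OF z] q d'(5)[of q] by simp
    qed
    have J: "J (h z) = (1 / fst (h z), snd (h z) / fst (h z) ^ n)" for z
      by (simp add: J_def split: prod.splits)
    have nz: "fst (h z) \<noteq> 0" if "z \<in> S" for z using *[OF that] by simp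
    have "(\<lambda>z. 1 / fst (h z)) holomorphic_on S" "(\<lambda>z. snd (h z) / fst (h z) ^ n) holomorphic_on S"
      using hol nz by (auto intro!: holomorphic_intros)
    then have "(\<lambda>z. \<psi> (J (h z))) holomorphic_on S" using \<psi> by (elim disjE) (simp_all add: J)
    then show ?thesis by (rule holomorphic_transform) (simp add: *)
  qed
  then show ?thesis by (simp add: S_def)
qed

lemma curve_chart_homeomorphic:
  assumes c: "c \<in> atlas (hyperelliptic_curve D)"
  shows "openin (curve_topology D) (fst c)" "open (snd c ` fst c)"
    "homeomorphic_map (subtopology (curve_topology D) (fst c)) (top_of_set (snd c ` fst c)) (snd c)"
proof -
  obtain P \<iota> V \<phi> where c': "(P, \<iota>) \<in> patches D" "(V, \<phi>) \<in> affine_charts P" "V \<subseteq> affine_curve P"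
    "fst c = \<iota> ` V" "\<And>p. p \<in> V \<Longrightarrow> snd c (\<iota> p) = \<phi> p"
    "snd c ` fst c = \<phi> ` V" "\<And>W. W \<subseteq> V \<Longrightarrow> snd c ` \<iota> ` W = \<phi> ` W"
    by (rule curve_charts[OF c]) (rule that; assumption)
  note oV = affine_charts_openin[OF c'(2)]
  have rP: "rsquarefree P" and inj: "inj \<iota>" using patch_good[OF c'(1)] by auto
  show o: "openin (curve_topology D) (fst c)" using patch_open[OF c'(1) oV] c' by simp
  show oo: "open (snd c ` fst c)" using affine_chart_open[OF rP c'(2)] c' by simp
  have top: "topspace (subtopology (curve_topology D) (fst c)) = fst c"
    using o by (meson openin_subset topspace_subtopology_subset)
  have contphi: "continuous_on V \<phi>"
    using affine_charts_fst_snd[OF c'(2)] by (auto intro: continuous_intros)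
  show "homeomorphic_map (subtopology (curve_topology D) (fst c)) (top_of_set (snd c ` fst c)) (snd c)"
  proof (rule bijective_open_imp_homeomorphic_map)
    show "inj_on (snd c) (topspace (subtopology (curve_topology D) (fst c)))"
      unfolding top using affine_charts_inj[OF c'(2)] c' by (auto simp: inj_on_def)
    show "snd c ` topspace (subtopology (curve_topology D) (fst c)) = topspace (top_of_set (snd c ` fst c))"
      unfolding top by simp
    show "continuous_map (subtopology (curve_topology D) (fst c)) (top_of_set (snd c ` fst c)) (snd c)"
      unfolding continuous_map top
    proof (intro conjI allI impI)
      fix U assume "openin (top_of_set (snd c ` fst c)) U"
      then have U: "open U" "U \<subseteq> \<phi> ` V" using oo c'(6) by (auto simp: openin_open_eq)
      have "{x \<in> fst c. snd c x \<in> U} = \<iota> ` {p \<in> V. \<phi> p \<in> U}" using c' by auto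
      moreover have "openin (top_of_set (affine_curve P)) {p \<in> V. \<phi> p \<in> U}"
      proof -
        have "openin (top_of_set V) (V \<inter> \<phi> -` U)"
          using continuous_openin_preimage_gen[OF contphi U(1)] .
        then have "openin (top_of_set (affine_curve P)) (V \<inter> \<phi> -` U)"
          using oV openin_trans by blast
        moreover have "V \<inter> \<phi> -` U = {p \<in> V. \<phi> p \<in> U}" by auto
        ultimately show ?thesis by simp
      qed
      ultimately have "openin (curve_topology D) {x \<in> fst c. snd c x \<in> U}"
        using patch_open[OF c'(1)] by metis
      then show "openin (subtopology (curve_topology D) (fst c)) {x \<in> fst c. snd c x \<in> U}"
        using o by (auto simp: openin_open_subtopology)
    qed simp
    show "open_map (subtopology (curve_topology D) (fst c)) (top_of_set (snd c ` fst c)) (snd c)"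
      unfolding open_map_def
    proof (intro allI impI)
      fix U assume "openin (subtopology (curve_topology D) (fst c)) U"
      then have U: "openin (curve_topology D) U" "U \<subseteq> fst c" using o by (auto simp: openin_open_subtopology)
      define W where "W = {p \<in> affine_curve P. \<iota> p \<in> U}"
      have "openin (top_of_set (affine_curve P)) W" using U(1) c'(1) by (auto simp: openin_curve W_def)
      moreover have UV: "U \<subseteq> \<iota> ` V" using U(2) c'(4) by simp
      then have WV: "W \<subseteq> V" unfolding W_def using inj_image_mem_iff[OF inj] by blast
      have UW: "U = \<iota> ` W" using UV c'(3) by (auto simp: W_def)
      ultimately have "open (\<phi> ` W)"
        using affine_chart_open[OF rP affine_charts_subset[OF c'(2)]] WV by blast
      then have "open (snd c ` U)" using c'(7) WV UW by simp
      then show "openin (top_of_set (snd c ` fst c)) (snd c ` U)"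
        using oo U(2) by (auto simp: openin_open_eq)
    qed
  qed
qed

lemma curve_cover: "(\<Union>c\<in>atlas (hyperelliptic_curve D). fst c) = K"
proof
  show "(\<Union>c\<in>atlas (hyperelliptic_curve D). fst c) \<subseteq> K"
    using curve_chart_homeomorphic(1) by (auto simp flip: topspace_curve dest: openin_subset)
  show "K \<subseteq> (\<Union>c\<in>atlas (hyperelliptic_curve D). fst c)"
  proof
    fix x assume "x \<in> K"
    then obtain P \<iota> p where p: "(P, \<iota>) \<in> patches D" "p \<in> affine_curve P" "x = \<iota> p" by (auto simp: K_def)
    then obtain V \<phi> where "(V, \<phi>) \<in> affine_charts P" "p \<in> V"
      using affine_charts_cover patch_good by metis
    then have "(\<iota> ` V, \<lambda>p. \<phi> (inv_into V \<iota> p)) \<in> atlas (hyperelliptic_curve D)" "x \<in> \<iota> ` V"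
      using p by (auto simp: hyperelliptic_curve_def)
    then show "x \<in> (\<Union>c\<in>atlas (hyperelliptic_curve D). fst c)" by force
  qed
qed

lemma curve_Hausdorff: "Hausdorff_space (curve_topology D)"
  unfolding Hausdorff_space_def topspace_curve
proof (intro allI impI, elim conjE)
  fix x y assume "x \<in> K" "y \<in> K" and ne: "x \<noteq> y"
  then obtain P \<iota> p Q \<kappa> q where p: "(P, \<iota>) \<in> patches D" "p \<in> affine_curve P" "x = \<iota> p"
    and q: "(Q, \<kappa>) \<in> patches D" "q \<in> affine_curve Q" "y = \<kappa> q" by (auto simp: K_def)
  let ?goal = "\<exists>U V. openin (curve_topology D) U \<and> openin (curve_topology D) V \<and> x \<in> U \<and> y \<in> V \<and> disjnt U V"
  have same: ?goal if "\<iota> = \<kappa>" "P = Q" "p \<in> affine_curve P" "q \<in> affine_curve P" "(P, \<iota>) \<in> patches D"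
    "x = \<iota> p" "y = \<iota> q" for P \<iota> p q Q \<kappa>
  proof -
    have "p \<noteq> q" using that ne by auto
    then obtain U V where UV: "open U" "open V" "p \<in> U" "q \<in> V" "U \<inter> V = {}"
      using hausdorff by metis
    have "openin (curve_topology D) (\<iota> ` (affine_curve P \<inter> U))"
      "openin (curve_topology D) (\<iota> ` (affine_curve P \<inter> V))"
      using UV by (auto intro!: patch_open[OF that(5)] openin_open_Int)
    moreover have "disjnt (\<iota> ` (affine_curve P \<inter> U)) (\<iota> ` (affine_curve P \<inter> V))"
    proof -
      have "inj \<iota>" using patch_good[OF that(5)] by simp
      then have "\<iota> ` (affine_curve P \<inter> U) \<inter> \<iota> ` (affine_curve P \<inter> V) =
          \<iota> ` (affine_curve P \<inter> U \<inter> (affine_curve P \<inter> V))" by (simp only: image_Int)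
      then show ?thesis using UV(5) by (auto simp: disjnt_def)
    qed
    moreover have "x \<in> \<iota> ` (affine_curve P \<inter> U)" "y \<in> \<iota> ` (affine_curve P \<inter> V)"
      using UV that by auto
    ultimately show ?thesis by blast
  qed
  show ?goal
  proof (cases "\<iota> = \<kappa> \<and> P = Q")
    case True then show ?thesis using same p q by metis
  next
    case False
    with patch_overlap[OF p(1) q(1)]
    have a: "\<And>p. fst p \<noteq> 0 \<Longrightarrow> (J p \<in> affine_curve Q \<longleftrightarrow> p \<in> affine_curve P)"
      and b: "\<And>p q. \<iota> p = \<kappa> q \<longleftrightarrow> fst p \<noteq> 0 \<and> q = J p" by blast+
    from False patch_overlap[OF q(1) p(1)]
    have a': "\<And>p. fst p \<noteq> 0 \<Longrightarrow> (J p \<in> affine_curve P \<longleftrightarrow> p \<in> affine_curve Q)"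
      and b': "\<And>p q. \<kappa> p = \<iota> q \<longleftrightarrow> fst p \<noteq> 0 \<and> q = J p" by blast+
    consider "fst p \<noteq> 0" | "fst q \<noteq> 0" | "fst p = 0" "fst q = 0" by blast
    then show ?thesis
    proof cases
      case 1
      then have "x = \<kappa> (J p)" "J p \<in> affine_curve Q" using a b p by auto
      then show ?thesis using same q by metis
    next
      case 2
      then have "y = \<iota> (J q)" "J q \<in> affine_curve P" using a' b' q by auto
      then show ?thesis using same p by metis
    next
      case 3
      define B where "B = ball (0::complex) 1 \<times> (UNIV :: complex set)"
      have oB: "open B" by (auto simp: B_def intro: open_Times)
      have "openin (curve_topology D) (\<iota> ` (affine_curve P \<inter> B))"
        "openin (curve_topology D) (\<kappa> ` (affine_curve Q \<inter> B))"
        using oB by (auto intro!: patch_open[OF p(1)] patch_open[OF q(1)] openin_open_Int)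
      moreover have "disjnt (\<iota> ` (affine_curve P \<inter> B)) (\<kappa> ` (affine_curve Q \<inter> B))"
        by (auto simp: disjnt_def b J_def B_def norm_divide)
      moreover have "p \<in> B" "q \<in> B" using 3 by (auto simp: B_def mem_Times_iff)
      moreover from this have "x \<in> \<iota> ` (affine_curve P \<inter> B)" "y \<in> \<kappa> ` (affine_curve Q \<inter> B)"
        using p q by auto
      ultimately show ?thesis by blast
    qed
  qed
qed

lemma curve_connected: "connected_space (curve_topology D)"
proof -
  have con: "connectedin (curve_topology D) (\<iota> ` affine_curve P)" if "(P, \<iota>) \<in> patches D" for P \<iota>
  proof (rule connectedin_continuous_map_image[OF patch_continuous[OF that]])
    show "connectedin (top_of_set (affine_curve P)) (affine_curve P)"
      using affine_curve_connected patch_good[OF that] by (simp add: connectedin_subtopology)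
  qed
  have m: "(D, finite_patch) \<in> patches D" "(reflect_poly D, infinite_patch n) \<in> patches D"
    by (auto simp: patches_eq)
  define p where "p = (1::complex, csqrt (poly D 1))"
  have "p \<in> affine_curve D" by (simp add: p_def affine_curve_def)
  moreover from this have "J p \<in> affine_curve (reflect_poly D)" unfolding p_def by (rule J_affine) auto
  moreover have "finite_patch p = infinite_patch n (J p)"
    by (simp add: p_def J_def finite_patch_def infinite_patch_def)
  ultimately have "finite_patch ` affine_curve D \<inter> infinite_patch n ` affine_curve (reflect_poly D) \<noteq> {}"
    by (metis IntI empty_iff imageI)
  then have "connectedin (curve_topology D)
      (finite_patch ` affine_curve D \<union> infinite_patch n ` affine_curve (reflect_poly D))"
    using connectedin_Un con m by blast
  moreover have "finite_patch ` affine_curve D \<union> infinite_patch n ` affine_curve (reflect_poly D) = K"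
    by (simp add: K_def patches_eq)
  ultimately show ?thesis by (metis connectedin_topspace topspace_curve)
qed

lemma curve_compact: "compact_space (curve_topology D)"
proof -
  define L where "L = (\<lambda>P. affine_curve P \<inter> cball 0 1 \<times> UNIV)"
  have comp: "compactin (curve_topology D) (\<iota> ` L P)" if "(P, \<iota>) \<in> patches D" for P \<iota>
  proof (rule image_compactin[OF _ patch_continuous[OF that]])
    have "compact (L P)"
    proof -
      have "compact (poly P ` cball 0 1)" by (intro compact_continuous_image continuous_intros) auto
      then obtain M where M: "\<And>x. x \<in> cball 0 1 \<Longrightarrow> norm (poly P x) \<le> M"
        by (meson bounded_iff compact_imp_bounded imageI)
      have "L P \<subseteq> cball 0 1 \<times> cball 0 (M + 1)"
      proof
        fix p assume "p \<in> L P"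
        then obtain x y where xy: "p = (x, y)" "x \<in> cball 0 1" "y\<^sup>2 = poly P x"
          by (auto simp: L_def affine_curve_def)
        have "(norm y)\<^sup>2 \<le> M" using M xy by (metis norm_power)
        moreover have "norm y \<le> (norm y)\<^sup>2 + 1"
          using zero_le_power2[of "norm y - 1/2"] by (simp add: power2_eq_square algebra_simps)
        ultimately show "p \<in> cball 0 1 \<times> cball 0 (M + 1)" using xy by auto
      qed
      then have "bounded (L P)" by (rule bounded_subset[OF bounded_Times[OF bounded_cball bounded_cball]])
      moreover have "closed (L P)"
      proof -
        have "affine_curve P = {p. (snd p)\<^sup>2 = poly P (fst p)}" by (auto simp: affine_curve_def)
        then show ?thesis unfolding L_def
          by (auto intro!: closed_Int closed_Collect_eq continuous_intros closed_Times)
      qed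
      ultimately show ?thesis by (simp add: compact_eq_bounded_closed)
    qed
    then show "compactin (top_of_set (affine_curve P)) (L P)"
      by (auto simp: compactin_subtopology L_def)
  qed
  have m: "(D, finite_patch) \<in> patches D" "(reflect_poly D, infinite_patch n) \<in> patches D"
    by (auto simp: patches_eq)
  have sub: "\<iota> p \<in> finite_patch ` L D \<union> infinite_patch n ` L (reflect_poly D)"
    if p: "(P, \<iota>) \<in> patches D" "p \<in> affine_curve P" for P \<iota> p
  proof (cases "norm (fst p) \<le> 1")
    case True
    then have "p \<in> L P" using p by (auto simp: L_def mem_Times_iff)
    then show ?thesis using p by (auto simp: patches_eq)
  next
    case False
    then have nz: "fst p \<noteq> 0" by auto
    have l: "norm (fst (J p)) \<le> 1"
      using False by (cases p) (simp add: J_def norm_divide divide_simps)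
    obtain Q \<kappa> where Q: "(Q, \<kappa>) \<in> patches D" "Q = D \<and> \<kappa> = finite_patch \<or> Q = reflect_poly D \<and> \<kappa> = infinite_patch n"
      "\<not> (\<iota> = \<kappa>)"
    proof -
      have "finite_patch \<noteq> infinite_patch n"
        by (auto simp: finite_patch_def infinite_patch_def fun_eq_iff intro!: exI[of _ 0])
      then show thesis using that m p by (cases "\<iota> = finite_patch") auto
    qed
    with patch_overlap[OF p(1) Q(1)] p nz have "J p \<in> affine_curve Q" "\<iota> p = \<kappa> (J p)" by blast+
    then have "\<iota> p \<in> \<kappa> ` L Q" using l by (auto simp: L_def mem_Times_iff)
    then show ?thesis using Q by auto
  qed
  have "finite_patch ` L D \<union> infinite_patch n ` L (reflect_poly D) = K"
  proof
    show "finite_patch ` L D \<union> infinite_patch n ` L (reflect_poly D) \<subseteq> K"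
      using m by (auto simp: K_def patches_eq L_def)
    show "K \<subseteq> finite_patch ` L D \<union> infinite_patch n ` L (reflect_poly D)"
    proof
      fix x assume "x \<in> K"
      then obtain P \<iota> p where "(P, \<iota>) \<in> patches D" "p \<in> affine_curve P" "x = \<iota> p" by (auto simp: K_def)
      then show "x \<in> finite_patch ` L D \<union> infinite_patch n ` L (reflect_poly D)" using sub by blast
    qed
  qed
  moreover have "compactin (curve_topology D) (finite_patch ` L D \<union> infinite_patch n ` L (reflect_poly D))"
    using comp m by (intro compactin_Un) auto
  ultimately show ?thesis by (simp add: compact_space_def topspace_curve)
qed

lemma compact_riemann_surface_rsquarefree:
  "compact_riemann_surface (hyperelliptic_curve D)"
proof -
  have p: "points (hyperelliptic_curve D) = curve_topology D"
    by (simp add: hyperelliptic_curve_def)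
  have "riemann_surface (hyperelliptic_curve D)"
    unfolding riemann_surface_def p topspace_curve
  proof (intro conjI ballI)
    fix c assume c: "c \<in> atlas (hyperelliptic_curve D)"
    show "openin (curve_topology D) (fst c)" "open (snd c ` fst c)"
      "homeomorphic_map (subtopology (curve_topology D) (fst c)) (top_of_set (snd c ` fst c)) (snd c)"
      using curve_chart_homeomorphic[OF c] .
    fix d assume d: "d \<in> atlas (hyperelliptic_curve D)"
    show "transition c d holomorphic_on snd c ` (fst c \<inter> fst d)" using curve_transition[OF c d] .
  qed (fact curve_Hausdorff curve_connected curve_cover)+
  then show ?thesis
    unfolding compact_riemann_surface_def p using curve_compact by blast
qed

end

theorem compact_riemann_surface_hyperelliptic_curve:
  assumes "totally_real g D"
  shows "compact_riemann_surface (hyperelliptic_curve D)"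
  using assms compact_riemann_surface_rsquarefree[of D "g + 1"] by (simp add: totally_real_def)

end

theory Submission
  imports Defs
begin

text \<open>Put \<open>m = g - 1\<close>. The form \<open>dx / y\<close> has no zeros or poles over the affine curve \<open>y\<^sup>2 = D x\<close> and a
zero of order \<open>m\<close> at each of the two points at infinity, so a \<open>k\<close>-differential is
\<open>F (dx / y)\<^sup>k\<close> with \<open>F\<close> regular on the affine curve and a pole of order at most \<open>k m\<close> at each
point at infinity. Typical such functions are \<open>F = A x + B x y\<close> with \<open>degree A \<le> k m\<close> and
\<open>degree B + m + 2 \<le> k m\<close>.

If \<open>k \<ge> 2\<close> and the zero is unique, it cannot be a branch point for a primitive differential: the
\<open>k\<close>-th power of a 1-differential would have the same divisor. Placing the zero at infinity, one wants
\<open>F\<close> to be invertible on the affine curve, which is the Pell-Abel equation \<open>A\<^sup>2 - D B\<^sup>2 = 1\<close> with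
\<open>degree A = k m\<close>. This leaves room for \<open>B \<noteq> 0\<close> exactly if \<open>k m \<ge> m + 2\<close>, and for \<open>g, k \<ge> 2\<close> the
only exception is \<open>(2, 2)\<close>.

For the existence, let \<open>A\<close> be a real polynomial all of whose critical points are real, with alternating
critical values \<open>\<plusminus>2\<close> at the first \<open>g\<close> of them and \<open>\<plusminus>1\<close> at the others. Then \<open>A\<^sup>2 - 1\<close> has double
zeros at the latter, and exactly \<open>2 g + 2\<close> further zeros, which are real and simple: these are the roots
of \<open>D\<close> (\<open>real_pell_abel_solution\<close>). A polynomial with these critical values is found by a
Poincare-Miranda argument applied to the gaps between the critical points
(\<open>prescribed_critical_values\<close>). To the left of all critical points there is an interval between two
roots of \<open>D\<close> which \<open>A\<close> maps onto \<open>[-1, 1]\<close>, without touching \<open>\<plusminus>1\<close> in between. On the oval of the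
curve over this interval, \<open>F\<close> winds exactly once around the unit circle; hence \<open>F\<close> is not the \<open>j\<close>-th
power of a continuous function for \<open>j \<ge> 2\<close> (\<open>no_root_on_oval\<close>), and \<open>F (dx / y)\<^sup>k\<close> is primitive. For
\<open>k = 1\<close>, the form \<open>x ^ m dx / y\<close> with \<open>D 0 = 0\<close> has its only zero at the branch point over 0.

In the exceptional case, and generally if \<open>k m < m + 2\<close>, the pole order at infinity is too small for the
part of \<open>F\<close> that is odd in \<open>y\<close>, so that \<open>F\<close> is a polynomial in \<open>x\<close> of degree at most \<open>k m\<close>
(\<open>low_degree_section\<close>). If a quadratic polynomial in \<open>x\<close> gives a form with a single zero, then this
zero is a branch point, the polynomial is a square, and so is the form
(\<open>genus_2_quadratic_is_square\<close>).\<close>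

section \<open>Real polynomials with prescribed critical values\<close>

text \<open>The dimension \<open>n\<close> is a term here, so a point of the cube is a sequence with values in \<open>{0..R}\<close>. Kuhn's
labelling lemma on the grid of mesh \<open>R / p\<close> yields a cell such that no \<open>G i\<close> has a strict sign on all of
its corners; a limit point of these cells for \<open>p \<longrightarrow> \<infinity>\<close> is a common zero.\<close>

lemma poincare_miranda:
  fixes G :: "nat \<Rightarrow> (nat \<Rightarrow> real) \<Rightarrow> real"
  assumes R: "R > 0"
    and cont: "\<And>i. i < n \<Longrightarrow> continuous_on UNIV (G i)"
    and lo: "\<And>i x. i < n \<Longrightarrow> \<forall>j. 0 \<le> x j \<and> x j \<le> R \<Longrightarrow> x i = 0 \<Longrightarrow> G i x \<le> 0"
    and hi: "\<And>i x. i < n \<Longrightarrow> \<forall>j. 0 \<le> x j \<and> x j \<le> R \<Longrightarrow> x i = R \<Longrightarrow> G i x \<ge> 0"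
  obtains x where "\<And>j. 0 \<le> x j \<and> x j \<le> R" "\<And>i. i < n \<Longrightarrow> G i x = 0"
proof -
  define scale :: "nat \<Rightarrow> (nat \<Rightarrow> nat) \<Rightarrow> nat \<Rightarrow> real"
    where "scale = (\<lambda>p x i. if i < n then R * real (x i) / real p else 0)"
  have box: "0 \<le> scale p x j \<and> scale p x j \<le> R" if "p > 0" "\<forall>i<n. x i \<le> p" for p x j
    using that R by (auto simp: scale_def divide_le_eq)
  have "\<exists>q. (\<forall>i<n. q i < p) \<and> (\<forall>i<n. \<exists>r s. (\<forall>j<n. q j \<le> r j \<and> r j \<le> q j + 1) \<and>
        (\<forall>j<n. q j \<le> s j \<and> s j \<le> q j + 1) \<and> G i (scale p r) \<le> 0 \<and> 0 \<le> G i (scale p s))"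
    if p: "p > 0" for p
  proof -
    \<comment> \<open>On the faces the label is dictated by the hypothesis of Kuhn's lemma, elsewhere it is the sign.\<close>
    define label where "label = (\<lambda>x i. if x i \<noteq> 0 \<and> (x i = p \<or> G i (scale p x) > 0) then 1 else (0::nat))"
    have l1: "G i (scale p x) \<ge> 0" if "label x i = 1" "i < n" "\<forall>i<n. x i \<le> p" for x i
    proof (cases "x i = p")
      case True
      then show ?thesis using hi[of i "scale p x"] box[OF p that(3)] that(2) p by (simp add: scale_def)
    qed (use that in \<open>auto simp: label_def split: if_splits\<close>)
    have l0: "G i (scale p x) \<le> 0" if "label x i = 0" "i < n" "\<forall>i<n. x i \<le> p" for x i
    proof (cases "x i = 0")
      case True
      then show ?thesis using lo[of i "scale p x"] box[OF p that(3)] that(2) p by (simp add: scale_def)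
    qed (use that in \<open>auto simp: label_def split: if_splits\<close>)
    have k: "\<forall>x. (\<forall>i<n. x i \<le> p) \<longrightarrow> (\<forall>i<n. label x i = 0 \<or> label x i = 1)"
      "\<forall>x. (\<forall>i<n. x i \<le> p) \<longrightarrow> (\<forall>i<n. x i = 0 \<longrightarrow> label x i = 0)"
      "\<forall>x. (\<forall>i<n. x i \<le> p) \<longrightarrow> (\<forall>i<n. x i = p \<longrightarrow> label x i = 1)"
      using p by (simp_all add: label_def)
    obtain q where q: "\<forall>i<n. q i < p" "\<forall>i<n. \<exists>r s. (\<forall>j<n. q j \<le> r j \<and> r j \<le> q j + 1) \<and>
        (\<forall>j<n. q j \<le> s j \<and> s j \<le> q j + 1) \<and> label r i \<noteq> label s i"
      using kuhn_lemma[OF p k] by blast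
    show ?thesis
    proof (rule exI[of _ q], intro conjI[OF q(1)] allI impI)
      fix i assume i: "i < n"
      obtain r s where rs: "\<forall>j<n. q j \<le> r j \<and> r j \<le> q j + 1"
        "\<forall>j<n. q j \<le> s j \<and> s j \<le> q j + 1" "label r i \<noteq> label s i" using q(2) i by blast
      have b: "\<forall>i<n. r i \<le> p" "\<forall>i<n. s i \<le> p"
        using rs(1,2) q(1) by (metis Suc_leI Suc_eq_plus1 le_trans)+
      have "label r i = 0 \<and> label s i = 1 \<or> label r i = 1 \<and> label s i = 0"
        using rs(3) by (auto simp: label_def split: if_splits)
      then show "\<exists>r s. (\<forall>j<n. q j \<le> r j \<and> r j \<le> q j + 1) \<and>
        (\<forall>j<n. q j \<le> s j \<and> s j \<le> q j + 1) \<and> G i (scale p r) \<le> 0 \<and> 0 \<le> G i (scale p s)"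
        using l0 l1 b rs i by metis
    qed
  qed
  then have "\<forall>p. \<exists>q. (\<forall>i<n. q i < Suc p) \<and> (\<forall>i<n. \<exists>r s. (\<forall>j<n. q j \<le> r j \<and> r j \<le> q j + 1) \<and>
        (\<forall>j<n. q j \<le> s j \<and> s j \<le> q j + 1) \<and> G i (scale (Suc p) r) \<le> 0 \<and> 0 \<le> G i (scale (Suc p) s))"
    by blast
  then obtain q where q: "\<And>p i. i < n \<Longrightarrow> q p i < Suc p"
    and q2: "\<And>p i. i < n \<Longrightarrow> \<exists>r s. (\<forall>j<n. q p j \<le> r j \<and> r j \<le> q p j + 1) \<and>
        (\<forall>j<n. q p j \<le> s j \<and> s j \<le> q p j + 1) \<and> G i (scale (Suc p) r) \<le> 0 \<and> 0 \<le> G i (scale (Suc p) s)"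
    by metis
  have "compact (PiE UNIV (\<lambda>_::nat. {0..R}))"
    using compactin_PiE[of "\<lambda>_::nat. euclidean::real topology" UNIV "\<lambda>_. {0..R}"]
    by (simp add: euclidean_product_topology)
  then have sc: "seq_compact (PiE UNIV (\<lambda>_::nat. {0..R}))" by (rule compact_imp_seq_compact)
  have "scale (Suc p) (q p) \<in> PiE UNIV (\<lambda>_::nat. {0..R})" for p
    using box[of "Suc p" "q p"] q[of _ p] by (simp add: PiE_def less_imp_le)
  then have "\<forall>p. (\<lambda>p. scale (Suc p) (q p)) p \<in> PiE UNIV (\<lambda>_::nat. {0..R})" by blast
  from seq_compactE[OF sc this] obtain z f where z: "z \<in> PiE UNIV (\<lambda>_::nat. {0..R})"
    and f: "strict_mono f" and lim: "((\<lambda>p. scale (Suc p) (q p)) \<circ> f) \<longlonglongrightarrow> z"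
    by blast
  have coord: "(s \<longlonglongrightarrow> z) \<longleftrightarrow> (\<forall>j. (\<lambda>p. s p j) \<longlonglongrightarrow> z j)" for s and z :: "nat \<Rightarrow> real"
    using limitin_componentwise[of "\<lambda>_::nat. euclidean::real topology" UNIV s z sequentially]
    by (simp add: euclidean_product_topology)
  have near: "(\<lambda>p. scale (Suc (f p)) (r p)) \<longlonglongrightarrow> z"
    if r: "\<And>p j. j < n \<Longrightarrow> q (f p) j \<le> r p j \<and> r p j \<le> q (f p) j + 1" for r
    unfolding coord
  proof
    fix j
    have l: "(\<lambda>p. scale (Suc (f p)) (q (f p)) j) \<longlonglongrightarrow> z j"
      using lim unfolding o_def coord by blast
    show "(\<lambda>p. scale (Suc (f p)) (r p) j) \<longlonglongrightarrow> z j"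
    proof (cases "j < n")
      case True
      have "(\<lambda>p. inverse (real (Suc (f p)))) \<longlonglongrightarrow> 0"
        using LIMSEQ_subseq_LIMSEQ[OF LIMSEQ_inverse_real_of_nat f] by (simp add: o_def)
      then have "(\<lambda>p. scale (Suc (f p)) (q (f p)) j + R * inverse (real (Suc (f p)))) \<longlonglongrightarrow> z j + R * 0"
        using l by (intro tendsto_intros)
      then have u: "(\<lambda>p. scale (Suc (f p)) (q (f p)) j + R * inverse (real (Suc (f p)))) \<longlonglongrightarrow> z j" by simp
      have *: "scale (Suc (f p)) (q (f p)) j \<le> scale (Suc (f p)) (r p) j \<and>
          scale (Suc (f p)) (r p) j \<le> scale (Suc (f p)) (q (f p)) j + R * inverse (real (Suc (f p)))" for p
      proof -
        have "real (q (f p) j) \<le> real (r p j)" "real (r p j) \<le> real (q (f p) j) + 1"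
          using r[OF True, of p] by linarith+
        then have "R * real (q (f p) j) \<le> R * real (r p j)" "R * real (r p j) \<le> R * real (q (f p) j) + R"
          using R by (auto simp: algebra_simps dest: mult_left_mono[of _ _ R])
        then show ?thesis
          using True by (simp add: scale_def divide_simps)
      qed
      show ?thesis
        by (rule tendsto_sandwich[OF _ _ l u]) (use * in auto)
    next
      case False
      then show ?thesis using l by (simp add: scale_def)
    qed
  qed
  have "G i z = 0" if i: "i < n" for i
  proof -
    have "\<forall>p. \<exists>r s. (\<forall>j<n. q (f p) j \<le> r j \<and> r j \<le> q (f p) j + 1) \<and>
        (\<forall>j<n. q (f p) j \<le> s j \<and> s j \<le> q (f p) j + 1) \<and>
        G i (scale (Suc (f p)) r) \<le> 0 \<and> 0 \<le> G i (scale (Suc (f p)) s)"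
      using q2[OF i] by blast
    then obtain r s where rs: "\<And>p j. j < n \<Longrightarrow> q (f p) j \<le> r p j \<and> r p j \<le> q (f p) j + 1"
       "\<And>p j. j < n \<Longrightarrow> q (f p) j \<le> s p j \<and> s p j \<le> q (f p) j + 1"
       "\<And>p. G i (scale (Suc (f p)) (r p)) \<le> 0" "\<And>p. 0 \<le> G i (scale (Suc (f p)) (s p))"
      by (simp only: choice_iff) blast
    have c: "isCont (G i) z" using cont[OF i] by (simp add: continuous_on_eq_continuous_at)
    have "(\<lambda>p. G i (scale (Suc (f p)) (r p))) \<longlonglongrightarrow> G i z"
      using isCont_tendsto_compose[OF c near[OF rs(1)]] .
    then have "G i z \<le> 0" by (rule LIMSEQ_le_const2) (use rs in auto)
    moreover have "(\<lambda>p. G i (scale (Suc (f p)) (s p))) \<longlonglongrightarrow> G i z"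
      using isCont_tendsto_compose[OF c near[OF rs(2)]] .
    then have "0 \<le> G i z" by (rule LIMSEQ_le_const) (use rs in auto)
    ultimately show ?thesis by simp
  qed
  then show thesis using that[of z] z by (auto simp: PiE_def Pi_def)
qed

definition antiderivative :: "real poly \<Rightarrow> real poly" where
  "antiderivative q = (\<Sum>i\<le>degree q. monom (coeff q i / (1 + real i)) (Suc i))"

lemma pderiv_antiderivative: "pderiv (antiderivative q) = q"
proof -
  have "pderiv (antiderivative q) = (\<Sum>i\<le>degree q. monom (coeff q i) i)"
    unfolding antiderivative_def by (simp add: higher_pderiv_sum[of 1, simplified] pderiv_monom)
  also have "\<dots> = q" by (rule poly_as_sum_of_monoms)
  finally show ?thesis .
qed

lemma continuous_coeff_prod:
  fixes c :: "nat \<Rightarrow> 'a::topological_space \<Rightarrow> real"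
  assumes "\<And>j. continuous_on UNIV (c j)"
  shows "continuous_on UNIV (\<lambda>x. coeff (\<Prod>j<m. [:- c j x, 1:]) i)"
proof (induction m arbitrary: i)
  case (Suc m)
  have "coeff (\<Prod>j<Suc m. [:- c j x, 1:]) i =
      (case i of 0 \<Rightarrow> 0 | Suc i' \<Rightarrow> coeff (\<Prod>j<m. [:- c j x, 1:]) i') - c m x * coeff (\<Prod>j<m. [:- c j x, 1:]) i" for x
    by (simp add: mult.commute[of "prod _ _"] coeff_pCons algebra_simps split: nat.splits)
  then show ?case
    using Suc assms by (cases i) (auto intro!: continuous_intros)
qed simp

lemma degree_prod_linear: "degree (\<Prod>j<m. [:- c j, 1::real:]) = m"
  by (subst degree_prod_eq_sum_degree) auto

text \<open>The unknowns are the gaps \<open>l i = x (i + 1) - x i\<close>, and the variation of \<open>Q\<close> over the \<open>i\<close>-th gap is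
the integral of \<open>\<Prod>j. \<bar>y - x j\<bar>\<close>. It vanishes if the gap does, and if the gap is large, it is large
whatever the other gaps are, since on the middle third all factors are at least a third of the gap. So
Poincare-Miranda applies.\<close>

lemma prescribed_critical_values:
  fixes v :: "nat \<Rightarrow> real"
  assumes v: "\<And>i. i < n \<Longrightarrow> v i > 0"
  obtains x :: "nat \<Rightarrow> real" and Q :: "real poly"
  where "\<And>i. i < n \<Longrightarrow> x i < x (Suc i)" "pderiv Q = (\<Prod>j<Suc n. [:- x j, 1:])"
    "\<And>i. i < n \<Longrightarrow> poly Q (x (Suc i)) - poly Q (x i) = (-1) ^ (n - i) * v i"
proof -
  define x :: "(nat \<Rightarrow> real) \<Rightarrow> nat \<Rightarrow> real" where "x = (\<lambda>l j. \<Sum>i<j. l i)"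
  define q where "q = (\<lambda>l. \<Prod>j<Suc n. [:- x l j, 1:])"
  define Q where "Q = (\<lambda>l. antiderivative (q l))"
  define W where "W = (\<lambda>i l. (-1) ^ (n - i) * (poly (Q l) (x l (Suc i)) - poly (Q l) (x l i)))"
  have x_Suc: "x l (Suc i) = x l i + l i" for l i by (simp add: x_def)
  have cx: "continuous_on UNIV (\<lambda>l. x l j)" for j
    unfolding x_def by (intro continuous_intros continuous_on_product_coordinates)
  have cq: "continuous_on UNIV (\<lambda>l. coeff (q l) i)" for i
    unfolding q_def using cx by (rule continuous_coeff_prod)
  have cW: "continuous_on UNIV (W i)" for i
  proof -
    have "poly (Q l) y = (\<Sum>i\<le>Suc n. coeff (q l) i / (1 + real i) * y ^ Suc i)" for l y
    proof -
      have d: "degree (q l) = Suc n" unfolding q_def by (rule degree_prod_linear)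
      show ?thesis unfolding Q_def antiderivative_def d by (simp add: poly_sum poly_monom)
    qed
    then show ?thesis
      unfolding W_def by (simp only:) (intro continuous_intros cx cq ballI; smt (verit) of_nat_0_le_iff)
  qed
  have mono: "x l i \<le> x l j" if "\<forall>j. 0 \<le> l j" "i \<le> j" for l i j
    unfolding x_def using that by (intro sum_mono2) auto
  have dQ: "DERIV (poly (Q l)) y :> poly (q l) y" for l y
    using poly_DERIV[of "Q l" y] by (simp add: Q_def pderiv_antiderivative)
  have sign: "(-1) ^ (n - i) * poly (q l) y = (\<Prod>j<Suc n. \<bar>y - x l j\<bar>)"
    if l: "\<forall>j. 0 \<le> l j" and i: "i < n" and y: "x l i \<le> y" "y \<le> x l (Suc i)" for l i y
  proof -
    have split: "(\<Prod>j<Suc n. f j) = (\<Prod>j\<le>i. f j) * (\<Prod>j\<in>{Suc i..n}. f j)" for f :: "nat \<Rightarrow> real"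
    proof -
      have "{..<Suc n} = {..i} \<union> {Suc i..n}" using i by auto
      then show ?thesis by (simp only:) (rule prod.union_disjoint, auto)
    qed
    have "(\<Prod>j\<in>{Suc i..n}. \<bar>y - x l j\<bar>) = (\<Prod>j\<in>{Suc i..n}. - (y - x l j))"
      using mono[OF l, of "Suc i"] y by (intro prod.cong) force+
    also have "\<dots> = (-1) ^ (n - i) * (\<Prod>j\<in>{Suc i..n}. y - x l j)"
      by (simp add: prod_uminus del: minus_diff_eq)
    finally have 1: "(\<Prod>j\<in>{Suc i..n}. \<bar>y - x l j\<bar>) = (-1) ^ (n - i) * (\<Prod>j\<in>{Suc i..n}. y - x l j)" .
    have 2: "(\<Prod>j\<le>i. \<bar>y - x l j\<bar>) = (\<Prod>j\<le>i. y - x l j)"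
      using mono[OF l, of _ i] y by (intro prod.cong) force+
    have "poly (q l) y = (\<Prod>j<Suc n. y - x l j)" by (simp only: q_def poly_prod) simp
    then show ?thesis unfolding split 1 2 by simp
  qed
  define M where "M = Max (insert 1 (v ` {..<n}))"
  have M: "1 \<le> M" "\<And>i. i < n \<Longrightarrow> v i \<le> M" by (auto simp: M_def)
  define R where "R = 3 * M"
  have R: "R > 0" using M by (simp add: R_def)
  have lower: "v i \<le> W i l" if l: "\<forall>j. 0 \<le> l j" and i: "i < n" and li: "l i = R" for l i
  proof -
    let ?F = "\<lambda>y. (-1) ^ (n - i) * poly (Q l) y"
    have dF: "(?F has_real_derivative (-1) ^ (n - i) * poly (q l) y) (at y)" for y
      by (intro DERIV_cmult dQ)
    have inc: "?F a \<le> ?F b" if "x l i \<le> a" "a \<le> b" "b \<le> x l (Suc i)" for a b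
    proof (rule DERIV_nonneg_imp_nondecreasing[OF that(2)])
      fix y assume "a \<le> y" "y \<le> b"
      moreover have "0 \<le> (\<Prod>j<Suc n. \<bar>y - x l j\<bar>)" by (rule prod_nonneg) simp
      ultimately show "\<exists>d. (?F has_real_derivative d) (at y) \<and> 0 \<le> d"
        using dF[of y] sign[OF l i, of y] that by (intro exI conjI) simp_all
    qed
    define a where "a = x l i + M"
    define b where "b = x l i + 2 * M"
    have b': "b = x l (Suc i) - M" using li by (simp add: x_Suc b_def R_def)
    have "\<exists>y. a < y \<and> y < b \<and> ?F b - ?F a = (b - a) * ((-1) ^ (n - i) * poly (q l) y)"
      using M by (intro MVT2 dF) (auto simp: a_def b_def)
    then obtain y where y: "a < y" "y < b" "?F b - ?F a = (b - a) * ((-1) ^ (n - i) * poly (q l) y)" by blast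
    have "M ^ Suc n = (\<Prod>j<Suc n. M)" by simp
    also have "\<dots> \<le> (\<Prod>j<Suc n. \<bar>y - x l j\<bar>)"
    proof (intro prod_mono conjI)
      fix j assume "j \<in> {..<Suc n}"
      show "M \<le> \<bar>y - x l j\<bar>"
      proof (cases "j \<le> i")
        case True
        then show ?thesis using mono[OF l True] y by (simp add: a_def)
      next
        case False
        then show ?thesis using mono[OF l, of "Suc i" j] y b' by simp
      qed
    qed (use M in auto)
    also have "\<dots> = (-1) ^ (n - i) * poly (q l) y"
      using sign[OF l i, of y] y M b' by (simp add: a_def)
    finally have "M ^ Suc n \<le> (-1) ^ (n - i) * poly (q l) y" .
    moreover have "1 \<le> M ^ Suc n" using M by (intro one_le_power) auto
    ultimately have "M * 1 \<le> (b - a) * ((-1) ^ (n - i) * poly (q l) y)"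
      using M by (intro mult_mono) (auto simp: a_def b_def)
    then have "M \<le> ?F b - ?F a" using y by simp
    also have "\<dots> \<le> ?F (x l (Suc i)) - ?F (x l i)"
      using inc[of "x l i" a] inc[of b "x l (Suc i)"] M b' by (auto simp: a_def b_def)
    also have "\<dots> = W i l" by (simp add: W_def right_diff_distrib)
    finally show ?thesis using M(2)[OF i] by simp
  qed
  obtain l where l: "\<And>j. 0 \<le> l j \<and> l j \<le> R" "\<And>i. i < n \<Longrightarrow> W i l - v i = 0"
  proof (rule poincare_miranda[of R n "\<lambda>i l. W i l - v i"])
    fix i l assume "i < n" "\<forall>j. 0 \<le> l j \<and> l j \<le> R" "l i = 0"
    then show "W i l - v i \<le> 0" using v[of i] by (simp add: W_def x_Suc)
  next
    fix i l assume "i < n" "\<forall>j. 0 \<le> l j \<and> l j \<le> R" "l i = R"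
    then show "0 \<le> W i l - v i" using lower[of l i] by simp
  qed (use R cW in \<open>auto intro!: continuous_intros\<close>)
  have pos: "l i > 0" if "i < n" for i
  proof (rule ccontr)
    assume "\<not> l i > 0"
    then have "l i = 0" using l(1)[of i] by simp
    then show False using l(2)[OF that] v[OF that] by (simp add: W_def x_Suc)
  qed
  show thesis
  proof (rule that[of "x l" "Q l"])
    show "poly (Q l) (x l (Suc i)) - poly (Q l) (x l i) = (-1) ^ (n - i) * v i" if "i < n" for i
    proof -
      have "v i = (-1) ^ (n - i) * (poly (Q l) (x l (Suc i)) - poly (Q l) (x l i))"
        using l(2)[OF that] by (simp add: W_def)
      then show ?thesis by (simp flip: mult.assoc power_add)
    qed
  qed (use pos in \<open>auto simp: x_Suc Q_def q_def pderiv_antiderivative\<close>)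
qed


section \<open>A totally real solution of the Pell-Abel equation\<close>

lemma double_roots_factor:
  fixes P :: "real poly"
  assumes "finite S" "\<And>b. b \<in> S \<Longrightarrow> poly P b = 0 \<and> poly (pderiv P) b = 0"
  shows "\<exists>C. P = C * (\<Prod>b\<in>S. [:- b, 1:])\<^sup>2"
  using assms
proof (induction S arbitrary: P rule: finite_induct)
  case (insert a S)
  obtain P1 where P1: "P = [:- a, 1:] * P1" using insert.prems by (meson dvdE insertI1 poly_eq_0_iff_dvd)
  have "poly (pderiv P) a = poly P1 a" unfolding P1 pderiv_mult by (simp add: pderiv_pCons)
  then have "poly P1 a = 0" using insert.prems by simp
  then obtain C0 where C0: "P1 = [:- a, 1:] * C0" by (meson dvdE poly_eq_0_iff_dvd)
  have P: "P = C0 * [:- a, 1:]\<^sup>2" by (simp only: P1 C0 power2_eq_square mult_ac)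
  have "poly C0 b = 0 \<and> poly (pderiv C0) b = 0" if "b \<in> S" for b
  proof -
    have ab: "b \<noteq> a" using that insert.hyps by auto
    have z: "poly P b = 0" "poly (pderiv P) b = 0" using insert.prems that by auto
    have c: "poly C0 b = 0" using z(1) ab by (simp add: P)
    have "poly (pderiv P) b = poly (pderiv C0) b * (b - a)\<^sup>2"
      unfolding P pderiv_mult using c by simp
    then show ?thesis using z ab c by simp
  qed
  then obtain C where "C0 = C * (\<Prod>b\<in>S. [:- b, 1:])\<^sup>2" using insert.IH by blast
  then have "P = C * (\<Prod>b\<in>insert a S. [:- b, 1:])\<^sup>2"
    unfolding P by (simp only: prod.insert[OF insert.hyps(1,2)] power_mult_distrib mult_ac)
  then show ?case by blast
qed auto

lemma poly_intermediate:
  fixes p :: "real poly"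
  assumes "a < b" "(poly p a - t) * (poly p b - t) < 0"
  obtains x where "a < x" "x < b" "poly p x = t"
  using poly_IVT[of a b "p - [:t:]"] assms by auto

lemma diff_const_poly:
  fixes p :: "real poly"
  assumes "degree p > 0"
  shows "degree (p - [:c:]) = degree p" "lead_coeff (p - [:c:]) = lead_coeff p"
proof -
  show "degree (p - [:c:]) = degree p"
    using degree_add_eq_left[of "- [:c:]" p] assms by (simp flip: diff_conv_add_uminus del: minus_pCons)
  then show "lead_coeff (p - [:c:]) = lead_coeff p"
    using assms by (simp add: coeff_pCons split: nat.splits)
qed

text \<open>The critical values of \<open>A\<close> are \<open>\<plusminus>2\<close> at \<open>x 0, \<dots>, x (g - 1)\<close> and \<open>\<plusminus>1\<close> at \<open>x g, \<dots>, x n\<close>, with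
alternating signs. The intermediate value theorem gives two solutions of \<open>A\<^sup>2 = 1\<close> in each of the \<open>g\<close>
intervals ending at some \<open>x i\<close> with \<open>i < g\<close>, one to the right of \<open>x (g - 1)\<close> before the double zeros
begin, and one to the right of them. By degree, there are no others.\<close>

lemma real_pell_abel_solution:
  assumes g: "g \<ge> 1" and N: "N \<ge> g + 1"
  obtains A B D :: "real poly" and a b :: real where
    "degree A = N" "A\<^sup>2 - 1 = D * B\<^sup>2" "degree D = 2 * g + 2" "card {x. poly D x = 0} = 2 * g + 2"
    "a < b" "poly D a = 0" "poly D b = 0" "poly A a = - poly A b" "\<bar>poly A a\<bar> = 1"
    "\<And>x. a < x \<Longrightarrow> x < b \<Longrightarrow> \<bar>poly A x\<bar> < 1"
proof -
  define n where "n = N - 2"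
  have nN: "N = n + 2" and gn: "g \<le> Suc n" using g N by (auto simp: n_def)
  define c :: "nat \<Rightarrow> real" where "c = (\<lambda>i. if i < g then 2 else 1)"
  have c1: "c i \<ge> 1" for i by (simp add: c_def)
  obtain x Q where x: "\<And>i. i < n \<Longrightarrow> x i < x (Suc i)" and Q: "pderiv Q = (\<Prod>j<Suc n. [:- x j, 1:])"
    and Qx: "\<And>i. i < n \<Longrightarrow> poly Q (x (Suc i)) - poly Q (x i) = (-1) ^ (n - i) * (c i + c (Suc i))"
    by (rule prescribed_critical_values[of n "\<lambda>i. c i + c (Suc i)"]) (use c1 in \<open>auto simp: add_pos_pos c_def\<close>)
  have x_less: "x i < x j" if "i < j" "j \<le> n" for i j
    using that
  proof (induction j)
    case (Suc j)
    then show ?case using x[of j] by (cases "i = j") auto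
  qed simp
  define A where "A = Q - [:poly Q (x 0) - (-1) ^ Suc n * c 0:]"
  have dA: "pderiv A = (\<Prod>j<Suc n. [:- x j, 1:])" by (simp only: A_def pderiv_diff Q) simp
  have degA: "degree A = N"
  proof -
    have "degree (pderiv A) = Suc n" unfolding dA by (rule degree_prod_linear)
    then show ?thesis unfolding nN degree_pderiv by simp
  qed
  have lcA: "lead_coeff A > 0"
  proof -
    have "coeff (pderiv A) (Suc n) = 1"
      using lead_coeff_prod[of "\<lambda>j. [:- x j, 1:]" "{..<Suc n}"] degree_prod_linear[of x "Suc n"]
      by (simp add: dA del: prod.lessThan_Suc)
    then have "real (n + 2) * coeff A (n + 2) = 1" by (simp add: coeff_pderiv)
    then have "coeff A (n + 2) = 1 / real (n + 2)" by (simp add: eq_divide_eq mult.commute)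
    then show ?thesis using degA nN by simp
  qed
  have val: "poly A (x i) = (-1) ^ (Suc n - i) * c i" if "i \<le> n" for i
    using that
  proof (induction i)
    case (Suc i)
    have "poly A (x (Suc i)) = poly A (x i) + (-1) ^ (n - i) * (c i + c (Suc i))"
      using Qx[of i] Suc.prems by (simp add: A_def)
    moreover have "Suc n - i = Suc (n - i)" using Suc.prems by simp
    ultimately show ?case using Suc by (simp add: algebra_simps)
  qed (simp add: A_def)
  obtain X where X: "X > x n" "poly A X > 2"
  proof -
    have "lead_coeff (A - [:2:]) > 0"
      using lcA degA nN diff_const_poly[of A 2] by simp
    then obtain K where "\<And>x. x \<ge> K \<Longrightarrow> poly (A - [:2:]) x \<ge> lead_coeff (A - [:2:])" "lead_coeff (A - [:2:]) > 0"
      using poly_pinfty_gt_lc[of "A - [:2:]"] by blast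
    then have "poly (A - [:2:]) (max K (x n + 1)) > 0" by (meson less_le_trans max.cobounded1)
    then show thesis using that[of "max K (x n + 1)"] by simp
  qed
  obtain Y where Y: "Y < x 0" "(-1) ^ N * poly A Y > 2"
  proof -
    define p where "p = smult ((-1) ^ N) (pcompose A [:0, -1:])"
    have "lead_coeff (pcompose A [:0, -1:]) = (-1) ^ N * lead_coeff A"
      using lead_coeff_comp[of "[:0, -1:]" A] degA by (simp add: mult.commute)
    then have "lead_coeff p = lead_coeff A"
      by (simp add: p_def flip: mult.assoc power_mult_distrib)
    then have lp: "lead_coeff p > 0" "degree p = N"
      using lcA degA by (auto simp: p_def degree_pcompose)
    have "lead_coeff (p - [:2:]) > 0"
      using lp nN diff_const_poly[of p 2] by simp
    then obtain K where K: "\<And>x. x \<ge> K \<Longrightarrow> poly (p - [:2:]) x \<ge> lead_coeff (p - [:2:])" "lead_coeff (p - [:2:]) > 0"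
      using poly_pinfty_gt_lc[of "p - [:2:]"] by blast
    have "poly (p - [:2:]) (max K (1 - x 0)) > 0"
      using K by (meson less_le_trans max.cobounded1)
    then have "poly p (max K (1 - x 0)) > 2" by simp
    moreover have "poly p y = (-1) ^ N * poly A (- y)" for y by (simp add: p_def poly_pcompose)
    ultimately show thesis using that[of "- max K (1 - x 0)"] by simp
  qed
  define lft where "lft = (\<lambda>i. if i = 0 then Y else x (i - 1))"
  have lft: "lft i < x i" if "i < g" for i
    using Y(1) x_less[of "i - 1" i] that gn by (auto simp: lft_def)
  have band: "(poly A (lft i) - t) * (poly A (x i) - t) < 0" if i: "i < g" and t: "\<bar>t\<bar> = 1" for i t
  proof -
    define s :: real where "s = (-1) ^ (Suc n - i)"
    have s: "s = 1 \<or> s = -1" unfolding s_def by (metis neg_one_even_power neg_one_odd_power)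
    have 1: "poly A (x i) = 2 * s" using val[of i] i gn by (simp add: c_def s_def)
    have 2: "- s * poly A (lft i) \<ge> 2"
    proof (cases "i = 0")
      case True
      then show ?thesis using Y(2) by (simp add: s_def lft_def nN)
    next
      case False
      then have "Suc n - (i - 1) = Suc (Suc n - i)" using i gn by simp
      then have "poly A (lft i) = - s * 2" using False i gn val[of "i - 1"] by (simp add: lft_def s_def c_def)
      then show ?thesis using s by auto
    qed
    from s 1 2 t show ?thesis by (auto simp: abs_if mult_neg_pos mult_pos_neg split: if_splits)
  qed
  have "\<exists>a b. \<forall>i<g. lft i < a i \<and> a i < x i \<and> poly A (a i) = 1 \<and> lft i < b i \<and> b i < x i \<and> poly A (b i) = -1"
  proof -
    have "\<exists>u w. lft i < u \<and> u < x i \<and> poly A u = 1 \<and> lft i < w \<and> w < x i \<and> poly A w = -1" if "i < g" for i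
      using poly_intermediate[OF lft[OF that] band[OF that, of 1]]
        poly_intermediate[OF lft[OF that] band[OF that, of "-1"]] by (metis abs_minus_cancel abs_one)
    then show ?thesis by metis
  qed
  then obtain a b where ab: "\<And>i. i < g \<Longrightarrow> lft i < a i \<and> a i < x i \<and> poly A (a i) = 1"
    "\<And>i. i < g \<Longrightarrow> lft i < b i \<and> b i < x i \<and> poly A (b i) = -1" by metis
  \<comment> \<open>The sign of \<open>A\<close> at \<open>x (g - 1)\<close>: going right from there, \<open>A\<close> takes the value \<open>\<tau>\<close> before it reaches
    \<open>x g\<close>. If \<open>g = n + 1\<close>, then \<open>x (g - 1)\<close> is the last critical point and \<open>\<tau> = -1\<close>.\<close>
  define \<tau> :: real where "\<tau> = (-1) ^ (n + 2 - g)"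
  have \<tau>: "\<tau> = 1 \<or> \<tau> = -1" unfolding \<tau>_def by (metis neg_one_even_power neg_one_odd_power)
  have v\<tau>: "poly A (x (g - 1)) = 2 * \<tau>"
  proof -
    have "Suc n - (g - 1) = n + 2 - g" using g by simp
    then show ?thesis using val[of "g - 1"] g gn by (simp add: c_def \<tau>_def)
  qed
  obtain e where e: "x (g - 1) < e" "poly A e = \<tau>" "g \<le> n \<Longrightarrow> e < x g"
  proof (cases "g \<le> n")
    case True
    have "n + 2 - g = Suc (Suc n - g)" using gn by simp
    then have "\<tau> = - ((-1) ^ (Suc n - g))" by (simp only: \<tau>_def power_Suc)
    then have "poly A (x g) = - \<tau>" using val[OF True] by (simp add: c_def)
    then have "(poly A (x (g - 1)) - \<tau>) * (poly A (x g) - \<tau>) < 0" using v\<tau> \<tau> by auto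
    moreover have "x (g - 1) < x g" using x_less[of "g - 1" g] g True by simp
    ultimately show thesis using poly_intermediate that by metis
  next
    case False
    then have gn': "g = Suc n" using gn by simp
    have t: "\<tau> = -1" by (simp add: \<tau>_def gn')
    have "(poly A (x (g - 1)) - \<tau>) * (poly A X - \<tau>) < 0" using v\<tau> t X(2) by (simp add: mult_neg_pos)
    moreover have "x (g - 1) < X" using X gn' by simp
    ultimately show thesis using poly_intermediate that False by metis
  qed
  obtain e' where e': "x n < e'" "poly A e' = 1"
  proof -
    have "poly A (x n) = - c n" using val[of n] by simp
    then have "(poly A (x n) - 1) * (poly A X - 1) < 0" using c1[of n] X(2) by (simp add: mult_neg_pos)
    then show thesis using poly_intermediate X(1) that by metis
  qed
  have x_le: "x i \<le> x j" if "i \<le> j" "j \<le> n" for i j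
    using x_less[of i j] that by (cases "i = j") auto
  define E where "E = insert e (insert e' (a ` {..<g} \<union> b ` {..<g}))"
  have ablt: "a i < x (g - 1)" "b i < x (g - 1)" if "i < g" for i
    using ab(1,2)[OF that] x_le[of i "g - 1"] that gn by linarith+
  have xg: "x (g - 1) \<le> x n" using x_le[of "g - 1" n] gn by simp
  have ne: "e \<noteq> e'"
  proof (cases "g \<le> n")
    case True
    then show ?thesis using e(3) e'(1) x_le[of g n] by simp
  next
    case False
    then have "g = Suc n" using gn by simp
    then have "\<tau> = -1" by (simp add: \<tau>_def)
    then show ?thesis using e e' by auto
  qed
  have inj: "inj_on f {..<g}" if f: "\<And>i. i < g \<Longrightarrow> lft i < f i \<and> f i < x i" for f :: "nat \<Rightarrow> real"
  proof (rule linorder_inj_onI)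
    fix i j assume ij: "i < j" "i \<in> {..<g}" "j \<in> {..<g}"
    then have "x i \<le> lft j" using x_le[of i "j - 1"] gn by (auto simp: lft_def)
    then show "f i \<noteq> f j" using f[of i] f[of j] ij by simp
  qed auto
  have cardE: "card E = 2 * g + 2"
  proof -
    have "a ` {..<g} \<inter> b ` {..<g} = {}" using ab by fastforce
    moreover have "card (a ` {..<g}) = g" "card (b ` {..<g}) = g"
      using inj[of a] inj[of b] ab by (auto simp: card_image)
    ultimately have "card (a ` {..<g} \<union> b ` {..<g}) = 2 * g"
      by (subst card_Un_disjoint) auto
    moreover have "e' \<notin> a ` {..<g} \<union> b ` {..<g}" "e \<notin> a ` {..<g} \<union> b ` {..<g}"
      using ablt e(1) e'(1) xg by fastforce+
    ultimately show ?thesis using ne by (simp add: E_def)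
  qed
  define S where "S = x ` {g..n}"
  define B where "B = (\<Prod>s\<in>S. [:- s, 1:])"
  have "\<exists>D. A\<^sup>2 - 1 = D * B\<^sup>2"
    unfolding B_def
  proof (rule double_roots_factor)
    fix s assume "s \<in> S"
    then obtain i where i: "g \<le> i" "i \<le> n" "s = x i" by (auto simp: S_def)
    have "(poly A s)\<^sup>2 = 1" using val[OF i(2)] i by (simp add: c_def flip: power_mult)
    moreover have "poly (pderiv A) s = 0" unfolding dA using i by (simp only: poly_prod) (auto intro!: prod_zero bexI[of _ i] simp del: prod.lessThan_Suc)
    ultimately show "poly (A\<^sup>2 - 1) s = 0 \<and> poly (pderiv (A\<^sup>2 - 1)) s = 0"
      by (simp add: power2_eq_square pderiv_diff pderiv_mult)
  qed (simp add: S_def)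
  then obtain D where D: "A\<^sup>2 - 1 = D * B\<^sup>2" by blast
  have degB: "degree B = Suc n - g"
  proof -
    have "inj_on x {g..n}" using x_less by (intro linorder_inj_onI) force+
    then have "card S = Suc n - g" by (simp add: S_def card_image)
    moreover have "degree B = card S" unfolding B_def by (subst degree_prod_eq_sum_degree) auto
    ultimately show ?thesis by simp
  qed
  have degA2: "degree (A\<^sup>2 - 1) = 2 * N"
  proof -
    have "A \<noteq> 0" using degA nN by auto
    then have "degree (A\<^sup>2) = 2 * N" using degA by (simp add: degree_power_eq)
    then show ?thesis using nN diff_const_poly[of "A\<^sup>2" 1] by (simp add: one_pCons)
  qed
  then have nz: "A\<^sup>2 - 1 \<noteq> 0" using nN by auto
  then have nz': "D \<noteq> 0" "B \<noteq> 0" using D by auto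
  have degD: "degree D = 2 * g + 2"
    using degA2 degB nz' gn nN unfolding D by (simp add: degree_mult_eq degree_power_eq)
  have rootA: "(poly A z)\<^sup>2 - 1 = poly D z * (poly B z)\<^sup>2" for z
    using arg_cong[OF D, of "\<lambda>p. poly p z"] by simp
  have rootB: "poly B z = 0 \<longleftrightarrow> z \<in> S" for z by (simp add: B_def poly_prod S_def)
  have Sge: "x (g - 1) < s" if "s \<in> S" for s
    using that x_less[of "g - 1"] g by (auto simp: S_def)
  have "E \<subseteq> {z. poly D z = 0}"
  proof
    fix z assume z: "z \<in> E"
    have "(poly A z)\<^sup>2 = 1" using z ab e e' \<tau> by (auto simp: E_def)
    moreover have "z \<notin> S"
      using z Sge ablt e'(1) e(3) x_le[of g] x_le[of _ n] unfolding E_def by (fastforce simp: S_def)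
    ultimately show "z \<in> {z. poly D z = 0}" using rootA[of z] rootB[of z] by auto
  qed
  moreover have fin: "finite {z. poly D z = 0}" using nz' by (simp add: poly_roots_finite)
  moreover have "card {z. poly D z = 0} \<le> 2 * g + 2"
    using card_poly_roots_bound[OF nz'(1)] degD nz' by simp
  ultimately have E: "{z. poly D z = 0} = E" using cardE by (metis card_seteq)
  have g0: "0 < g" and x0: "x 0 \<le> x (g - 1)" using g gn x_le[of 0 "g - 1"] by auto
  \<comment> \<open>The leftmost interval contains none of the double zeros.\<close>
  have inner: "\<bar>poly A z\<bar> < 1" if z: "min (a 0) (b 0) < z" "z < max (a 0) (b 0)" for z
  proof -
    have no: "(poly A w)\<^sup>2 \<noteq> 1" if w: "min (a 0) (b 0) < w" "w < max (a 0) (b 0)" for w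
    proof
      assume "(poly A w)\<^sup>2 = 1"
      then have "w \<in> E \<or> w \<in> S" using rootA[of w] rootB E by auto
      moreover have w0: "w < x 0" using w ab(1,2)[OF g0] by auto
      then have "w \<notin> S" using Sge[of w] x0 by auto
      moreover have "w \<noteq> e" "w \<noteq> e'" using w0 e(1) e'(1) x0 xg by auto
      moreover have "w \<noteq> a i \<and> w \<noteq> b i" if "i < g" for i
      proof (cases "i = 0")
        case False
        then have "x 0 \<le> lft i" using x_le[of 0 "i - 1"] that gn by (auto simp: lft_def)
        then show ?thesis using w0 ab(1,2)[OF that] by auto
      qed (use w in auto)
      ultimately show False by (auto simp: E_def)
    qed
    have A01: "poly A (a 0) = 1" "poly A (b 0) = -1" using ab g0 by auto
    have less: "a 0 < z \<and> z < b 0 \<or> b 0 < z \<and> z < a 0" using z by (auto simp: min_def max_def split: if_splits)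
    have "poly A z \<noteq> 1" "poly A z \<noteq> -1" using no[OF z] by auto
    moreover have "\<not> poly A z > 1"
    proof
      assume "poly A z > 1"
      then have "(poly A z - 1) * (poly A (b 0) - 1) < 0" "(poly A (b 0) - 1) * (poly A z - 1) < 0"
        using A01 by (auto simp: mult_pos_neg mult_neg_pos)
      then obtain w where "poly A w = 1" "z < w \<and> w < b 0 \<or> b 0 < w \<and> w < z"
        using poly_intermediate less by metis
      then show False using no[of w] z less by auto
    qed
    moreover have "\<not> poly A z < -1"
    proof
      assume "poly A z < -1"
      then have "(poly A z - -1) * (poly A (a 0) - -1) < 0" "(poly A (a 0) - -1) * (poly A z - -1) < 0"
        using A01 by (auto simp: mult_pos_neg mult_neg_pos)
      then obtain w where "poly A w = -1" "z < w \<and> w < a 0 \<or> a 0 < w \<and> w < z"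
        using poly_intermediate less by metis
      then show False using no[of w] z less by auto
    qed
    ultimately show ?thesis by auto
  qed
  show thesis
  proof (rule that[of A D B "min (a 0) (b 0)" "max (a 0) (b 0)"])
    have A01: "poly A (a 0) = 1" "poly A (b 0) = -1" using ab g0 by auto
    then have "a 0 \<noteq> b 0" by auto
    then show "min (a 0) (b 0) < max (a 0) (b 0)" by (auto simp: min_def max_def)
    show "poly A (min (a 0) (b 0)) = - poly A (max (a 0) (b 0))" "\<bar>poly A (min (a 0) (b 0))\<bar> = 1"
      using A01 by (auto simp: min_def max_def)
    have "a 0 \<in> E" "b 0 \<in> E" using g0 by (auto simp: E_def)
    then have "poly D (a 0) = 0" "poly D (b 0) = 0" using E by auto
    then show "poly D (min (a 0) (b 0)) = 0" "poly D (max (a 0) (b 0)) = 0" by (auto simp: min_def max_def)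
  qed (use degA D degD E cardE inner in auto)
qed


section \<open>The form dx/y in the charts of the curve\<close>

text \<open>The coefficient of \<open>dx / y = 2 dy / P' x\<close> with respect to the coordinate \<open>\<phi>\<close>. The two expressions
agree as \<open>2 y dy = P' x dx\<close> on the curve, and in each kind of chart the denominator does not vanish.\<close>

definition theta :: "complex poly \<Rightarrow> (complex \<times> complex \<Rightarrow> complex) \<Rightarrow> complex \<times> complex \<Rightarrow> complex" where
  "theta P \<phi> q = (if \<phi> = fst then 1 / snd q else 2 / poly (pderiv P) (fst q))"

lemma fst_neq_snd: "(fst :: complex \<times> complex \<Rightarrow> complex) \<noteq> snd"
  by (metis fst_conv snd_conv zero_neq_one)

lemma theta_simps [simp]:
  "theta P fst q = 1 / snd q" "theta P snd q = 2 / poly (pderiv P) (fst q)"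
  using fst_neq_snd by (auto simp: theta_def)

lemma theta_nonzero:
  assumes "(V, \<phi>) \<in> affine_charts P" "q \<in> V"
  shows "theta P \<phi> q \<noteq> 0"
  using assms by (auto simp: affine_charts_def)

lemma DERIV_transfer_ev:
  assumes "(f has_field_derivative a) (at z)" "\<forall>\<^sub>F w in nhds z. f w = g w"
  shows "(g has_field_derivative a) (at z)"
  using assms DERIV_cong_ev[OF refl assms(2) refl] by blast

lemma DERIV_divide_power:
  fixes f h :: "complex \<Rightarrow> complex"
  assumes "(f has_field_derivative F) (at z)" "(h has_field_derivative H) (at z)" "f z \<noteq> 0"
  shows "((\<lambda>z. h z / f z ^ j) has_field_derivative
    (H * f z ^ j - h z * (of_nat j * f z ^ (j - 1) * F)) / (f z ^ j * f z ^ j)) (at z)"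
  using assms by (auto intro!: derivative_eq_intros)

text \<open>In any chart, \<open>dx = y \<theta>\<close> and \<open>dy = P' x / 2 \<theta>\<close> for \<open>\<theta> = dx / y\<close>. Stated like this, the
formulas hold for both kinds of charts, also where \<open>y\<close> or \<open>P' x\<close> vanishes.\<close>

lemma chart_parametrization:
  assumes P: "rsquarefree P" and c: "(V, \<phi>) \<in> affine_charts P" and q: "q \<in> V"
  obtains X Y r where "r > 0" "\<And>z. z \<in> ball (\<phi> q) r \<Longrightarrow> (X z, Y z) \<in> V \<and> \<phi> (X z, Y z) = z"
    "X (\<phi> q) = fst q" "Y (\<phi> q) = snd q"
    "(X has_field_derivative snd q * theta P \<phi> q) (at (\<phi> q))"
    "(Y has_field_derivative poly (pderiv P) (fst q) / 2 * theta P \<phi> q) (at (\<phi> q))"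
proof -
  obtain X Y r where r: "r > 0" "X holomorphic_on ball (\<phi> q) r" "Y holomorphic_on ball (\<phi> q) r"
    and XY: "\<And>z. z \<in> ball (\<phi> q) r \<Longrightarrow> (X z, Y z) \<in> V \<and> \<phi> (X z, Y z) = z"
    using affine_chart_local[OF P c q] by metis
  define z where "z = \<phi> q"
  have zb: "z \<in> ball z r" using r by simp
  have q': "(X z, Y z) = q"
    using XY[of z] zb affine_charts_inj[OF c] q by (auto simp: z_def inj_on_def)
  have V: "V \<subseteq> affine_curve P" using affine_charts_openin[OF c] openin_imp_subset by blast
  obtain a b where a: "(X has_field_derivative a) (at z)" and b: "(Y has_field_derivative b) (at z)"
    using r zb by (metis DERIV_deriv_iff_field_differentiable holomorphic_on_imp_differentiable_at open_ball z_def)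
  have ev: "\<forall>\<^sub>F w in nhds z. w \<in> ball z r" using r by (intro eventually_nhds_in_open) auto
  have d1: "((\<lambda>w. (Y w)\<^sup>2) has_field_derivative 2 * Y z * b) (at z)"
    using b by (auto intro!: derivative_eq_intros)
  have d2: "((\<lambda>w. poly P (X w)) has_field_derivative poly (pderiv P) (X z) * a) (at z)"
    using DERIV_chain2[OF poly_DERIV a] .
  have "\<forall>\<^sub>F w in nhds z. (Y w)\<^sup>2 = poly P (X w)"
    using ev by eventually_elim (use XY V in \<open>auto simp: z_def affine_curve_def\<close>)
  then have e: "2 * Y z * b = poly (pderiv P) (X z) * a"
    using DERIV_unique[OF DERIV_transfer_ev[OF d1] d2] by blast
  have id: "u = 1" if "(f has_field_derivative u) (at z)" "\<And>w. w \<in> ball z r \<Longrightarrow> f w = w" for f u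
  proof -
    have "\<forall>\<^sub>F w in nhds z. f w = w" using ev by eventually_elim (use that in auto)
    then have "((\<lambda>w. w) has_field_derivative u) (at z)" by (rule DERIV_transfer_ev[OF that(1)])
    then show ?thesis by (metis DERIV_ident DERIV_unique)
  qed
  have "a = snd q * theta P \<phi> q \<and> b = poly (pderiv P) (fst q) / 2 * theta P \<phi> q"
    using affine_charts_fst_snd[OF c]
  proof
    assume \<phi>: "\<phi> = fst"
    then have "a = 1" using id[OF a] XY by (simp add: z_def)
    moreover have "snd q \<noteq> 0" using c q \<phi> fst_neq_snd by (auto simp: affine_charts_def)
    ultimately show ?thesis using e q' \<phi> by (auto simp: field_simps)
  next
    assume \<phi>: "\<phi> = snd"
    then have "b = 1" using id[OF b] XY by (simp add: z_def)
    moreover have "poly (pderiv P) (fst q) \<noteq> 0" using c q \<phi> fst_neq_snd by (auto simp: affine_charts_def)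
    ultimately show ?thesis using e q' \<phi> by (auto simp: field_simps)
  qed
  then show thesis
    using that[of r X Y] r(1) XY q' a b unfolding z_def by (metis fst_conv snd_conv)
qed

definition curve_chart :: "(complex \<times> complex \<Rightarrow> curve_point) \<Rightarrow> (complex \<times> complex) set \<Rightarrow>
    (complex \<times> complex \<Rightarrow> complex) \<Rightarrow> curve_point chart" where
  "curve_chart \<iota> V \<phi> = (\<iota> ` V, \<lambda>p. \<phi> (inv_into V \<iota> p))"

lemma finite_neq_infinite_patch: "finite_patch \<noteq> infinite_patch n"
proof
  assume "finite_patch = infinite_patch n"
  then have "finite_patch (0, 0) = infinite_patch n (0, 0)" by simp
  then show False by (simp add: finite_patch_def infinite_patch_def)
qed

text \<open>The transition between the two affine patches; it is the same in both directions.\<close>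

definition flip :: "nat \<Rightarrow> complex \<times> complex \<Rightarrow> complex \<times> complex" where
  "flip n = (\<lambda>(x, y). (1 / x, y / x ^ n))"

lemma fst_flip [simp]: "fst (flip n q) = 1 / fst q" and snd_flip [simp]: "snd (flip n q) = snd q / fst q ^ n"
  by (auto simp: flip_def split: prod.splits)

lemma flip_flip: "fst q \<noteq> 0 \<Longrightarrow> flip n (flip n q) = q"
  by (cases q) (simp add: flip_def power_divide)

lemma finite_eq_infinite_patch:
  "finite_patch p = infinite_patch n q \<longleftrightarrow> fst p \<noteq> 0 \<and> q = flip n p"
proof -
  obtain a b c d where [simp]: "p = (a, b)" "q = (c, d)" by fastforce
  have "a = 1 / c \<longleftrightarrow> c = 1 / a" by (auto simp: field_simps)
  moreover have "b = d / c ^ n \<longleftrightarrow> d = b / a ^ n" if "a \<noteq> 0" "c = 1 / a"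
    using that(1) by (auto simp: that(2) field_simps power_divide)
  ultimately show ?thesis by (auto simp: finite_patch_def infinite_patch_def flip_def)
qed

lemma infinite_eq_finite_patch:
  "infinite_patch n p = finite_patch q \<longleftrightarrow> fst p \<noteq> 0 \<and> q = flip n p"
  by (cases p; cases q) (auto simp: finite_patch_def infinite_patch_def flip_def)

text \<open>The genus is \<open>m + 1\<close>, and \<open>m\<close> is the order of the zero of \<open>dx / y\<close> at the points at infinity.\<close>

locale curve =
  fixes D :: "complex poly" and m :: nat
  assumes rsq: "rsquarefree D" and deg: "degree D = 2 * (m + 2)"
begin

abbreviation "inf_patch \<equiv> infinite_patch (m + 2)"
abbreviation "surf \<equiv> hyperelliptic_curve D"

lemma patches: "patches D = {(D, finite_patch), (reflect_poly D, inf_patch)}"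
  using patches_eq[OF rsq deg] by simp

lemma patch: 
  assumes "(P, \<iota>) \<in> patches D"
  shows "rsquarefree P" "degree P > 0" "inj \<iota>"
  using patch_good[OF rsq deg] assms by auto

lemma finite_patch_in: "(D, finite_patch) \<in> patches D"
  and inf_patch_in: "(reflect_poly D, inf_patch) \<in> patches D"
  by (auto simp: patches)

lemma atlas_iff: "c \<in> atlas surf \<longleftrightarrow>
    (\<exists>P \<iota> V \<phi>. (P, \<iota>) \<in> patches D \<and> (V, \<phi>) \<in> affine_charts P \<and> c = curve_chart \<iota> V \<phi>)"
  by (auto simp: hyperelliptic_curve_def curve_chart_def)

lemma curve_chart_props:
  assumes "(P, \<iota>) \<in> patches D" "(V, \<phi>) \<in> affine_charts P"
  shows "fst (curve_chart \<iota> V \<phi>) = \<iota> ` V"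
    and "\<And>q. q \<in> V \<Longrightarrow> snd (curve_chart \<iota> V \<phi>) (\<iota> q) = \<phi> q"
    and "snd (curve_chart \<iota> V \<phi>) ` fst (curve_chart \<iota> V \<phi>) = \<phi> ` V"
    and "\<And>q. q \<in> V \<Longrightarrow> inv_into (fst (curve_chart \<iota> V \<phi>)) (snd (curve_chart \<iota> V \<phi>)) (\<phi> q) = \<iota> q"
proof -
  let ?c = "curve_chart \<iota> V \<phi>"
  have inj: "inj_on \<iota> V" using patch(3)[OF assms(1)] by (auto intro: inj_on_subset)
  show 1: "fst ?c = \<iota> ` V" by (simp add: curve_chart_def)
  show 2: "snd ?c (\<iota> q) = \<phi> q" if "q \<in> V" for q using inj that by (simp add: curve_chart_def)
  show "snd ?c ` fst ?c = \<phi> ` V" unfolding 1 image_image using 2 by (intro image_cong) auto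
  have "inj_on (snd ?c) (fst ?c)"
    using affine_charts_inj[OF assms(2)] 1 2 by (auto simp: inj_on_def)
  then show "inv_into (fst ?c) (snd ?c) (\<phi> q) = \<iota> q" if "q \<in> V" for q
    using inv_into_f_eq[of "snd ?c" "fst ?c" "\<iota> q" "\<phi> q"] that 1 2 by auto
qed

text \<open>The form \<open>dx / y\<close> of the patch \<open>\<kappa>\<close> is this multiple of the form of the patch \<open>\<iota>\<close>, at \<open>q\<close>:
\<open>du / v = - x ^ m dx / y\<close> for \<open>u = 1 / x\<close> and \<open>v = y / x ^ (m + 2)\<close>.\<close>

definition factor :: "(complex \<times> complex \<Rightarrow> curve_point) \<Rightarrow> (complex \<times> complex \<Rightarrow> curve_point) \<Rightarrow> complex \<times> complex \<Rightarrow> complex" where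
  "factor \<iota> \<kappa> q = (if \<iota> = \<kappa> then 1 else - (fst q ^ m))"

lemma overlap_cases:
  assumes "(P, \<iota>) \<in> patches D" "(Q, \<kappa>) \<in> patches D" "\<iota> q = \<kappa> r"
  obtains "\<iota> = \<kappa>" "P = Q" "q = r"
    | "\<iota> \<noteq> \<kappa>" "fst q \<noteq> 0" "r = flip (m + 2) q"
      "\<And>u. u \<noteq> 0 \<Longrightarrow> poly Q u = u ^ (2 * (m + 2)) * poly P (1 / u)"
      "\<And>q r. \<iota> q = \<kappa> r \<longleftrightarrow> fst q \<noteq> 0 \<and> r = flip (m + 2) q"
proof -
  have r1: "poly (reflect_poly D) u = u ^ (2 * (m + 2)) * poly D (1 / u)" if "u \<noteq> 0" for u
    using that by (simp add: poly_reflect_poly_nz deg inverse_eq_divide)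
  have r2: "poly D u = u ^ (2 * (m + 2)) * poly (reflect_poly D) (1 / u)" if "u \<noteq> 0" for u
    using that r1[of "1 / u"] by (simp add: power_one_over)
  consider "\<iota> = \<kappa>" "P = Q"
    | "\<iota> = finite_patch" "P = D" "\<kappa> = inf_patch" "Q = reflect_poly D"
    | "\<iota> = inf_patch" "P = reflect_poly D" "\<kappa> = finite_patch" "Q = D"
    using assms by (auto simp: patches)
  then show thesis
  proof cases
    case 1
    then have "q = r" using assms(3) injD[OF patch(3)[OF assms(1)]] by blast
    with 1 that(1) show thesis by blast
  next
    case 2
    have q: "fst q \<noteq> 0" "r = flip (m + 2) q" using assms(3) unfolding 2 by (auto simp: finite_eq_infinite_patch)
    show thesis
      by (rule that(2)) (use 2 q r1 finite_neq_infinite_patch in \<open>auto simp: finite_eq_infinite_patch\<close>)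
  next
    case 3
    have q: "fst q \<noteq> 0" "r = flip (m + 2) q" using assms(3) unfolding 3 by (auto simp: infinite_eq_finite_patch)
    show thesis
      by (rule that(2)) (use 3 q r2 finite_neq_infinite_patch[symmetric] in \<open>auto simp: infinite_eq_finite_patch\<close>)
  qed
qed

lemma reversed_pderiv:
  fixes P Q :: "complex poly"
  assumes "\<And>u. u \<noteq> 0 \<Longrightarrow> poly Q u = u ^ (2 * (m + 2)) * poly P (1 / u)" and x: "x \<noteq> 0"
  shows "poly (pderiv Q) (1 / x) = of_nat (2 * (m + 2)) * poly P x / x ^ (2 * m + 3) - poly (pderiv P) x / x ^ (2 * m + 2)"
proof -
  have u: "1 / x \<noteq> 0" using x by simp
  define k where "k = 2 * (m + 2)"
  have "((\<lambda>u. u ^ k * poly P (1 / u)) has_field_derivative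
      of_nat k * (1 / x) ^ (k - 1) * poly P x + (1 / x) ^ k * (poly (pderiv P) x * (- (x\<^sup>2)))) (at (1 / x))"
    using x by (auto intro!: derivative_eq_intros DERIV_chain2[OF poly_DERIV] simp: power2_eq_square)
  moreover have "\<forall>\<^sub>F u in nhds (1 / x). u ^ k * poly P (1 / u) = poly Q u"
    using t1_space_nhds[OF u] by eventually_elim (simp add: assms k_def)
  ultimately have "poly (pderiv Q) (1 / x) =
      of_nat k * (1 / x) ^ (k - 1) * poly P x + (1 / x) ^ k * (poly (pderiv P) x * (- (x\<^sup>2)))"
    using DERIV_unique[OF poly_DERIV] DERIV_transfer_ev by blast
  also have "\<dots> = of_nat (2 * (m + 2)) * poly P x / x ^ (2 * m + 3) - poly (pderiv P) x / x ^ (2 * m + 2)"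
  proof -
    have "k - 1 = 2 * m + 3" "k = 2 * m + 2 + 2" by (simp_all add: k_def)
    then have "(1 / x) ^ (k - 1) = 1 / x ^ (2 * m + 3)" "(1 / x) ^ k = 1 / x ^ (2 * m + 2) * (1 / x\<^sup>2)"
      by (simp_all only: power_divide power_one power_add mult_1_left times_divide_times_eq)
    moreover from this(2) have "(1 / x) ^ k * x\<^sup>2 = 1 / x ^ (2 * m + 2)" using x by simp
    ultimately show ?thesis by (simp only: k_def) (simp add: algebra_simps)
  qed
  finally show ?thesis .
qed

text \<open>Near the given point both charts are expressed through the parametrization of the first one. It then suffices
to know the derivatives of the two coordinate functions of the second patch, because
\<open>chart_parametrization\<close> expresses them by the form of that patch times the factor.\<close>

lemma transition_theta:
  assumes P: "(P, \<iota>) \<in> patches D" and V: "(V, \<phi>) \<in> affine_charts P" and q: "q \<in> V"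
    and Q: "(Q, \<kappa>) \<in> patches D" and W: "(W, \<psi>) \<in> affine_charts Q" and r: "r \<in> W"
    and qr: "\<iota> q = \<kappa> r"
  shows "transition (curve_chart \<iota> V \<phi>) (curve_chart \<kappa> W \<psi>) (\<phi> q) = \<psi> r"
    and "theta Q \<psi> r * deriv (transition (curve_chart \<iota> V \<phi>) (curve_chart \<kappa> W \<psi>)) (\<phi> q) =
           factor \<iota> \<kappa> q * theta P \<phi> q"
proof -
  let ?T = "transition (curve_chart \<iota> V \<phi>) (curve_chart \<kappa> W \<psi>)" and ?d = "theta P \<phi> q"
  note c = curve_chart_props[OF P V] and d = curve_chart_props[OF Q W]
  show "?T (\<phi> q) = \<psi> r" using c(4)[OF q] d(2)[OF r] qr by (simp add: transition_def)
  have VP: "V \<subseteq> affine_curve P" using affine_charts_openin[OF V] openin_imp_subset by blast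
  obtain O' where O': "open O'" "W = affine_curve Q \<inter> O'"
    using affine_charts_openin[OF W] by (auto simp: openin_open)
  obtain f h \<epsilon> where e: "\<epsilon> > 0" and fh: "\<And>z. z \<in> ball (\<phi> q) \<epsilon> \<Longrightarrow> (f z, h z) \<in> V \<and> \<phi> (f z, h z) = z"
    and q0: "f (\<phi> q) = fst q" "h (\<phi> q) = snd q"
    and df: "(f has_field_derivative snd q * ?d) (at (\<phi> q))"
    and dh: "(h has_field_derivative poly (pderiv P) (fst q) / 2 * ?d) (at (\<phi> q))"
    using chart_parametrization[OF patch(1)[OF P] V q] by metis
  have ev: "\<forall>\<^sub>F z in nhds (\<phi> q). z \<in> ball (\<phi> q) \<epsilon>" using e by (intro eventually_nhds_in_open) auto
  have key: "theta Q \<psi> r * deriv ?T (\<phi> q) = s * ?d"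
    if du: "(u has_field_derivative s * snd r * ?d) (at (\<phi> q))"
      and dv: "(v has_field_derivative s * poly (pderiv Q) (fst r) / 2 * ?d) (at (\<phi> q))"
      and uv: "(u (\<phi> q), v (\<phi> q)) = r"
      and near: "\<forall>\<^sub>F z in nhds (\<phi> q). \<iota> (f z, h z) = \<kappa> (u z, v z) \<and> (u z, v z) \<in> affine_curve Q" for u v s
  proof -
    have cu: "isCont (\<lambda>z. (u z, v z)) (\<phi> q)"
      using du dv by (intro continuous_intros DERIV_isCont)
    then have "((\<lambda>z. (u z, v z)) \<longlongrightarrow> (u (\<phi> q), v (\<phi> q))) (nhds (\<phi> q))"
      by (simp add: isCont_def tendsto_nhds_iff)
    moreover have "(u (\<phi> q), v (\<phi> q)) \<in> O'" using uv r O' by simp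
    ultimately have "\<forall>\<^sub>F z in nhds (\<phi> q). (u z, v z) \<in> O'" using O'(1) by (metis topological_tendstoD)
    with near ev have T: "\<forall>\<^sub>F z in nhds (\<phi> q). ?T z = \<psi> (u z, v z)"
    proof eventually_elim
      case (elim z)
      then have "(u z, v z) \<in> W" using O'(2) by simp
      moreover have "(f z, h z) \<in> V" "\<phi> (f z, h z) = z" using fh elim by auto
      ultimately show ?case using elim c(4)[of "(f z, h z)"] d(2)[of "(u z, v z)"] by (simp add: transition_def)
    qed
    have dT: "deriv ?T (\<phi> q) = deriv (\<lambda>z. \<psi> (u z, v z)) (\<phi> q)"
      by (rule deriv_cong_ev[OF T refl])
    show ?thesis
      using affine_charts_fst_snd[OF W]
    proof
      assume \<psi>: "\<psi> = fst"
      have "snd r \<noteq> 0" using W r \<psi> fst_neq_snd by (auto simp: affine_charts_def)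
      then show ?thesis using dT DERIV_imp_deriv[OF du] \<psi> by simp
    next
      assume \<psi>: "\<psi> = snd"
      have "poly (pderiv Q) (fst r) \<noteq> 0" using W r \<psi> fst_neq_snd by (auto simp: affine_charts_def)
      then show ?thesis using dT DERIV_imp_deriv[OF dv] \<psi> by (simp add: field_simps)
    qed
  qed
  from P Q qr show "theta Q \<psi> r * deriv ?T (\<phi> q) = factor \<iota> \<kappa> q * ?d"
  proof (cases rule: overlap_cases)
    case 1
    have "theta Q \<psi> r * deriv ?T (\<phi> q) = 1 * ?d"
    proof (rule key[of f 1 h])
      show "\<forall>\<^sub>F z in nhds (\<phi> q). \<iota> (f z, h z) = \<kappa> (f z, h z) \<and> (f z, h z) \<in> affine_curve Q"
        using ev by eventually_elim (use fh VP 1 in auto)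
    qed (use df dh q0 1 in auto)
    then show ?thesis using 1 by (simp add: factor_def)
  next
    case 2
    define x y where "x = fst q" and "y = snd q"
    have x: "x \<noteq> 0" using 2 by (simp add: x_def)
    have y2: "y * y = poly P x" using q VP by (auto simp: x_def y_def affine_curve_def power2_eq_square)
    have "theta Q \<psi> r * deriv ?T (\<phi> q) = - (x ^ m) * ?d"
    proof (rule key[of "\<lambda>z. 1 / f z" _ "\<lambda>z. h z / f z ^ (m + 2)"])
      show "((\<lambda>z. 1 / f z) has_field_derivative - (x ^ m) * snd r * ?d) (at (\<phi> q))"
        using 2 x q0 by (auto intro!: derivative_eq_intros df simp: x_def power_add power2_eq_square)
      have *: "((\<lambda>z. h z / f z ^ (m + 2)) has_field_derivative
          (poly (pderiv P) x / 2 * ?d * x ^ (m + 2) - y * (of_nat (m + 2) * x ^ (m + 1) * (y * ?d))) / (x ^ (m + 2) * x ^ (m + 2))) (at (\<phi> q))"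
      proof -
        have "f (\<phi> q) \<noteq> 0" "m + 2 - 1 = m + 1" using x q0 by (simp_all add: x_def)
        then show ?thesis
          using DERIV_divide_power[OF df dh, of "m + 2"] by (simp only: x_def y_def q0 not_False_eq_True simp_thms)
      qed
      have "(poly (pderiv P) x / 2 * ?d * x ^ (m + 2) - y * (of_nat (m + 2) * x ^ (m + 1) * (y * ?d))) / (x ^ (m + 2) * x ^ (m + 2))
         = (poly (pderiv P) x / 2 * ?d * x ^ (m + 2) - (of_nat (m + 2) * x ^ (m + 1) * (poly P x * ?d))) / (x ^ (m + 2) * x ^ (m + 2))"
      proof -
        have "y * (c * (y * d)) = c * (poly P x * d)" for c d
          unfolding y2[symmetric] by (simp only: mult_ac)
        then show ?thesis by (simp only:)
      qed
      also have "\<dots> = - (x ^ m) * (of_nat (2 * (m + 2)) * poly P x / x ^ (2 * m + 3) - poly (pderiv P) x / x ^ (2 * m + 2)) / 2 * ?d"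
      proof -
        define w where "w = x ^ m"
        have w: "w \<noteq> 0" "x ^ (m + 2) = w * x * x" "x ^ (m + 1) = w * x" "x ^ (2 * m + 3) = w * w * x * x * x" "x ^ (2 * m + 2) = w * w * x * x"
        proof -
          show "w \<noteq> 0" using x by (simp add: w_def)
          show "x ^ (m + 2) = w * x * x" "x ^ (m + 1) = w * x" by (simp_all add: w_def)
          have "2 * m = m + m" by simp
          then have "x ^ (2 * m) = w * w" by (simp only: w_def power_add)
          then show "x ^ (2 * m + 3) = w * w * x * x * x" "x ^ (2 * m + 2) = w * w * x * x"
            by (simp_all only: power_add) (simp_all add: power2_eq_square power3_eq_cube)
        qed
        define N :: complex where "N = of_nat (m + 2)"
        have "of_nat (2 * (m + 2)) = 2 * N" by (simp add: N_def)
        then show ?thesis unfolding w(2-) w_def[symmetric] N_def[symmetric] using w(1) x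
          by (simp add: field_simps)
      qed
      also have "\<dots> = - (x ^ m) * poly (pderiv Q) (fst r) / 2 * ?d"
        using reversed_pderiv[OF 2(4) x] 2(3) by (simp add: x_def)
      finally show "((\<lambda>z. h z / f z ^ (m + 2)) has_field_derivative - (x ^ m) * poly (pderiv Q) (fst r) / 2 * ?d) (at (\<phi> q))"
        using * by simp
      show "(1 / f (\<phi> q), h (\<phi> q) / f (\<phi> q) ^ (m + 2)) = r"
        using q0 2(3) by (simp add: prod_eq_iff)
      have "(f \<longlongrightarrow> f (\<phi> q)) (nhds (\<phi> q))" using DERIV_isCont[OF df] by (simp add: isCont_def tendsto_nhds_iff)
      then have "\<forall>\<^sub>F z in nhds (\<phi> q). f z \<noteq> 0"
        using x q0 by (intro tendsto_imp_eventually_ne) (auto simp: x_def)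
      with ev show "\<forall>\<^sub>F z in nhds (\<phi> q). \<iota> (f z, h z) = \<kappa> (1 / f z, h z / f z ^ (m + 2)) \<and>
          (1 / f z, h z / f z ^ (m + 2)) \<in> affine_curve Q"
      proof eventually_elim
        case (elim z)
        have "(h z)\<^sup>2 = poly P (f z)" using fh[of z] elim VP by (auto simp: affine_curve_def)
        moreover have "(h z / f z ^ (m + 2))\<^sup>2 = (1 / f z) ^ (2 * (m + 2)) * (h z)\<^sup>2"
          by (simp only: power_divide power_mult[symmetric] mult.commute[of _ 2] power_one) simp
        moreover have "poly Q (1 / f z) = (1 / f z) ^ (2 * (m + 2)) * poly P (f z)"
          using 2(4)[of "1 / f z"] elim by simp
        ultimately have "(1 / f z, h z / f z ^ (m + 2)) \<in> affine_curve Q"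
          by (simp only: affine_curve_def) simp
        moreover have "\<iota> (f z, h z) = \<kappa> (1 / f z, h z / f z ^ (m + 2))"
          using 2(5)[of "(f z, h z)" "(1 / f z, h z / f z ^ (m + 2))"] elim by (simp only: flip_def) simp
        ultimately show ?case by blast
      qed
    qed
    then show ?thesis using 2 by (simp add: factor_def x_def)
  qed
qed

end


section \<open>Sections as functions on the affine patches\<close>

context curve
begin

text \<open>On the patch \<open>\<iota>\<close> the section is \<open>F \<iota> (dx / y)\<^sup>k\<close> with respect to the coordinates of that patch.\<close>

definition represents :: "nat \<Rightarrow> curve_point k_form \<Rightarrow> ((complex \<times> complex \<Rightarrow> curve_point) \<Rightarrow> complex \<times> complex \<Rightarrow> complex) \<Rightarrow> bool" where
  "represents k \<omega> F \<longleftrightarrow> (\<forall>P \<iota> V \<phi> q. (P, \<iota>) \<in> patches D \<longrightarrow> (V, \<phi>) \<in> affine_charts P \<longrightarrow> q \<in> V \<longrightarrow>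
     \<omega> (curve_chart \<iota> V \<phi>) (\<phi> q) = F \<iota> q * theta P \<phi> q ^ k)"

definition glued :: "nat \<Rightarrow> ((complex \<times> complex \<Rightarrow> curve_point) \<Rightarrow> complex \<times> complex \<Rightarrow> complex) \<Rightarrow> bool" where
  "glued k F \<longleftrightarrow> (\<forall>q\<in>affine_curve D. fst q \<noteq> 0 \<longrightarrow>
     F finite_patch q = (- (fst q ^ m)) ^ k * F inf_patch (flip (m + 2) q))"

definition regular :: "((complex \<times> complex \<Rightarrow> curve_point) \<Rightarrow> complex \<times> complex \<Rightarrow> complex) \<Rightarrow> bool" where
  "regular F \<longleftrightarrow> (\<forall>P \<iota> V \<phi>. (P, \<iota>) \<in> patches D \<longrightarrow> (V, \<phi>) \<in> affine_charts P \<longrightarrow>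
     (\<lambda>z. F \<iota> (inv_into V \<phi> z)) holomorphic_on \<phi> ` V)"

lemma representsD:
  assumes "represents k \<omega> F" "(P, \<iota>) \<in> patches D" "(V, \<phi>) \<in> affine_charts P" "q \<in> V"
  shows "\<omega> (curve_chart \<iota> V \<phi>) (\<phi> q) = F \<iota> q * theta P \<phi> q ^ k"
  using assms unfolding represents_def by blast

lemma chart_subset: "(V, \<phi>) \<in> affine_charts P \<Longrightarrow> V \<subseteq> affine_curve P"
  using affine_charts_openin openin_imp_subset by blast

lemma atlasE:
  assumes "c \<in> atlas surf"
  obtains P \<iota> V \<phi> where "(P, \<iota>) \<in> patches D" "(V, \<phi>) \<in> affine_charts P" "c = curve_chart \<iota> V \<phi>"
  using assms unfolding atlas_iff by blast

lemma glued_overlap: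
  assumes F: "glued k F" and P: "(P, \<iota>) \<in> patches D" "q \<in> affine_curve P"
    and Q: "(Q, \<kappa>) \<in> patches D" "r \<in> affine_curve Q" and qr: "\<iota> q = \<kappa> r"
  shows "F \<iota> q = F \<kappa> r * factor \<iota> \<kappa> q ^ k"
  using P(1) Q(1) qr
proof (cases rule: overlap_cases)
  case 1
  then show ?thesis by (simp add: factor_def)
next
  case 2
  then consider "P = D" "\<iota> = finite_patch" "\<kappa> = inf_patch" | "Q = D" "\<kappa> = finite_patch" "\<iota> = inf_patch"
    using P(1) Q(1) by (auto simp: patches)
  then show ?thesis
  proof cases
    case 1
    then show ?thesis using F P(2) 2 by (simp add: glued_def factor_def)
  next
    case b: 2
    have "fst r \<noteq> 0" "flip (m + 2) r = q" using 2 by (auto simp: flip_flip)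
    then have "F \<kappa> r = (- (fst r ^ m)) ^ k * F \<iota> q" using F Q(2) b by (simp add: glued_def)
    moreover have "(- (fst r ^ m)) ^ k * (- (fst q ^ m)) ^ k = 1"
      unfolding power_mult_distrib[symmetric] using 2(2,3) by (simp add: power_one_over)
    ultimately show ?thesis using 2(1) by (simp add: factor_def)
  qed
qed

lemma theta_holomorphic:
  assumes P: "(P, \<iota>) \<in> patches D" "(V, \<phi>) \<in> affine_charts P"
  shows "(\<lambda>z. theta P \<phi> (inv_into V \<phi> z)) holomorphic_on \<phi> ` V"
proof -
  have nz: "theta P \<phi> (inv_into V \<phi> z) \<noteq> 0" if "z \<in> \<phi> ` V" for z
    using theta_nonzero[OF P(2)] that by (simp add: inv_into_into)
  show ?thesis
    using affine_charts_fst_snd[OF P(2)]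
  proof
    assume \<phi>: "\<phi> = fst"
    then show ?thesis using affine_chart_inverse[OF patch(1)[OF P(1)] P(2)] nz
      by (auto intro!: holomorphic_intros)
  next
    assume \<phi>: "\<phi> = snd"
    then show ?thesis using affine_chart_inverse[OF patch(1)[OF P(1)] P(2)] nz
      by (auto intro!: holomorphic_intros)
  qed
qed

text \<open>A form is a function on charts, but one chart can arise from several sets \<open>V\<close> and coordinates. The
transition law between any two charts, applied to a chart and itself, shows that the value does not depend on
this choice.\<close>

lemma section_exists:
  assumes glued: "glued k F" and regular: "regular F"
  shows "\<exists>\<omega>. holomorphic_section surf k \<omega> \<and> represents k \<omega> F"
proof -
  define rep where "rep = (\<lambda>c z P \<iota> V \<phi> q. (P, \<iota>) \<in> patches D \<and> (V, \<phi>) \<in> affine_charts P \<and>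
    c = curve_chart \<iota> V \<phi> \<and> q \<in> V \<and> z = \<phi> q)"
  define \<omega> where "\<omega> = (\<lambda>c z. SOME w. \<exists>P \<iota> V \<phi> q. rep c z P \<iota> V \<phi> q \<and> w = F \<iota> q * theta P \<phi> q ^ k)"
  have law: "F \<iota> q * theta P \<phi> q ^ k = F \<kappa> r * theta Q \<psi> r ^ k *
      deriv (transition (curve_chart \<iota> V \<phi>) (curve_chart \<kappa> W \<psi>)) (\<phi> q) ^ k"
    if P: "(P, \<iota>) \<in> patches D" "(V, \<phi>) \<in> affine_charts P" "q \<in> V"
      and Q: "(Q, \<kappa>) \<in> patches D" "(W, \<psi>) \<in> affine_charts Q" "r \<in> W" and qr: "\<iota> q = \<kappa> r"
    for P \<iota> V \<phi> q Q \<kappa> W \<psi> r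
  proof -
    have "F \<iota> q = F \<kappa> r * factor \<iota> \<kappa> q ^ k"
      using glued_overlap[OF glued P(1) _ Q(1) _ qr] P Q chart_subset by blast
    then show ?thesis
      using transition_theta(2)[OF P Q qr] by (simp add: mult.assoc flip: power_mult_distrib)
  qed
  have unique: "F \<iota> q * theta P \<phi> q ^ k = F \<kappa> r * theta Q \<psi> r ^ k"
    if 1: "rep c z P \<iota> V \<phi> q" and 2: "rep c z Q \<kappa> W \<psi> r" for c z P \<iota> V \<phi> q Q \<kappa> W \<psi> r
  proof -
    have P: "(P, \<iota>) \<in> patches D" "(V, \<phi>) \<in> affine_charts P" "q \<in> V" "c = curve_chart \<iota> V \<phi>" "z = \<phi> q"
      and Q: "(Q, \<kappa>) \<in> patches D" "(W, \<psi>) \<in> affine_charts Q" "r \<in> W" "c = curve_chart \<kappa> W \<psi>" "z = \<psi> r"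
      using 1 2 by (auto simp: rep_def)
    have "\<iota> q = \<kappa> r"
      using curve_chart_props(4)[OF P(1,2,3)] curve_chart_props(4)[OF Q(1,2,3)] P(4,5) Q(4,5) by metis
    moreover have "deriv (transition c c) z = 1"
    proof -
      have "z \<in> \<phi> ` V" "open (\<phi> ` V)" using P affine_chart_open[OF patch(1)[OF P(1)] P(2)] by auto
      then have "\<forall>\<^sub>F w in nhds z. w \<in> \<phi> ` V" by (intro eventually_nhds_in_open)
      then have "\<forall>\<^sub>F w in nhds z. transition c c w = w"
        by eventually_elim
          (use curve_chart_props(2,4)[OF P(1,2)] P(4) in \<open>auto simp: transition_def\<close>)
      then have "deriv (transition c c) z = deriv (\<lambda>w. w) z" by (intro deriv_cong_ev) auto
      then show ?thesis by simp
    qed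
    ultimately show ?thesis using law[OF P(1-3) Q(1-3)] P(4,5) Q(4) by simp
  qed
  have \<omega>: "\<omega> (curve_chart \<iota> V \<phi>) (\<phi> q) = F \<iota> q * theta P \<phi> q ^ k"
    if "(P, \<iota>) \<in> patches D" "(V, \<phi>) \<in> affine_charts P" "q \<in> V" for P \<iota> V \<phi> q
    unfolding \<omega>_def
  proof (rule some_equality)
    have "rep (curve_chart \<iota> V \<phi>) (\<phi> q) P \<iota> V \<phi> q" using that by (simp add: rep_def)
    then show "\<exists>P' \<iota>' V' \<phi>' q'. rep (curve_chart \<iota> V \<phi>) (\<phi> q) P' \<iota>' V' \<phi>' q' \<and>
        F \<iota> q * theta P \<phi> q ^ k = F \<iota>' q' * theta P' \<phi>' q' ^ k" by blast
    show "w = F \<iota> q * theta P \<phi> q ^ k"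
      if "\<exists>P' \<iota>' V' \<phi>' q'. rep (curve_chart \<iota> V \<phi>) (\<phi> q) P' \<iota>' V' \<phi>' q' \<and> w = F \<iota>' q' * theta P' \<phi>' q' ^ k" for w
      using that unique \<open>rep (curve_chart \<iota> V \<phi>) (\<phi> q) P \<iota> V \<phi> q\<close> by metis
  qed
  have "holomorphic_section surf k \<omega>"
    unfolding holomorphic_section_def
  proof (intro conjI ballI)
    fix c assume "c \<in> atlas surf"
    then obtain P \<iota> V \<phi> where P: "(P, \<iota>) \<in> patches D" "(V, \<phi>) \<in> affine_charts P" and c: "c = curve_chart \<iota> V \<phi>"
      by (rule atlasE)
    note theta_holomorphic[OF P]
    moreover have "(\<lambda>z. F \<iota> (inv_into V \<phi> z)) holomorphic_on \<phi> ` V" using regular P by (auto simp: regular_def)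
    ultimately have "(\<lambda>z. F \<iota> (inv_into V \<phi> z) * theta P \<phi> (inv_into V \<phi> z) ^ k) holomorphic_on \<phi> ` V"
      by (intro holomorphic_intros)
    moreover have "\<omega> c z = F \<iota> (inv_into V \<phi> z) * theta P \<phi> (inv_into V \<phi> z) ^ k" if "z \<in> \<phi> ` V" for z
      using \<omega>[OF P inv_into_into[OF that]] f_inv_into_f[OF that] c by simp
    ultimately show "\<omega> c holomorphic_on snd c ` fst c"
      unfolding c curve_chart_props(3)[OF P] by (simp cong: holomorphic_cong)
    fix d z assume "d \<in> atlas surf" and z: "z \<in> snd c ` (fst c \<inter> fst d)"
    then obtain Q \<kappa> W \<psi> where Q: "(Q, \<kappa>) \<in> patches D" "(W, \<psi>) \<in> affine_charts Q" and d: "d = curve_chart \<kappa> W \<psi>"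
      by (blast elim: atlasE)
    obtain p where p: "p \<in> \<iota> ` V" "p \<in> \<kappa> ` W" "z = snd c p"
      using z curve_chart_props(1)[OF P] curve_chart_props(1)[OF Q] by (force simp: c d)
    then obtain q r where qr: "q \<in> V" "r \<in> W" "\<iota> q = \<kappa> r" "p = \<iota> q" by auto
    have "z = \<phi> q" using p(3) qr(4) curve_chart_props(2)[OF P qr(1)] by (simp only: c)
    note qr = qr(1-3) this
    show "\<omega> c z = \<omega> d (transition c d z) * deriv (transition c d) z ^ k"
      using law[OF P qr(1) Q qr(2,3)] \<omega>[OF P qr(1)] \<omega>[OF Q qr(2)] transition_theta(1)[OF P qr(1) Q qr(2,3)]
      by (simp add: c d qr(4))
  qed
  then show ?thesis using \<omega> by (auto simp: represents_def)
qed

lemma flip_affine: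
  assumes "q \<in> affine_curve D" "fst q \<noteq> 0"
  shows "flip (m + 2) q \<in> affine_curve (reflect_poly D)"
proof -
  have "(snd q / fst q ^ (m + 2))\<^sup>2 = (snd q)\<^sup>2 / fst q ^ (2 * (m + 2))"
    by (simp only: power_divide power_mult[symmetric] mult.commute)
  moreover have "poly (reflect_poly D) (1 / fst q) = poly D (fst q) / fst q ^ (2 * (m + 2))"
    using assms(2) by (simp add: poly_reflect_poly_nz deg power_divide)
  moreover have "(snd q)\<^sup>2 = poly D (fst q)" using assms(1) by (auto simp: affine_curve_def)
  ultimately have "(snd q / fst q ^ (m + 2))\<^sup>2 = poly (reflect_poly D) (1 / fst q)" by simp
  then show ?thesis by (simp only: affine_curve_def flip_def split_def) simp
qed

lemma flip_reflected_affine: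
  assumes "q \<in> affine_curve (reflect_poly D)" "fst q \<noteq> 0"
  shows "flip (m + 2) q \<in> affine_curve D"
proof -
  have "(snd q / fst q ^ (m + 2))\<^sup>2 = (snd q)\<^sup>2 / fst q ^ (2 * (m + 2))"
    by (simp only: power_divide power_mult[symmetric] mult.commute)
  moreover have "(snd q)\<^sup>2 = fst q ^ (2 * (m + 2)) * poly D (1 / fst q)"
    using assms by (auto simp: affine_curve_def poly_reflect_poly_nz deg inverse_eq_divide)
  ultimately have "(snd q / fst q ^ (m + 2))\<^sup>2 = poly D (1 / fst q)" using assms(2) by simp
  then show ?thesis by (simp only: affine_curve_def flip_def split_def) simp
qed

text \<open>Dividing by the nowhere vanishing form \<open>dx / y\<close> turns a section into a function; the transition laws
of both cancel.\<close>

lemma section_function: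
  assumes \<omega>: "holomorphic_section surf k \<omega>"
  obtains F where "represents k \<omega> F" "glued k F" "regular F"
    "\<And>P \<iota>. (P, \<iota>) \<in> patches D \<Longrightarrow> continuous_on (affine_curve P) (F \<iota>)"
proof -
  define val where "val = (\<lambda>P \<iota> V \<phi> q. \<omega> (curve_chart \<iota> V \<phi>) (\<phi> q) / theta P \<phi> q ^ k)"
  define F where "F = (\<lambda>\<iota> q. SOME w. \<exists>P V \<phi>. (P, \<iota>) \<in> patches D \<and> (V, \<phi>) \<in> affine_charts P \<and> q \<in> V \<and> w = val P \<iota> V \<phi> q)"
  have law: "val P \<iota> V \<phi> q = val Q \<kappa> W \<psi> r * factor \<iota> \<kappa> q ^ k"
    if P: "(P, \<iota>) \<in> patches D" "(V, \<phi>) \<in> affine_charts P" "q \<in> V"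
      and Q: "(Q, \<kappa>) \<in> patches D" "(W, \<psi>) \<in> affine_charts Q" "r \<in> W" and qr: "\<iota> q = \<kappa> r"
    for P \<iota> V \<phi> q Q \<kappa> W \<psi> r
  proof -
    let ?c = "curve_chart \<iota> V \<phi>" and ?d = "curve_chart \<kappa> W \<psi>"
    let ?T = "deriv (transition ?c ?d) (\<phi> q)"
    have cd: "?c \<in> atlas surf" "?d \<in> atlas surf" unfolding atlas_iff using P Q by blast+
    have "\<iota> q \<in> fst ?c" "\<iota> q \<in> fst ?d"
      unfolding curve_chart_props(1)[OF P(1,2)] curve_chart_props(1)[OF Q(1,2)]
      using P(3) Q(3) qr by (blast, metis imageI)
    then have "snd ?c (\<iota> q) \<in> snd ?c ` (fst ?c \<inter> fst ?d)" by blast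
    then have z: "\<phi> q \<in> snd ?c ` (fst ?c \<inter> fst ?d)"
      by (simp only: curve_chart_props(2)[OF P])
    have 1: "\<omega> ?c (\<phi> q) = \<omega> ?d (\<psi> r) * ?T ^ k"
      using \<omega>[unfolded holomorphic_section_def, THEN conjunct2, rule_format, OF cd z]
      by (simp only: transition_theta(1)[OF P Q qr])
    have 2: "theta Q \<psi> r ^ k * ?T ^ k = factor \<iota> \<kappa> q ^ k * theta P \<phi> q ^ k"
      using transition_theta(2)[OF P Q qr] by (simp flip: power_mult_distrib)
    have "theta P \<phi> q \<noteq> 0" "theta Q \<psi> r \<noteq> 0"
      using theta_nonzero[OF P(2,3)] theta_nonzero[OF Q(2,3)] .
    then have nz: "theta P \<phi> q ^ k \<noteq> 0" "theta Q \<psi> r ^ k \<noteq> 0" by simp_all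
    have "\<omega> ?c (\<phi> q) * theta Q \<psi> r ^ k = \<omega> ?d (\<psi> r) * (theta Q \<psi> r ^ k * ?T ^ k)"
      unfolding 1 by (simp only: mult_ac)
    then have "\<omega> ?c (\<phi> q) * theta Q \<psi> r ^ k = \<omega> ?d (\<psi> r) * factor \<iota> \<kappa> q ^ k * theta P \<phi> q ^ k"
      unfolding 2 by (simp only: mult_ac)
    then show ?thesis using nz by (simp add: val_def frac_eq_eq)
  qed
  have F: "F \<iota> q = val P \<iota> V \<phi> q"
    if P: "(P, \<iota>) \<in> patches D" "(V, \<phi>) \<in> affine_charts P" "q \<in> V" for P \<iota> V \<phi> q
    unfolding F_def
  proof (rule some_equality)
    show "\<exists>P' V' \<phi>'. (P', \<iota>) \<in> patches D \<and> (V', \<phi>') \<in> affine_charts P' \<and> q \<in> V' \<and> val P \<iota> V \<phi> q = val P' \<iota> V' \<phi>' q"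
      using P by blast
    show "w = val P \<iota> V \<phi> q"
      if w: "\<exists>P' V' \<phi>'. (P', \<iota>) \<in> patches D \<and> (V', \<phi>') \<in> affine_charts P' \<and> q \<in> V' \<and> w = val P' \<iota> V' \<phi>' q" for w
    proof -
      obtain P' V' \<phi>' where w: "(P', \<iota>) \<in> patches D" "(V', \<phi>') \<in> affine_charts P'" "q \<in> V'" "w = val P' \<iota> V' \<phi>' q"
        using w by blast
      then show ?thesis using law[of P' \<iota> V' \<phi>' q P \<iota> V \<phi> q, OF w(1-3) P refl]
        by (simp only: factor_def refl if_True power_one mult_1_right)
    qed
  qed
  show thesis
  proof (rule that[of F])
    show "represents k \<omega> F"
      unfolding represents_def
    proof (intro allI impI)
      fix P \<iota> V \<phi> q assume P: "(P, \<iota>) \<in> patches D" "(V, \<phi>) \<in> affine_charts P" "q \<in> V"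
      show "\<omega> (curve_chart \<iota> V \<phi>) (\<phi> q) = F \<iota> q * theta P \<phi> q ^ k"
        unfolding F[OF P] val_def using theta_nonzero[OF P(2,3)] by simp
    qed
    show "glued k F"
      unfolding glued_def
    proof (intro ballI impI)
      fix q assume q: "q \<in> affine_curve D" "fst q \<noteq> 0"
      let ?r = "flip (m + 2) q"
      have e: "finite_patch q = inf_patch ?r" using q by (simp add: finite_eq_infinite_patch)
      obtain V \<phi> where V: "(V, \<phi>) \<in> affine_charts D" "q \<in> V"
        using affine_charts_cover[OF rsq q(1)] by blast
      obtain W \<psi> where W: "(W, \<psi>) \<in> affine_charts (reflect_poly D)" "?r \<in> W"
        using affine_charts_cover[OF patch(1)[OF inf_patch_in] flip_affine[OF q]] by blast
      have "val D finite_patch V \<phi> q = val (reflect_poly D) inf_patch W \<psi> ?r * (- (fst q ^ m)) ^ k"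
        using law[OF finite_patch_in V inf_patch_in W e] finite_neq_infinite_patch by (simp only: factor_def if_False)
      then show "F finite_patch q = (- (fst q ^ m)) ^ k * F inf_patch ?r"
        by (simp only: F[OF finite_patch_in V] F[OF inf_patch_in W] mult.commute)
    qed
    have hol: "(\<lambda>z. F \<iota> (inv_into V \<phi> z)) holomorphic_on \<phi> ` V"
      if P: "(P, \<iota>) \<in> patches D" "(V, \<phi>) \<in> affine_charts P" for P \<iota> V \<phi>
    proof -
      have c: "curve_chart \<iota> V \<phi> \<in> atlas surf" using P by (auto simp: atlas_iff)
      have h1: "\<omega> (curve_chart \<iota> V \<phi>) holomorphic_on \<phi> ` V"
        using \<omega>[unfolded holomorphic_section_def, THEN conjunct1, rule_format, OF c]
        by (simp only: curve_chart_props(3)[OF P])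
      have nz: "theta P \<phi> (inv_into V \<phi> z) \<noteq> 0" if "z \<in> \<phi> ` V" for z
        using theta_nonzero[OF P(2)] that by (simp add: inv_into_into)
      have "(\<lambda>z. \<omega> (curve_chart \<iota> V \<phi>) z / theta P \<phi> (inv_into V \<phi> z) ^ k) holomorphic_on \<phi> ` V"
        using h1 theta_holomorphic[OF P] nz by (intro holomorphic_intros) auto
      moreover have "F \<iota> (inv_into V \<phi> z) = \<omega> (curve_chart \<iota> V \<phi>) z / theta P \<phi> (inv_into V \<phi> z) ^ k"
        if "z \<in> \<phi> ` V" for z
        unfolding F[OF P inv_into_into[OF that]] val_def f_inv_into_f[OF that] ..
      ultimately show ?thesis by (simp cong: holomorphic_cong)
    qed
    then show "regular F" unfolding regular_def by (intro allI impI)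
    show "continuous_on (affine_curve P) (F \<iota>)" if P: "(P, \<iota>) \<in> patches D" for P \<iota>
      unfolding continuous_on_eq_continuous_within
    proof
      fix q assume q: "q \<in> affine_curve P"
      obtain V \<phi> where V: "(V, \<phi>) \<in> affine_charts P" "q \<in> V"
        using affine_charts_cover[OF patch(1)[OF P] q] by blast
      obtain T where T: "open T" "V = affine_curve P \<inter> T"
        using affine_charts_openin[OF V(1)] by (auto simp: openin_open)
      have "continuous_on V \<phi>" using affine_charts_fst_snd[OF V(1)] by (auto intro: continuous_intros)
      then have "continuous_on V (\<lambda>q. F \<iota> (inv_into V \<phi> (\<phi> q)))"
        by (rule continuous_on_compose2[OF holomorphic_on_imp_continuous_on[OF hol[OF P V(1)]]]) auto
      then have "continuous_on V (F \<iota>)"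
        by (rule continuous_on_eq) (simp add: inv_into_f_f[OF affine_charts_inj[OF V(1)]])
      then have "continuous (at q within V) (F \<iota>)" using V(2) by (simp add: continuous_on_eq_continuous_within)
      moreover have "at q within V = at q within affine_curve P"
        using T V(2) by (intro at_within_nhd[of q T]) auto
      ultimately show "continuous (at q within affine_curve P) (F \<iota>)" by simp
    qed
  qed
qed

lemma topspace_surf:
  "p \<in> topspace (points surf) \<longleftrightarrow> (\<exists>P \<iota> q. (P, \<iota>) \<in> patches D \<and> q \<in> affine_curve P \<and> p = \<iota> q)"
proof -
  have "topspace (points surf) = (\<Union>c\<in>atlas surf. fst c)"
    using compact_riemann_surface_rsquarefree[OF rsq deg]
    by (simp add: compact_riemann_surface_def riemann_surface_def)
  also have "p \<in> \<dots> \<longleftrightarrow> (\<exists>P \<iota> V \<phi>. (P, \<iota>) \<in> patches D \<and> (V, \<phi>) \<in> affine_charts P \<and> p \<in> \<iota> ` V)"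
    unfolding UN_iff Bex_def atlas_iff using curve_chart_props(1) by blast
  also have "\<dots> \<longleftrightarrow> (\<exists>P \<iota> q. (P, \<iota>) \<in> patches D \<and> q \<in> affine_curve P \<and> p = \<iota> q)"
  proof
    assume "\<exists>P \<iota> V \<phi>. (P, \<iota>) \<in> patches D \<and> (V, \<phi>) \<in> affine_charts P \<and> p \<in> \<iota> ` V"
    then show "\<exists>P \<iota> q. (P, \<iota>) \<in> patches D \<and> q \<in> affine_curve P \<and> p = \<iota> q"
      using chart_subset by blast
  next
    assume "\<exists>P \<iota> q. (P, \<iota>) \<in> patches D \<and> q \<in> affine_curve P \<and> p = \<iota> q"
    then obtain P \<iota> q where P: "(P, \<iota>) \<in> patches D" "q \<in> affine_curve P" "p = \<iota> q" by blast
    obtain V \<phi> where "(V, \<phi>) \<in> affine_charts P" "q \<in> V"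
      using affine_charts_cover[OF patch(1)[OF P(1)] P(2)] by blast
    then show "\<exists>P \<iota> V \<phi>. (P, \<iota>) \<in> patches D \<and> (V, \<phi>) \<in> affine_charts P \<and> p \<in> \<iota> ` V"
      using P by blast
  qed
  finally show ?thesis .
qed

lemma zeros_iff:
  assumes F: "represents k \<omega> F" "glued k F" and P: "(P, \<iota>) \<in> patches D" "q \<in> affine_curve P"
  shows "\<iota> q \<in> zeros surf \<omega> \<longleftrightarrow> F \<iota> q = 0"
proof
  assume "\<iota> q \<in> zeros surf \<omega>"
  then obtain c where "c \<in> atlas surf" "\<iota> q \<in> fst c" "\<omega> c (snd c (\<iota> q)) = 0"
    unfolding zeros_def by blast
  note c = this
  obtain Q \<kappa> V \<phi> where Q: "(Q, \<kappa>) \<in> patches D" "(V, \<phi>) \<in> affine_charts Q" "c = curve_chart \<kappa> V \<phi>"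
    using c(1) by (rule atlasE)
  obtain r where r: "r \<in> V" "\<iota> q = \<kappa> r" using c(2) unfolding Q(3) curve_chart_props(1)[OF Q(1,2)] by blast
  have "F \<kappa> r * theta Q \<phi> r ^ k = 0"
    using representsD[OF F(1) Q(1,2) r(1)] c(3) curve_chart_props(2)[OF Q(1,2) r(1)] r(2) Q(3) by simp
  then have "F \<kappa> r = 0" using theta_nonzero[OF Q(2) r(1)] by simp
  then show "F \<iota> q = 0"
    using glued_overlap[OF F(2) P Q(1) subsetD[OF chart_subset[OF Q(2)] r(1)] r(2)] by simp
next
  assume "F \<iota> q = 0"
  obtain V \<phi> where V: "(V, \<phi>) \<in> affine_charts P" "q \<in> V"
    using affine_charts_cover[OF patch(1)[OF P(1)] P(2)] by blast
  let ?c = "curve_chart \<iota> V \<phi>"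
  have c: "?c \<in> atlas surf" "\<iota> q \<in> fst ?c" "\<omega> ?c (snd ?c (\<iota> q)) = 0"
    using P V representsD[OF F(1) P(1) V] \<open>F \<iota> q = 0\<close> curve_chart_props(1,2)[OF P(1) V(1)]
    by (auto simp: atlas_iff)
  have "\<iota> q \<in> topspace (points surf)" using P topspace_surf by blast
  then show "\<iota> q \<in> zeros surf \<omega>"
    unfolding zeros_def by (intro CollectI conjI bexI[OF _ c(1)] c(2,3))
qed

lemma k_differential_iff:
  assumes "holomorphic_section surf k \<omega>" "represents k \<omega> F"
  shows "k_differential surf k \<omega> \<longleftrightarrow> (\<exists>P \<iota> q. (P, \<iota>) \<in> patches D \<and> q \<in> affine_curve P \<and> F \<iota> q \<noteq> 0)"
proof
  assume "k_differential surf k \<omega>"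
  then have "\<exists>c\<in>atlas surf. \<exists>z\<in>snd c ` fst c. \<omega> c z \<noteq> 0"
    unfolding k_differential_def by (rule conjunct2)
  then obtain c z where c: "c \<in> atlas surf" "z \<in> snd c ` fst c" "\<omega> c z \<noteq> 0"
    by (elim bexE)
  obtain P \<iota> V \<phi> where P: "(P, \<iota>) \<in> patches D" "(V, \<phi>) \<in> affine_charts P" "c = curve_chart \<iota> V \<phi>"
    using c(1) by (rule atlasE)
  obtain q where q: "q \<in> V" "z = \<phi> q" using c(2) curve_chart_props(3)[OF P(1,2)] P(3) by auto
  then have "F \<iota> q \<noteq> 0" using representsD[OF assms(2) P(1,2) q(1)] c(3) P(3) by auto
  then show "\<exists>P \<iota> q. (P, \<iota>) \<in> patches D \<and> q \<in> affine_curve P \<and> F \<iota> q \<noteq> 0"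
    using P(1) q(1) chart_subset[OF P(2)] by blast
next
  assume "\<exists>P \<iota> q. (P, \<iota>) \<in> patches D \<and> q \<in> affine_curve P \<and> F \<iota> q \<noteq> 0"
  then obtain P \<iota> q where P: "(P, \<iota>) \<in> patches D" "q \<in> affine_curve P" "F \<iota> q \<noteq> 0" by blast
  obtain V \<phi> where V: "(V, \<phi>) \<in> affine_charts P" "q \<in> V"
    using affine_charts_cover[OF patch(1)[OF P(1)] P(2)] by blast
  have c: "curve_chart \<iota> V \<phi> \<in> atlas surf" using P V by (auto simp: atlas_iff)
  have z: "\<phi> q \<in> snd (curve_chart \<iota> V \<phi>) ` fst (curve_chart \<iota> V \<phi>)"
    unfolding curve_chart_props(3)[OF P(1) V(1)] using V by simp
  have "\<omega> (curve_chart \<iota> V \<phi>) (\<phi> q) \<noteq> 0"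
    using representsD[OF assms(2) P(1) V] P(3) theta_nonzero[OF V] by simp
  then show "k_differential surf k \<omega>"
    unfolding k_differential_def by (intro conjI assms(1) bexI[OF _ c] bexI[OF _ z])
qed

lemma tensor_power_iff:
  assumes \<eta>: "represents k' \<eta> G" and \<omega>: "represents (j * k') \<omega> F"
  shows "is_tensor_power surf \<eta> j \<omega> \<longleftrightarrow> (\<forall>P \<iota>. (P, \<iota>) \<in> patches D \<longrightarrow> (\<forall>q\<in>affine_curve P. F \<iota> q = G \<iota> q ^ j))"
proof -
  have *: "\<omega> (curve_chart \<iota> V \<phi>) (\<phi> q) = \<eta> (curve_chart \<iota> V \<phi>) (\<phi> q) ^ j \<longleftrightarrow> F \<iota> q = G \<iota> q ^ j"
    if "(P, \<iota>) \<in> patches D" "(V, \<phi>) \<in> affine_charts P" "q \<in> V" for P \<iota> V \<phi> q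
  proof -
    have "\<omega> (curve_chart \<iota> V \<phi>) (\<phi> q) = F \<iota> q * theta P \<phi> q ^ (j * k')"
      "\<eta> (curve_chart \<iota> V \<phi>) (\<phi> q) = G \<iota> q * theta P \<phi> q ^ k'"
      using representsD[OF \<omega> that] representsD[OF \<eta> that] by auto
    moreover have "(G \<iota> q * theta P \<phi> q ^ k') ^ j = G \<iota> q ^ j * theta P \<phi> q ^ (j * k')"
      by (simp only: power_mult_distrib power_mult[symmetric] mult.commute[of j])
    ultimately show ?thesis using theta_nonzero[OF that(2,3)] by simp
  qed
  show ?thesis
  proof
    assume l: "is_tensor_power surf \<eta> j \<omega>"
    show "\<forall>P \<iota>. (P, \<iota>) \<in> patches D \<longrightarrow> (\<forall>q\<in>affine_curve P. F \<iota> q = G \<iota> q ^ j)"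
    proof (intro allI impI ballI)
      fix P \<iota> q assume P: "(P, \<iota>) \<in> patches D" and q: "q \<in> affine_curve P"
      obtain V \<phi> where V: "(V, \<phi>) \<in> affine_charts P" "q \<in> V"
        using affine_charts_cover[OF patch(1)[OF P] q] by blast
      have c: "curve_chart \<iota> V \<phi> \<in> atlas surf" using P V by (auto simp: atlas_iff)
      have z: "\<phi> q \<in> snd (curve_chart \<iota> V \<phi>) ` fst (curve_chart \<iota> V \<phi>)"
        unfolding curve_chart_props(3)[OF P V(1)] using V by simp
      show "F \<iota> q = G \<iota> q ^ j"
        using l[unfolded is_tensor_power_def, rule_format, OF c z] *[OF P V] by simp
    qed
  next
    assume r: "\<forall>P \<iota>. (P, \<iota>) \<in> patches D \<longrightarrow> (\<forall>q\<in>affine_curve P. F \<iota> q = G \<iota> q ^ j)"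
    show "is_tensor_power surf \<eta> j \<omega>"
      unfolding is_tensor_power_def
    proof (intro ballI)
      fix c z assume "c \<in> atlas surf" and z: "z \<in> snd c ` fst c"
      then obtain P \<iota> V \<phi> where P: "(P, \<iota>) \<in> patches D" "(V, \<phi>) \<in> affine_charts P" and c: "c = curve_chart \<iota> V \<phi>"
        by (blast elim: atlasE)
      obtain q where "q \<in> V" "z = \<phi> q" using z curve_chart_props(3)[OF P] c by auto
      then show "\<omega> c z = \<eta> c z ^ j" using *[OF P] r P chart_subset c by blast
    qed
  qed
qed

end


section \<open>Forms with polynomial coefficients\<close>

text \<open>For \<open>degree A \<le> N\<close>, this is \<open>u ^ N * A (1 / u)\<close>.\<close>

definition reverse_poly :: "nat \<Rightarrow> complex poly \<Rightarrow> complex poly" where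
  "reverse_poly N A = monom 1 (N - degree A) * reflect_poly A"

lemma poly_reverse_poly:
  assumes "degree A \<le> N" "u \<noteq> 0"
  shows "poly (reverse_poly N A) u = u ^ N * poly A (1 / u)"
  using assms by (simp add: reverse_poly_def poly_monom poly_reflect_poly_nz inverse_eq_divide flip: mult.assoc power_add)

lemma poly_reverse_poly_0:
  assumes "degree A \<le> N"
  shows "poly (reverse_poly N A) 0 = coeff A N"
proof (cases "degree A = N")
  case False
  then show ?thesis using assms by (simp add: reverse_poly_def poly_monom coeff_eq_0)
qed (use assms in \<open>auto simp: reverse_poly_def poly_monom\<close>)

context curve
begin

text \<open>At infinity, \<open>A x + B x y\<close> is multiplied by \<open>x ^ - (k m)\<close> and the sign of
\<open>(dx / y)\<^sup>k = (-1)\<^sup>k u ^ (k m) (du / v)\<^sup>k\<close> enters; since \<open>y = v / u ^ (m + 2)\<close>, the coefficient \<open>B\<close>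
loses \<open>m + 2\<close> degrees.\<close>

definition poly_function :: "nat \<Rightarrow> complex poly \<Rightarrow> complex poly \<Rightarrow> (complex \<times> complex \<Rightarrow> curve_point) \<Rightarrow> complex \<times> complex \<Rightarrow> complex" where
  "poly_function k A B \<iota> q =
     (if \<iota> = finite_patch then poly A (fst q) + poly B (fst q) * snd q
      else (-1) ^ k * (poly (reverse_poly (k * m) A) (fst q) + poly (reverse_poly (k * m - (m + 2)) B) (fst q) * snd q))"

lemma poly_function_simps [simp]:
  "poly_function k A B finite_patch q = poly A (fst q) + poly B (fst q) * snd q"
  "poly_function k A B inf_patch q =
     (-1) ^ k * (poly (reverse_poly (k * m) A) (fst q) + poly (reverse_poly (k * m - (m + 2)) B) (fst q) * snd q)"
  using finite_neq_infinite_patch[of "m + 2"] unfolding poly_function_def by auto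

lemma poly_function_glued:
  assumes A: "degree A \<le> k * m" and B: "B = 0 \<or> degree B + (m + 2) \<le> k * m"
  shows "glued k (poly_function k A B)"
  unfolding glued_def
proof (intro ballI impI)
  fix q :: "complex \<times> complex" assume q: "fst q \<noteq> 0"
  define x y where "x = fst q" and "y = snd q"
  have x: "x \<noteq> 0" using q by (simp add: x_def)
  have 1: "(- (x ^ m)) ^ k = (-1) ^ k * x ^ (k * m)"
    by (simp add: power_minus[of "x ^ m"] mult.commute flip: power_mult)
  have 2: "x ^ (k * m) * poly (reverse_poly (k * m) A) (1 / x) = poly A x"
    using poly_reverse_poly[OF A, of "1 / x"] x by (simp add: power_one_over)
  have 3: "x ^ (k * m) * (poly (reverse_poly (k * m - (m + 2)) B) (1 / x) * (y / x ^ (m + 2))) = poly B x * y"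
  proof (cases "B = 0")
    case False
    define d where "d = k * m - (m + 2)"
    have d: "degree B \<le> d" "k * m = d + (m + 2)" using B False by (auto simp: d_def)
    have "x ^ d * poly (reverse_poly d B) (1 / x) = poly B x"
      using poly_reverse_poly[OF d(1), of "1 / x"] x by (simp add: power_one_over)
    moreover have "x ^ (k * m) * (p * (y / x ^ (m + 2))) = x ^ d * p * y" for p
      unfolding d(2) power_add[of x d] using x by simp
    ultimately show ?thesis unfolding d_def by simp
  qed (simp add: reverse_poly_def)
  have "(- (x ^ m)) ^ k * ((-1) ^ k * (poly (reverse_poly (k * m) A) (1 / x) +
      poly (reverse_poly (k * m - (m + 2)) B) (1 / x) * (y / x ^ (m + 2)))) = poly A x + poly B x * y"
    unfolding 1 2[symmetric] 3[symmetric] by (simp add: algebra_simps flip: power_mult_distrib)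
  then show "poly_function k A B finite_patch q = (- (fst q ^ m)) ^ k * poly_function k A B inf_patch (flip (m + 2) q)"
    by (simp only: poly_function_simps fst_flip snd_flip x_def y_def)
qed

lemma poly_function_regular: "regular (poly_function k A B)"
  unfolding regular_def
proof (intro allI impI)
  fix P \<iota> V \<phi> assume P: "(P, \<iota>) \<in> patches D" "(V, \<phi>) \<in> affine_charts P"
  note h = affine_chart_inverse[OF patch(1)[OF P(1)] P(2)]
  show "(\<lambda>z. poly_function k A B \<iota> (inv_into V \<phi> z)) holomorphic_on \<phi> ` V"
    unfolding poly_function_def using h by (cases "\<iota> = finite_patch") (auto intro!: holomorphic_intros)
qed

lemma poly_section:
  assumes A: "degree A \<le> k * m" and B: "B = 0 \<or> degree B + (m + 2) \<le> k * m"
    and nz: "q \<in> affine_curve D" "poly A (fst q) + poly B (fst q) * snd q \<noteq> 0"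
  obtains \<omega> where "k_differential surf k \<omega>" "represents k \<omega> (poly_function k A B)"
proof -
  obtain \<omega> where \<omega>: "holomorphic_section surf k \<omega>" "represents k \<omega> (poly_function k A B)"
    using section_exists[OF poly_function_glued[OF A B] poly_function_regular] by blast
  have "poly_function k A B finite_patch q \<noteq> 0" using nz(2) by simp
  then have "k_differential surf k \<omega>"
    unfolding k_differential_iff[OF \<omega>] using finite_patch_in nz(1) by blast
  then show thesis using that \<omega> by blast
qed

text \<open>The points outside of the finite patch are those with first coordinate 0 in the other one.\<close>

lemma unique_zeroI:
  assumes \<omega>: "represents k \<omega> F" and g: "glued k F"
    and P: "(P, \<iota>) \<in> patches D" "p \<in> affine_curve P"
    and fin: "\<And>q. q \<in> affine_curve D \<Longrightarrow> F finite_patch q = 0 \<longleftrightarrow> finite_patch q = \<iota> p"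
    and inf: "\<And>v. (0, v) \<in> affine_curve (reflect_poly D) \<Longrightarrow> F inf_patch (0, v) = 0 \<longleftrightarrow> inf_patch (0, v) = \<iota> p"
  shows "zeros surf \<omega> = {\<iota> p}"
proof (rule set_eqI)
  fix x
  have pt: "x \<in> topspace (points surf) \<longleftrightarrow> (\<exists>q\<in>affine_curve D. x = finite_patch q) \<or>
      (\<exists>v. (0, v) \<in> affine_curve (reflect_poly D) \<and> x = inf_patch (0, v))"
  proof
    assume "x \<in> topspace (points surf)"
    then obtain Q \<kappa> q where Q: "(Q, \<kappa>) \<in> patches D" "q \<in> affine_curve Q" "x = \<kappa> q"
      unfolding topspace_surf by blast
    consider "Q = D" "\<kappa> = finite_patch" | "Q = reflect_poly D" "\<kappa> = inf_patch" "fst q = 0"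
      | "Q = reflect_poly D" "\<kappa> = inf_patch" "fst q \<noteq> 0"
      using Q(1) by (auto simp: patches)
    then show "(\<exists>q\<in>affine_curve D. x = finite_patch q) \<or> (\<exists>v. (0, v) \<in> affine_curve (reflect_poly D) \<and> x = inf_patch (0, v))"
    proof cases
      case 1
      then show ?thesis using Q by blast
    next
      case 2
      then have "q = (0, snd q)" by (simp add: prod_eq_iff)
      then show ?thesis using Q 2 by metis
    next
      case 3
      have eq: "inf_patch q = finite_patch (flip (m + 2) q)" using 3 by (simp add: infinite_eq_finite_patch)
      have "flip (m + 2) q \<in> affine_curve D" using flip_reflected_affine Q(2) 3 by blast
      then show ?thesis using eq Q(3) 3(2) by metis
    qed
  next
    assume "(\<exists>q\<in>affine_curve D. x = finite_patch q) \<or> (\<exists>v. (0, v) \<in> affine_curve (reflect_poly D) \<and> x = inf_patch (0, v))"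
    then show "x \<in> topspace (points surf)"
      unfolding topspace_surf using finite_patch_in inf_patch_in by blast
  qed
  show "x \<in> zeros surf \<omega> \<longleftrightarrow> x \<in> {\<iota> p}"
  proof (cases "x \<in> topspace (points surf)")
    case True
    then consider q where "q \<in> affine_curve D" "x = finite_patch q"
      | v where "(0, v) \<in> affine_curve (reflect_poly D)" "x = inf_patch (0, v)" using pt by blast
    then show ?thesis
    proof cases
      case 1
      then show ?thesis using zeros_iff[OF \<omega> g finite_patch_in 1(1)] fin[OF 1(1)] by simp
    next
      case 2
      then show ?thesis using zeros_iff[OF \<omega> g inf_patch_in 2(1)] inf[OF 2(1)] by simp
    qed
  next
    case False
    then have "x \<notin> zeros surf \<omega>" by (simp add: zeros_def)
    moreover have "x \<noteq> \<iota> p" using False P topspace_surf by blast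
    ultimately show ?thesis by simp
  qed
qed

lemma has_orderI:
  assumes \<omega>: "represents k \<omega> F" and P: "(P, \<iota>) \<in> patches D" "(V, \<phi>) \<in> affine_charts P" "p \<in> V"
    and S: "open S" "\<phi> p \<in> S" "S \<subseteq> \<phi> ` V" and g: "g holomorphic_on S" "g (\<phi> p) \<noteq> 0"
    and eq: "\<And>q. q \<in> V \<Longrightarrow> \<phi> q \<in> S \<Longrightarrow> F \<iota> q * theta P \<phi> q ^ k = g (\<phi> q) * (\<phi> q - \<phi> p) ^ N"
  shows "has_order_at surf \<omega> (\<iota> p) N"
proof -
  let ?c = "curve_chart \<iota> V \<phi>"
  have c: "?c \<in> atlas surf" unfolding atlas_iff using P by blast
  have p: "\<iota> p \<in> fst ?c" unfolding curve_chart_props(1)[OF P(1,2)] using P(3) by blast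
  have "zorder (\<omega> ?c) (\<phi> p) = int N"
  proof (rule zorder_eqI[OF S(1,2) g])
    fix w assume w: "w \<in> S" "w \<noteq> \<phi> p"
    then obtain q where q: "q \<in> V" "w = \<phi> q" using S(3) by blast
    show "\<omega> ?c w = g w * (w - \<phi> p) powi int N"
      using representsD[OF \<omega> P(1,2) q(1)] eq[OF q(1)] w q(2) by simp
  qed
  then have "zorder (\<omega> ?c) (snd ?c (\<iota> p)) = int N" by (simp only: curve_chart_props(2)[OF P])
  then show ?thesis unfolding has_order_at_def using c p by blast
qed

end


section \<open>The Pell-Abel unit on a real oval\<close>

text \<open>With \<open>\<alpha> = arccos A\<close>, the unit \<open>A + B y\<close> equals \<open>exp (i \<alpha>)\<close> on one half of the oval and
\<open>exp (- i \<alpha>)\<close> on the other. A continuous \<open>j\<close>-th root is \<open>c1 exp (i \<alpha> / j)\<close> on the first and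
\<open>c2 exp (- i \<alpha> / j)\<close> on the second half, with constants \<open>c1\<close> and \<open>c2\<close>. The halves meet over both
ends of the interval, where \<open>\<alpha>\<close> is \<open>0\<close> and \<open>\<pi>\<close>; comparing gives \<open>exp (2 \<pi> i / j) = 1\<close>.\<close>

lemma no_root_on_oval:
  fixes A B D :: "real poly" and h :: "complex \<times> complex \<Rightarrow> complex"
  assumes pell: "A\<^sup>2 - 1 = D * B\<^sup>2" and ab: "a < b" "poly D a = 0" "poly D b = 0"
    and A: "poly A a = - poly A b" "\<bar>poly A a\<bar> = 1"
    and band: "\<And>x. a < x \<Longrightarrow> x < b \<Longrightarrow> \<bar>poly A x\<bar> < 1"
    and j: "j \<ge> 2" and C: "\<And>x y. y\<^sup>2 = complex_of_real (poly D x) \<Longrightarrow> (complex_of_real x, y) \<in> C"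
    and h: "continuous_on C h"
    and hj: "\<And>x y. y\<^sup>2 = complex_of_real (poly D x) \<Longrightarrow>
      h (complex_of_real x, y) ^ j = complex_of_real (poly A x) + complex_of_real (poly B x) * y"
  shows False
proof -
  have e: "(poly A x)\<^sup>2 - 1 = poly D x * (poly B x)\<^sup>2" for x
    using arg_cong[OF pell, of "\<lambda>p. poly p x"] by simp
  have A1: "\<bar>poly A x\<bar> \<le> 1" if x: "x \<in> {a..b}" for x
  proof -
    consider "x = a" | "x = b" | "a < x" "x < b" using x by fastforce
    then show ?thesis
    proof cases
      case 3
      then show ?thesis using band[of x] by simp
    qed (use A in auto)
  qed
  have in_band: "poly B x \<noteq> 0 \<and> poly D x < 0" if "a < x" "x < b" for x
  proof -
    have "(poly A x)\<^sup>2 < 1" using band[OF that] by (simp add: abs_square_less_1)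
    then have "poly D x * (poly B x)\<^sup>2 < 0" using e[of x] by simp
    then show ?thesis by (auto simp: mult_less_0_iff)
  qed
  have D0: "poly D x \<le> 0" if x: "x \<in> {a..b}" for x
  proof -
    consider "x = a" | "x = b" | "a < x" "x < b" using x by fastforce
    then show ?thesis
    proof cases
      case 3
      then show ?thesis using in_band[of x] by simp
    qed (use ab in auto)
  qed
  \<comment> \<open>The sign of \<open>B\<close> on the interval decides on which half of the oval \<open>B y\<close> has positive imaginary
    part.\<close>
  obtain s :: real where s: "s\<^sup>2 = 1" "\<And>x. a < x \<Longrightarrow> x < b \<Longrightarrow> s * poly B x > 0"
  proof -
    define c where "c = (a + b) / 2"
    have c: "a < c" "c < b" using ab(1) by (auto simp: c_def)
    have same: "poly B c * poly B x > 0" if x: "a < x" "x < b" for x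
    proof (rule ccontr)
      assume "\<not> poly B c * poly B x > 0"
      moreover have "poly B c \<noteq> 0" "poly B x \<noteq> 0" using in_band c x by auto
      ultimately have n: "poly B c * poly B x < 0" by (simp add: not_less order_le_less)
      then have "c \<noteq> x" by (auto simp: mult_less_0_iff)
      then obtain z where "poly B z = 0" "min c x < z" "z < max c x"
        using poly_IVT[of c x B] poly_IVT[of x c B] n by (cases "c < x") (auto simp: mult.commute)
      then show False using in_band[of z] c x by auto
    qed
    show thesis
      by (rule that[of "sgn (poly B c)"])
        (use same in_band c in \<open>auto simp: power2_eq_square sgn_if zero_less_mult_iff split: if_splits\<close>)
  qed
  define \<alpha> where "\<alpha> = (\<lambda>x. arccos (poly A x))"
  define y where "y = (\<lambda>x. complex_of_real (s * sqrt (- poly D x)) * \<i>)"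
  have y2: "(y x)\<^sup>2 = complex_of_real (poly D x)" if "x \<in> {a..b}" for x
  proof -
    have "(s * sqrt (- poly D x))\<^sup>2 = - poly D x" using D0[OF that] s(1) by (simp add: power_mult_distrib)
    then have "(complex_of_real (s * sqrt (- poly D x)))\<^sup>2 = complex_of_real (- poly D x)"
      by (metis of_real_power)
    then show ?thesis unfolding y_def power_mult_distrib by simp
  qed
  have cis: "complex_of_real (poly A x) + complex_of_real (poly B x) * y x = cis (\<alpha> x)" if x: "x \<in> {a..b}" for x
  proof -
    have c: "cos (\<alpha> x) = poly A x" "sin (\<alpha> x) = sqrt (1 - (poly A x)\<^sup>2)"
      using A1[OF x] by (simp_all add: \<alpha>_def sin_arccos_abs)
    have "sqrt (1 - (poly A x)\<^sup>2) = poly B x * (s * sqrt (- poly D x))"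
    proof -
      have "1 - (poly A x)\<^sup>2 = (- poly D x) * (poly B x)\<^sup>2" using e[of x] by simp
      then have "sqrt (1 - (poly A x)\<^sup>2) = sqrt (- poly D x) * \<bar>poly B x\<bar>"
        by (simp only: real_sqrt_mult real_sqrt_abs)
      moreover have "\<bar>poly B x\<bar> = s * poly B x \<or> poly D x = 0"
      proof (cases "x = a \<or> x = b")
        case False
        then have "s * poly B x > 0" using s(2) x by auto
        moreover have "\<bar>s\<bar> = 1" using s(1) by (auto simp: power2_eq_1_iff)
        ultimately show ?thesis by (metis abs_mult abs_of_pos mult_1)
      qed (use ab in auto)
      ultimately show ?thesis by (auto simp: mult_ac)
    qed
    then show ?thesis using c by (simp add: complex_eq_iff y_def)
  qed
  have cis': "complex_of_real (poly A x) + complex_of_real (poly B x) * (- y x) = cis (- \<alpha> x)" if x: "x \<in> {a..b}" for x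
    using arg_cong[OF cis[OF x], of cnj] by (simp add: y_def cis_cnj)
  have cont\<alpha>: "continuous_on {a..b} \<alpha>"
    unfolding \<alpha>_def using A1 by (intro continuous_intros) (auto simp: abs_le_iff)
  have conty: "continuous_on {a..b} y" unfolding y_def by (intro continuous_intros)
  have const: "\<exists>c. \<forall>x\<in>{a..b}. h (complex_of_real x, t * y x) = c * cis (t' * \<alpha> x / real j)"
    if t: "t\<^sup>2 = 1" and eq: "\<And>x. x \<in> {a..b} \<Longrightarrow> complex_of_real (poly A x) + complex_of_real (poly B x) * (t * y x) = cis (t' * \<alpha> x)"
    for t :: complex and t' :: real
  proof -
    define f where "f = (\<lambda>x. h (complex_of_real x, t * y x) * cis (- (t' * \<alpha> x / real j)))"
    have ty: "(t * y x)\<^sup>2 = complex_of_real (poly D x)" if "x \<in> {a..b}" for x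
      using y2[OF that] t by (simp add: power_mult_distrib)
    have "continuous_on {a..b} (\<lambda>x. h (complex_of_real x, t * y x))"
      by (rule continuous_on_compose2[OF h]) (use conty C ty in \<open>auto intro!: continuous_intros\<close>)
    then have "continuous_on {a..b} f"
      unfolding f_def using cont\<alpha> j by (intro continuous_intros) auto
    moreover have "f ` {a..b} \<subseteq> {z. z ^ j = 1}"
    proof clarify
      fix x assume x: "x \<in> {a..b}"
      have "f x ^ j = cis (t' * \<alpha> x) * cis (- (t' * \<alpha> x / real j)) ^ j"
        unfolding f_def power_mult_distrib using hj[OF ty[OF x]] eq[OF x] by simp
      also have "cis (- (t' * \<alpha> x / real j)) ^ j = cis (- (t' * \<alpha> x))"
        unfolding Complex.DeMoivre using j by simp
      also have "cis (t' * \<alpha> x) * cis (- (t' * \<alpha> x)) = 1" by (simp add: cis_mult)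
      finally show "f x ^ j = 1" .
    qed
    then have "finite (f ` {a..b})" using j by (elim finite_subset) (simp add: finite_roots_unity)
    ultimately have "f constant_on {a..b}" by (intro continuous_finite_range_constant) auto
    then obtain c where "\<And>x. x \<in> {a..b} \<Longrightarrow> f x = c" by (auto simp: constant_on_def)
    then have "h (complex_of_real x, t * y x) = c * cis (t' * \<alpha> x / real j)" if "x \<in> {a..b}" for x
      using that unfolding f_def by (force simp: cis_mult mult.assoc)
    then show ?thesis by blast
  qed
  obtain c1 where c1: "\<And>x. x \<in> {a..b} \<Longrightarrow> h (complex_of_real x, 1 * y x) = c1 * cis (1 * \<alpha> x / real j)"
    using const[of 1 1] cis by auto
  obtain c2 where c2: "\<And>x. x \<in> {a..b} \<Longrightarrow> h (complex_of_real x, -1 * y x) = c2 * cis (-1 * \<alpha> x / real j)"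
    using const[of "-1" "-1"] cis' by auto
  have ya: "y a = 0" "y b = 0" using ab by (auto simp: y_def)
  have ha: "h (complex_of_real a, 0) ^ j = complex_of_real (poly A a)" using hj[of 0 a] ab by simp
  have h0: "h (complex_of_real a, 0) \<noteq> 0"
  proof
    assume "h (complex_of_real a, 0) = 0"
    then have "poly A a = 0" using ha j by (simp add: power_0_left)
    then show False using A(2) by simp
  qed
  have ends: "c1 * cis (\<alpha> x / real j) = c2 * cis (- \<alpha> x / real j)" if "x \<in> {a, b}" for x
    using c1[of x] c2[of x] that ya ab(1) by auto
  have "c1 \<noteq> 0" using c1[of a] h0 ya ab(1) by auto
  have ratio: "c2 = c1 * cis (2 * \<alpha> x / real j)" if "x \<in> {a, b}" for x
  proof -
    have "c2 = c2 * cis (- \<alpha> x / real j) * cis (\<alpha> x / real j)" by (simp add: mult.assoc cis_mult)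
    also have "\<dots> = c1 * cis (2 * \<alpha> x / real j)"
      unfolding ends[OF that, symmetric] by (simp add: mult.assoc cis_mult add_divide_distrib flip: mult_2)
    finally show ?thesis .
  qed
  from ratio[of a] ratio[of b] have "c1 * cis (2 * \<alpha> a / real j) = c1 * cis (2 * \<alpha> b / real j)" by (metis insertCI)
  then have "cis (2 * \<alpha> a / real j) = cis (2 * \<alpha> b / real j)" using \<open>c1 \<noteq> 0\<close> by simp
  moreover have "\<alpha> a = 0 \<and> \<alpha> b = pi \<or> \<alpha> a = pi \<and> \<alpha> b = 0"
    using A by (auto simp: \<alpha>_def abs_if split: if_splits)
  ultimately have "cis (2 * pi / real j) = 1" by auto
  then have "cos (2 * pi / real j) = cos 0" by (simp add: complex_eq_iff)
  moreover have "0 < 2 * pi / real j" "2 * pi / real j \<le> pi" using j by (auto simp: divide_le_eq)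
  ultimately show False using cos_monotone_0_pi[of 0 "2 * pi / real j"] by simp
qed


section \<open>Existence of primitive differentials\<close>

abbreviation complex_poly :: "real poly \<Rightarrow> complex poly" where
  "complex_poly \<equiv> map_poly complex_of_real"

lemma poly_complex_poly: "poly (complex_poly p) (complex_of_real x) = complex_of_real (poly p x)"
  by (induction p) (auto simp: map_poly_pCons)

lemma complex_poly_mult: "complex_poly (p * q) = complex_poly p * complex_poly q"
  by (rule poly_eqI) (simp add: coeff_map_poly coeff_mult)

lemma complex_poly_diff: "complex_poly (p - q) = complex_poly p - complex_poly q"
  by (rule poly_eqI) (simp add: coeff_map_poly)

lemma totally_realI:
  assumes deg: "degree D = 2 * g + 2" and S: "card S = 2 * g + 2" "S \<subseteq> \<real>" "\<And>x. x \<in> S \<Longrightarrow> poly D x = 0"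
  shows "totally_real g D"
proof -
  have D0: "D \<noteq> 0" using deg by auto
  have "finite {x. poly D x = 0}" using D0 by (rule poly_roots_finite)
  moreover have "S \<subseteq> {x. poly D x = 0}" using S(3) by blast
  moreover have "card {x. poly D x = 0} \<le> 2 * g + 2" using card_poly_roots_bound[OF D0] deg by simp
  ultimately have eq: "S = {x. poly D x = 0}" using S(1) by (metis card_seteq)
  have "rsquarefree D"
    unfolding rsquarefree_roots
  proof (intro allI notI, elim conjE)
    fix a assume a: "poly D a = 0" "poly (pderiv D) a = 0"
    obtain E where E: "D = [:- a, 1:] * E" using a(1) by (meson dvdE poly_eq_0_iff_dvd)
    have "poly (pderiv D) a = poly E a" unfolding E pderiv_mult by (simp add: pderiv_pCons)
    then have "{x. poly D x = 0} = {x. poly E x = 0}" using a(2) unfolding E by auto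
    moreover have E0: "E \<noteq> 0" using D0 E by auto
    moreover have "degree D = Suc (degree E)" unfolding E using E0 by (subst degree_mult_eq) auto
    ultimately show False using card_poly_roots_bound[OF E0] S(1) deg eq by simp
  qed
  then show ?thesis using deg eq S(2) by (auto simp: totally_real_def)
qed

context curve
begin

text \<open>The conjugate \<open>A - B y\<close> is an inverse of \<open>A + B y\<close> on the affine curve, so all zeros are at infinity.
There the equation becomes \<open>A1\<^sup>2 - v\<^sup>2 B1\<^sup>2 = u ^ (2 k m)\<close> for the reversed polynomials. At each of
the two points at infinity one of the factors \<open>A1 \<plusminus> B1 v\<close> is nonzero; the other one carries the whole
order.\<close>

lemma pell_function_zero:
  assumes pell: "A\<^sup>2 - 1 = D * B\<^sup>2" and A: "degree A = k * m" and B: "degree B + (m + 2) = k * m" and B0: "B \<noteq> 0"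
  obtains \<omega> where "k_differential surf k \<omega>" "represents k \<omega> (poly_function k A B)"
    "has_unique_zero_of_order surf \<omega> (k * (2 * m))"
proof -
  define N where "N = k * m"
  define d where "d = N - (m + 2)"
  have d: "degree B = d" "N = d + (m + 2)" using B by (auto simp: d_def N_def)
  let ?F = "poly_function k A B"
  have norm1: "(poly A x + poly B x * y) * (poly A x - poly B x * y) = 1" if "y\<^sup>2 = poly D x" for x y
  proof -
    have "(poly A x)\<^sup>2 - 1 = poly D x * (poly B x)\<^sup>2" using arg_cong[OF pell, of "\<lambda>p. poly p x"] by simp
    then have "(poly A x)\<^sup>2 - poly D x * (poly B x)\<^sup>2 = 1" by (simp add: diff_eq_eq add.commute)
    moreover have "(poly A x + poly B x * y) * (poly A x - poly B x * y) = (poly A x)\<^sup>2 - y\<^sup>2 * (poly B x)\<^sup>2"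
      by (simp add: algebra_simps power2_eq_square)
    ultimately show ?thesis using that by simp
  qed
  have fin0: "?F finite_patch q \<noteq> 0" if "q \<in> affine_curve D" for q
    using norm1[of "snd q" "fst q"] that by (auto simp: affine_curve_def)
  have q0: "(0, csqrt (poly D 0)) \<in> affine_curve D" by (simp add: affine_curve_def)
  have A': "degree A \<le> k * m" and B': "B = 0 \<or> degree B + (m + 2) \<le> k * m" using A B by auto
  obtain \<omega> where \<omega>: "k_differential surf k \<omega>" "represents k \<omega> ?F"
    using poly_section[OF A' B' q0] fin0[OF q0] by auto
  define a b where "a = lead_coeff A" and "b = lead_coeff B"
  have N0: "N \<noteq> 0" using d by simp
  have A0: "A \<noteq> 0" using A N0 by (auto simp: N_def)
  have ab: "a \<noteq> 0" "b \<noteq> 0" using A0 B0 by (auto simp: a_def b_def)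
  define A1 B1 where "A1 = reverse_poly N A" and "B1 = reverse_poly d B"
  have inf_F: "?F inf_patch q = (-1) ^ k * (poly A1 (fst q) + poly B1 (fst q) * snd q)" for q
    by (simp only: poly_function_simps A1_def B1_def N_def d_def)
  have at0: "poly A1 0 = a" "poly B1 0 = b"
    using poly_reverse_poly_0[of A N] poly_reverse_poly_0[of B d] A d by (simp_all add: A1_def B1_def a_def b_def N_def)
  have norm2: "(poly A1 u + poly B1 u * v) * (poly A1 u - poly B1 u * v) = u ^ (2 * N)"
    if v: "v\<^sup>2 = poly (reflect_poly D) u" for u v
  proof -
    have n: "(poly A1 u)\<^sup>2 - poly (reflect_poly D) u * (poly B1 u)\<^sup>2 = u ^ (2 * N)" if "u \<noteq> 0" for u
    proof -
      have 1: "poly A1 u = u ^ N * poly A (1 / u)" "poly B1 u = u ^ d * poly B (1 / u)"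
        using poly_reverse_poly[of A N u] poly_reverse_poly[of B d u] that A d by (simp_all add: A1_def B1_def N_def)
      have 2: "poly (reflect_poly D) u = u ^ (2 * (m + 2)) * poly D (1 / u)"
        using that by (simp add: poly_reflect_poly_nz deg inverse_eq_divide)
      have 3: "(u ^ N)\<^sup>2 = u ^ (2 * N)" "u ^ (2 * (m + 2)) * (u ^ d)\<^sup>2 = u ^ (2 * N)"
        unfolding d(2) power_mult[symmetric] power_add[symmetric] by (simp_all add: algebra_simps)
      have "(poly A (1 / u))\<^sup>2 - 1 = poly D (1 / u) * (poly B (1 / u))\<^sup>2"
        using arg_cong[OF pell, of "\<lambda>p. poly p (1 / u)"] by simp
      then have "(poly A (1 / u))\<^sup>2 - poly D (1 / u) * (poly B (1 / u))\<^sup>2 = 1" by (simp add: diff_eq_eq add.commute)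
      then have "u ^ (2 * N) * ((poly A (1 / u))\<^sup>2 - poly D (1 / u) * (poly B (1 / u))\<^sup>2) = u ^ (2 * N)" by simp
      moreover have "(poly A1 u)\<^sup>2 = u ^ (2 * N) * (poly A (1 / u))\<^sup>2"
        unfolding 1 power_mult_distrib 3 ..
      moreover have "poly (reflect_poly D) u * (poly B1 u)\<^sup>2 = u ^ (2 * N) * (poly D (1 / u) * (poly B (1 / u))\<^sup>2)"
        unfolding 1 2 power_mult_distrib 3(2)[symmetric] by (simp only: mult_ac)
      ultimately show ?thesis by (simp only: right_diff_distrib)
    qed
    have eq: "A1\<^sup>2 - reflect_poly D * B1\<^sup>2 = monom 1 (2 * N)"
    proof (rule ccontr)
      assume "A1\<^sup>2 - reflect_poly D * B1\<^sup>2 \<noteq> monom 1 (2 * N)"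
      then have "finite {u. poly (A1\<^sup>2 - reflect_poly D * B1\<^sup>2 - monom 1 (2 * N)) u = 0}"
        by (intro poly_roots_finite) simp
      moreover have "UNIV - {0} \<subseteq> {u. poly (A1\<^sup>2 - reflect_poly D * B1\<^sup>2 - monom 1 (2 * N)) u = 0}"
        using n by (auto simp: poly_monom)
      ultimately have "finite (UNIV - {0::complex})" by (rule finite_subset[rotated])
      then show False by (simp add: infinite_UNIV_char_0)
    qed
    have "(poly A1 u)\<^sup>2 - poly (reflect_poly D) u * (poly B1 u)\<^sup>2 = u ^ (2 * N)"
      using arg_cong[OF eq, of "\<lambda>p. poly p u"] by (simp add: poly_monom)
    moreover have "(poly A1 u + poly B1 u * v) * (poly A1 u - poly B1 u * v) = (poly A1 u)\<^sup>2 - v\<^sup>2 * (poly B1 u)\<^sup>2"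
      by (simp add: algebra_simps power2_eq_square)
    ultimately show ?thesis using v by simp
  qed
  define v0 where "v0 = - a / b"
  have v0: "v0 \<noteq> 0" "a + b * v0 = 0" using ab by (auto simp: v0_def)
  define p where "p = (0 :: complex, v0)"
  have p: "p \<in> affine_curve (reflect_poly D)"
  proof -
    obtain w where w: "w\<^sup>2 = poly (reflect_poly D) 0" by (metis power2_csqrt)
    then have "(a + b * w) * (a - b * w) = 0" using norm2[of w 0] N0 at0 by (simp add: zero_power)
    then have "b * w = - a \<or> b * w = a" by (auto simp only: mult_eq_0_iff add_eq_0_iff right_minus_eq minus_equation_iff)
    then have "w = v0 \<or> w = - v0"
      using ab by (auto simp: v0_def eq_divide_eq eq_minus_divide_eq mult.commute)
    then have "w\<^sup>2 = v0\<^sup>2" by auto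
    then show ?thesis using w by (simp add: p_def affine_curve_def)
  qed
  have zeros: "zeros surf \<omega> = {inf_patch p}"
  proof (rule unique_zeroI[OF \<omega>(2) poly_function_glued[OF A' B'] inf_patch_in p])
    fix q assume q: "q \<in> affine_curve D"
    have "inf_patch p \<noteq> finite_patch q" by (simp only: infinite_eq_finite_patch p_def) simp
    then show "?F finite_patch q = 0 \<longleftrightarrow> finite_patch q = inf_patch p" using fin0[OF q] by metis
  next
    fix v
    have "?F inf_patch (0, v) = 0 \<longleftrightarrow> a + b * v = 0" unfolding inf_F by (simp add: at0)
    also have "\<dots> \<longleftrightarrow> v = v0" using ab by (auto simp: v0_def field_simps add_eq_0_iff)
    also have "\<dots> \<longleftrightarrow> inf_patch (0, v) = inf_patch p" by (simp add: p_def infinite_patch_def)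
    finally show "?F inf_patch (0, v) = 0 \<longleftrightarrow> inf_patch (0, v) = inf_patch p" .
  qed
  obtain V where V: "(V, fst) \<in> affine_charts (reflect_poly D)" "p \<in> V"
    using affine_chart_fst[of 0 v0 "reflect_poly D"] p v0 by (auto simp: p_def)
  note hv = affine_chart_inverse(2)[OF patch(1)[OF inf_patch_in] V(1)]
  define v where "v = (\<lambda>w. snd (inv_into V fst w))"
  have vq: "v (fst q) = snd q" if "q \<in> V" for q
    using inv_into_f_f[OF affine_charts_inj[OF V(1)] that] by (simp add: v_def)
  have vnz: "v w \<noteq> 0" if "w \<in> fst ` V" for w
    using that vq V(1) fst_neq_snd by (auto simp: affine_charts_def)
  have oV: "open (fst ` V)" using affine_chart_open[OF patch(1)[OF inf_patch_in] V(1)] .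
  have hv': "v holomorphic_on fst ` V" using hv by (simp add: v_def)
  define S where "S = {w \<in> fst ` V. poly A1 w - poly B1 w * v w \<noteq> 0}"
  have oS: "open S"
  proof -
    have "continuous_on (fst ` V) (\<lambda>w. poly A1 w - poly B1 w * v w)"
      using hv' by (intro continuous_intros holomorphic_on_imp_continuous_on)
    then have "open (fst ` V \<inter> (\<lambda>w. poly A1 w - poly B1 w * v w) -` (- {0}))"
      using oV by (intro continuous_open_preimage) auto
    moreover have "fst ` V \<inter> (\<lambda>w. poly A1 w - poly B1 w * v w) -` (- {0}) = S" by (auto simp: S_def)
    ultimately show ?thesis by simp
  qed
  define g where "g = (\<lambda>w. (-1) ^ k / (poly A1 w - poly B1 w * v w) * (1 / v w) ^ k)"
  have "has_order_at surf \<omega> (inf_patch p) (2 * N)"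
  proof (rule has_orderI[OF \<omega>(2) inf_patch_in V oS])
    have v0': "v 0 = v0" using vq[OF V(2)] by (simp add: p_def)
    have "b * v0 = - a" using ab by (simp add: v0_def)
    then have "a - b * v0 = 2 * a" by simp
    then have "a - b * v0 \<noteq> 0" using ab(1) by (metis mult_eq_0_iff zero_neq_numeral)
    then have "poly A1 0 - poly B1 0 * v 0 \<noteq> 0" unfolding at0 v0' .
    moreover have "0 \<in> fst ` V" using V(2) by (force simp: p_def)
    ultimately show "fst p \<in> S" by (simp add: S_def p_def)
    show "S \<subseteq> fst ` V" by (auto simp: S_def)
    show "g holomorphic_on S"
      unfolding g_def using vnz by (intro holomorphic_intros holomorphic_on_subset[OF hv']) (auto simp: S_def)
    show "g (fst p) \<noteq> 0" using \<open>fst p \<in> S\<close> vnz by (auto simp: g_def S_def)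
    fix q assume q: "q \<in> V" "fst q \<in> S"
    have "q \<in> affine_curve (reflect_poly D)" using chart_subset[OF V(1)] q(1) by blast
    then have "(snd q)\<^sup>2 = poly (reflect_poly D) (fst q)" by (auto simp: affine_curve_def)
    then have n: "(poly A1 (fst q) + poly B1 (fst q) * snd q) * (poly A1 (fst q) - poly B1 (fst q) * snd q) = fst q ^ (2 * N)"
      by (rule norm2)
    have nz: "poly A1 (fst q) - poly B1 (fst q) * snd q \<noteq> 0" using q(2) vq[OF q(1)] by (simp add: S_def)
    have "poly A1 (fst q) + poly B1 (fst q) * snd q = fst q ^ (2 * N) / (poly A1 (fst q) - poly B1 (fst q) * snd q)"
      using n nz by (simp add: eq_divide_eq)
    then show "?F inf_patch q * theta (reflect_poly D) fst q ^ k = g (fst q) * (fst q - fst p) ^ (2 * N)"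
      unfolding inf_F g_def vq[OF q(1)] theta_simps by (simp add: p_def)
  qed
  moreover have "2 * N = k * (2 * m)" by (simp add: N_def)
  ultimately have "has_unique_zero_of_order surf \<omega> (k * (2 * m))"
    using zeros unfolding has_unique_zero_of_order_def by metis
  then show thesis using that \<omega> by blast
qed

end

lemma exists_primitive:
  assumes m: "m \<ge> 1" and k: "k \<ge> 2" and km: "k * m \<ge> m + 2"
  shows "\<exists>D \<omega>. totally_real (m + 1) D \<and> primitive_k_differential (hyperelliptic_curve D) k \<omega> \<and>
    has_unique_zero_of_order (hyperelliptic_curve D) \<omega> (k * (2 * m))"
proof -
  obtain A B R :: "real poly" and a b where R: "degree A = k * m" "A\<^sup>2 - 1 = R * B\<^sup>2" "degree R = 2 * (m + 1) + 2"
    "card {x. poly R x = 0} = 2 * (m + 1) + 2" and ab: "a < b" "poly R a = 0" "poly R b = 0"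
    "poly A a = - poly A b" "\<bar>poly A a\<bar> = 1" "\<And>x. a < x \<Longrightarrow> x < b \<Longrightarrow> \<bar>poly A x\<bar> < 1"
    by (rule real_pell_abel_solution[of "m + 1" "k * m"]) (use m km in auto)
  let ?A = "complex_poly A" and ?B = "complex_poly B" and ?D = "complex_poly R"
  have tr: "totally_real (m + 1) ?D"
  proof (rule totally_realI)
    show "card (complex_of_real ` {x. poly R x = 0}) = 2 * (m + 1) + 2"
      using R(4) by (subst card_image) (auto simp: inj_on_def)
  qed (use R in \<open>auto simp: degree_map_poly poly_complex_poly\<close>)
  interpret curve ?D m
    using tr by unfold_locales (auto simp: totally_real_def)
  have pell: "?A\<^sup>2 - 1 = ?D * ?B\<^sup>2"
    using arg_cong[OF R(2), of complex_poly]
    by (simp add: complex_poly_mult complex_poly_diff power2_eq_square)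
  have "degree (A\<^sup>2 - 1) = 2 * (k * m)"
  proof -
    have "A \<noteq> 0" using R(1) km by auto
    then have "degree (A\<^sup>2) = 2 * (k * m)" using R(1) by (simp add: degree_power_eq)
    then show ?thesis using diff_const_poly(1)[of "A\<^sup>2" 1] km m k by (simp add: one_pCons)
  qed
  moreover from this have nz: "R \<noteq> 0" "B \<noteq> 0" using R(2) km by auto
  ultimately have degB: "degree B + (m + 2) = k * m"
    using R(3) unfolding R(2) by (simp add: degree_mult_eq degree_power_eq)
  obtain \<omega> where \<omega>: "k_differential surf k \<omega>" "represents k \<omega> (poly_function k ?A ?B)"
    "has_unique_zero_of_order surf \<omega> (k * (2 * m))"
    by (rule pell_function_zero[OF pell])
      (use R(1) degB nz in \<open>auto simp: degree_map_poly map_poly_eq_0_iff\<close>)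
  have "\<not> (\<exists>k' j \<eta>. 0 < k' \<and> k' < k \<and> j * k' = k \<and> k_differential surf k' \<eta> \<and> is_tensor_power surf \<eta> j \<omega>)"
  proof
    assume "\<exists>k' j \<eta>. 0 < k' \<and> k' < k \<and> j * k' = k \<and> k_differential surf k' \<eta> \<and> is_tensor_power surf \<eta> j \<omega>"
    then obtain k' j \<eta> where k': "0 < k'" "k' < k" "j * k' = k" and \<eta>: "k_differential surf k' \<eta>" "is_tensor_power surf \<eta> j \<omega>"
      by blast
    have "j \<noteq> 0" "j \<noteq> 1" using k' by auto
    then have j: "j \<ge> 2" by simp
    have "holomorphic_section surf k' \<eta>" using \<eta>(1) unfolding k_differential_def by (rule conjunct1)
    then obtain G where G: "represents k' \<eta> G" "continuous_on (affine_curve ?D) (G finite_patch)"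
      using section_function finite_patch_in by metis
    have "represents (j * k') \<omega> (poly_function k ?A ?B)" using \<omega>(2) k'(3) by simp
    then have pow: "poly_function k ?A ?B finite_patch q = G finite_patch q ^ j" if "q \<in> affine_curve ?D" for q
      using tensor_power_iff[OF G(1)] \<eta>(2) finite_patch_in that by blast
    show False
    proof (rule no_root_on_oval[OF R(2) ab(1-5) ab(6) j _ G(2)])
      fix x y assume y: "y\<^sup>2 = complex_of_real (poly R x)"
      show c: "(complex_of_real x, y) \<in> affine_curve ?D"
        using y by (simp add: affine_curve_def poly_complex_poly)
      show "G finite_patch (complex_of_real x, y) ^ j = complex_of_real (poly A x) + complex_of_real (poly B x) * y"
        using pow[OF c] by (simp add: poly_complex_poly)
    qed
  qed
  then have "primitive_k_differential surf k \<omega>" using \<omega>(1) unfolding primitive_k_differential_def by blast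
  then show ?thesis using tr \<omega>(3) by blast
qed

text \<open>At the branch point over 0 the coordinate is \<open>y\<close>, and \<open>x = y\<^sup>2 / D1 x\<close> for \<open>D x = x * D1 x\<close>, so that
\<open>x ^ m\<close> vanishes to order \<open>2 m\<close>.\<close>

lemma exists_abelian:
  assumes m: "m \<ge> 1"
  shows "\<exists>D \<omega>. totally_real (m + 1) D \<and> primitive_k_differential (hyperelliptic_curve D) 1 \<omega> \<and>
    has_unique_zero_of_order (hyperelliptic_curve D) \<omega> (2 * m)"
proof -
  define D1 :: "complex poly" where "D1 = (\<Prod>i\<in>{1..<2 * m + 4}. [:- of_nat i, 1:])"
  define D where "D = [:0, 1:] * D1"
  have D1: "poly D1 x = (\<Prod>i\<in>{1..<2 * m + 4}. x - of_nat i)" for x by (simp add: D1_def poly_prod)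
  have D1_0: "poly D1 0 \<noteq> 0" by (simp add: D1)
  have polyD: "poly D x = x * poly D1 x" for x by (simp add: D_def)
  have tr: "totally_real (m + 1) D"
  proof (rule totally_realI)
    have "degree D1 = 2 * m + 3" unfolding D1_def by (subst degree_prod_eq_sum_degree) auto
    then show "degree D = 2 * (m + 1) + 2" using D1_0 by (subst D_def, subst degree_mult_eq) auto
    show "card (of_nat ` {..<2 * m + 4} :: complex set) = 2 * (m + 1) + 2"
      by (subst card_image) (auto simp: inj_on_def)
    show "of_nat ` {..<2 * m + 4} \<subseteq> (\<real> :: complex set)" by auto
    show "poly D x = 0" if x: "x \<in> of_nat ` {..<2 * m + 4}" for x
    proof -
      obtain i where i: "i < 2 * m + 4" "x = of_nat i" using x by auto
      then show ?thesis by (cases "i = 0") (auto simp: polyD D1)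
    qed
  qed
  interpret curve D m
    using tr by unfold_locales (auto simp: totally_real_def)
  let ?A = "monom 1 m :: complex poly" and ?F = "poly_function 1 (monom 1 m) 0"
  have A': "degree ?A \<le> 1 * m" by (simp add: degree_monom_eq)
  have q1: "(1, csqrt (poly D 1)) \<in> affine_curve D" by (simp add: affine_curve_def)
  obtain \<omega> where \<omega>: "k_differential surf 1 \<omega>" "represents 1 \<omega> ?F"
    by (rule poly_section[OF A' _ q1]) (auto simp: poly_monom)
  define p where "p = (0 :: complex, 0 :: complex)"
  have p: "p \<in> affine_curve D" by (simp add: p_def affine_curve_def polyD)
  have glued: "glued 1 ?F" by (rule poly_function_glued[OF A']) simp
  have zeros: "zeros surf \<omega> = {finite_patch p}"
  proof (rule unique_zeroI[OF \<omega>(2) glued finite_patch_in p])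
    fix q assume q: "q \<in> affine_curve D"
    have "?F finite_patch q = 0 \<longleftrightarrow> fst q = 0" using m by (simp add: poly_monom)
    also have "\<dots> \<longleftrightarrow> q = p" using q by (auto simp: affine_curve_def p_def polyD)
    also have "\<dots> \<longleftrightarrow> finite_patch q = finite_patch p"
      using injD[OF patch(3)[OF finite_patch_in]] by blast
    finally show "?F finite_patch q = 0 \<longleftrightarrow> finite_patch q = finite_patch p" .
  next
    fix v
    have "poly (reverse_poly (1 * m) ?A) 0 = 1" using poly_reverse_poly_0[OF A'] by simp
    then have "?F inf_patch (0, v) \<noteq> 0"
      unfolding poly_function_simps by (simp add: reverse_poly_def[of _ 0])
    moreover have "inf_patch (0, v) \<noteq> finite_patch p" by (simp add: infinite_eq_finite_patch)
    ultimately show "?F inf_patch (0, v) = 0 \<longleftrightarrow> inf_patch (0, v) = finite_patch p" by blast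
  qed
  have dD0: "poly (pderiv D) 0 \<noteq> 0" using D1_0 by (simp add: D_def pderiv_mult pderiv_pCons)
  obtain V \<phi> where V': "(V, \<phi>) \<in> affine_charts D" "p \<in> V" using affine_charts_cover[OF rsq p] by blast
  have \<phi>: "\<phi> = snd" using V' by (auto simp: affine_charts_def p_def)
  note V = V'[unfolded \<phi>]
  define X where "X = (\<lambda>w. fst (inv_into V snd w))"
  have hX: "X holomorphic_on snd ` V" using affine_chart_inverse(1)[OF rsq V(1)] by (simp add: X_def)
  have Xq: "X (snd q) = fst q" if "q \<in> V" for q
    using inv_into_f_f[OF affine_charts_inj[OF V(1)] that] by (simp add: X_def)
  have dD: "poly (pderiv D) (X w) \<noteq> 0" if "w \<in> snd ` V" for w
    using that Xq V(1) fst_neq_snd by (auto simp: affine_charts_def)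
  have oV: "open (snd ` V)" using affine_chart_open[OF rsq V(1)] .
  define S where "S = {w \<in> snd ` V. poly D1 (X w) \<noteq> 0}"
  have oS: "open S"
  proof -
    have "continuous_on (snd ` V) (\<lambda>w. poly D1 (X w))"
      using hX by (intro continuous_intros holomorphic_on_imp_continuous_on)
    then have "open (snd ` V \<inter> (\<lambda>w. poly D1 (X w)) -` (- {0}))"
      using oV by (intro continuous_open_preimage) auto
    moreover have "snd ` V \<inter> (\<lambda>w. poly D1 (X w)) -` (- {0}) = S" by (auto simp: S_def)
    ultimately show ?thesis by simp
  qed
  define g where "g = (\<lambda>w. (1 / poly D1 (X w)) ^ m * (2 / poly (pderiv D) (X w)))"
  have "has_order_at surf \<omega> (finite_patch p) (2 * m)"
  proof (rule has_orderI[OF \<omega>(2) finite_patch_in V oS])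
    have "X 0 = 0" using Xq[OF V(2)] by (simp add: p_def)
    moreover have "0 \<in> snd ` V" using V(2) by (force simp: p_def)
    ultimately show "snd p \<in> S" using D1_0 by (simp add: S_def p_def)
    show "S \<subseteq> snd ` V" by (auto simp: S_def)
    show "g holomorphic_on S"
      unfolding g_def using dD by (intro holomorphic_intros holomorphic_on_subset[OF hX]) (auto simp: S_def)
    show "g (snd p) \<noteq> 0" using \<open>snd p \<in> S\<close> dD by (auto simp: g_def S_def)
    fix q assume q: "q \<in> V" "snd q \<in> S"
    have "q \<in> affine_curve D" using chart_subset[OF V(1)] q(1) by blast
    then have e: "(snd q)\<^sup>2 = fst q * poly D1 (fst q)" by (auto simp: affine_curve_def polyD)
    have "poly D1 (fst q) \<noteq> 0" using q(2) Xq[OF q(1)] by (simp add: S_def)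
    then have "fst q = (snd q)\<^sup>2 * (1 / poly D1 (fst q))" unfolding e by simp
    then have "fst q ^ m = snd q ^ (2 * m) * (1 / poly D1 (fst q)) ^ m"
      by (metis power_mult power_mult_distrib)
    then show "?F finite_patch q * theta D snd q ^ 1 = g (snd q) * (snd q - snd p) ^ (2 * m)"
      unfolding g_def Xq[OF q(1)] theta_simps by (simp add: p_def poly_monom)
  qed
  then have "has_unique_zero_of_order surf \<omega> (2 * m)"
    using zeros unfolding has_unique_zero_of_order_def by blast
  moreover have "primitive_k_differential surf 1 \<omega>"
    using \<omega>(1) unfolding primitive_k_differential_def by auto
  ultimately show ?thesis using tr by blast
qed


section \<open>Differentials of low degree\<close>

lemma card_roots_rsquarefree:
  fixes D :: "complex poly"
  assumes "rsquarefree D"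
  shows "card {x. poly D x = 0} = degree D"
proof -
  have D0: "D \<noteq> 0" using assms by (auto simp: rsquarefree_def)
  have "degree D = degree (smult (lead_coeff D) (\<Prod>z | poly D z = 0. [:- z, 1:]))"
    using complex_poly_decompose_rsquarefree[OF assms] by simp
  also have "\<dots> = degree (\<Prod>z | poly D z = 0. [:- z, 1:])" using D0 by simp
  also have "\<dots> = card {x. poly D x = 0}" by (subst degree_prod_eq_sum_degree) auto
  finally show ?thesis by simp
qed

lemma degree_linear_mult: "p \<noteq> 0 \<Longrightarrow> degree ([:- a, 1:] * p) = Suc (degree p)" for p :: "complex poly"
  by (subst degree_mult_eq) auto

context curve
begin

text \<open>Such a function descends to the \<open>x\<close>-line. It is holomorphic outside of the roots of \<open>D\<close>, where the
singularities are removable by continuity, and Liouville's theorem applies.\<close>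

lemma even_function_polynomial:
  assumes cont: "continuous_on (affine_curve D) G"
    and even: "\<And>x y. (x, y) \<in> affine_curve D \<Longrightarrow> G (x, - y) = G (x, y)"
    and hol: "\<And>V. (V, fst) \<in> affine_charts D \<Longrightarrow> (\<lambda>z. G (inv_into V fst z)) holomorphic_on fst ` V"
    and growth: "\<And>q. q \<in> affine_curve D \<Longrightarrow> 1 \<le> norm (fst q) \<Longrightarrow> norm (G q) \<le> C * norm (fst q) ^ N"
  obtains p where "degree p \<le> N" "\<And>q. q \<in> affine_curve D \<Longrightarrow> G q = poly p (fst q)"
proof -
  define f where "f = (\<lambda>x. G (x, csqrt (poly D x)))"
  have on_curve: "(x, csqrt (poly D x)) \<in> affine_curve D" for x by (simp add: affine_curve_def)
  have Gf: "G q = f (fst q)" if "q \<in> affine_curve D" for q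
  proof -
    obtain x y where q: "q = (x, y)" by fastforce
    have "y\<^sup>2 = (csqrt (poly D x))\<^sup>2" using that by (simp add: q affine_curve_def)
    then have "y = csqrt (poly D x) \<or> y = - csqrt (poly D x)" by (rule power2_eq_iff[THEN iffD1])
    then show ?thesis using even[OF on_curve[of x]] by (auto simp: q f_def)
  qed
  have D0: "D \<noteq> 0" using deg by auto
  let ?Z = "{x. poly D x = 0}"
  have fin: "finite ?Z" using D0 by (rule poly_roots_finite)
  have hol_f: "f holomorphic_on UNIV - ?Z"
    unfolding holomorphic_on_def
  proof
    fix x assume x: "x \<in> UNIV - ?Z"
    then have "csqrt (poly D x) \<noteq> 0" by simp
    then obtain V where V: "(V, fst) \<in> affine_charts D" "(x, csqrt (poly D x)) \<in> V"
      using affine_chart_fst[OF on_curve] by metis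
    have op: "open (fst ` V)" using affine_chart_open[OF rsq V(1)] .
    have "f z = G (inv_into V fst z)" if "z \<in> fst ` V" for z
      using Gf[of "inv_into V fst z"] inv_into_into[OF that] f_inv_into_f[OF that] chart_subset[OF V(1)] by auto
    then have "f holomorphic_on fst ` V" using hol[OF V(1)] by (simp cong: holomorphic_cong)
    moreover have "x \<in> fst ` V" using V(2) by force
    ultimately have "f field_differentiable (at x)" using op holomorphic_on_imp_differentiable_at by blast
    then show "f field_differentiable (at x within UNIV - ?Z)" by (rule field_differentiable_at_within)
  qed
  have "f holomorphic_on UNIV"
  proof (rule no_isolated_singularity'[OF _ hol_f open_UNIV fin])
    fix e assume e: "e \<in> ?Z"
    have "((\<lambda>x. poly D x) \<longlongrightarrow> poly D e) (at e)" by (intro tendsto_intros)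
    then have "((\<lambda>x. sqrt (norm (poly D x))) \<longlongrightarrow> sqrt (norm (poly D e))) (at e)" by (intro tendsto_intros)
    then have "((\<lambda>x. norm (csqrt (poly D x))) \<longlongrightarrow> 0) (at e)" using e by (simp add: norm_csqrt)
    then have "((\<lambda>x. csqrt (poly D x)) \<longlongrightarrow> 0) (at e)" by (rule tendsto_norm_zero_cancel)
    then have "((\<lambda>x. (x, csqrt (poly D x))) \<longlongrightarrow> (e, 0)) (at e)" by (intro tendsto_intros)
    then have "((\<lambda>x. G (x, csqrt (poly D x))) \<longlongrightarrow> G (e, 0)) (at e)"
      by (rule continuous_on_tendsto_compose[OF cont]) (use e in \<open>auto simp: affine_curve_def\<close>)
    then show "(f \<longlongrightarrow> f e) (at e within UNIV)" using e by (simp add: f_def)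
  qed
  moreover have "norm (f z) \<le> C * norm z ^ N" if "1 \<le> norm z" for z
    using growth[OF on_curve[of z]] that by (simp add: f_def)
  ultimately have L: "f z = (\<Sum>k\<le>N. (deriv ^^ k) f 0 / fact k * z ^ k)" for z
    by (rule Liouville_polynomial)
  define p where "p = (\<Sum>k\<le>N. monom ((deriv ^^ k) f 0 / fact k) k)"
  have "f z = poly p z" for z unfolding p_def poly_sum poly_monom by (rule L)
  moreover have "degree p \<le> N"
    unfolding p_def by (intro degree_sum_le) (auto intro: order_trans[OF degree_monom_le])
  ultimately show thesis using that Gf by auto
qed

text \<open>In the patch at infinity the points with \<open>\<bar>x\<bar> \<ge> 1\<close> form a compact set.\<close>

lemma section_growth:
  assumes glued: "glued k F" and cont: "continuous_on (affine_curve (reflect_poly D)) (F inf_patch)"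
  obtains C where "C \<ge> 0" "\<And>q. q \<in> affine_curve D \<Longrightarrow> 1 \<le> norm (fst q) \<Longrightarrow> norm (F finite_patch q) \<le> C * norm (fst q) ^ (k * m)"
proof -
  let ?Q = "reflect_poly D"
  define L where "L = affine_curve ?Q \<inter> cball 0 1 \<times> UNIV"
  have "compact L"
  proof -
    have "compact (poly ?Q ` cball 0 1)" by (intro compact_continuous_image continuous_intros) auto
    then obtain M where M: "\<And>x. x \<in> cball 0 1 \<Longrightarrow> norm (poly ?Q x) \<le> M"
      by (meson bounded_iff compact_imp_bounded imageI)
    have "L \<subseteq> cball 0 1 \<times> cball 0 (M + 1)"
    proof
      fix p assume "p \<in> L"
      then obtain x y where xy: "p = (x, y)" "x \<in> cball 0 1" "y\<^sup>2 = poly ?Q x"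
        by (auto simp: L_def affine_curve_def)
      have "(norm y)\<^sup>2 \<le> M" using M xy by (metis norm_power)
      moreover have "norm y \<le> (norm y)\<^sup>2 + 1"
        using zero_le_power2[of "norm y - 1/2"] by (simp add: power2_eq_square algebra_simps)
      ultimately show "p \<in> cball 0 1 \<times> cball 0 (M + 1)" using xy by auto
    qed
    then have "bounded L" by (rule bounded_subset[OF bounded_Times[OF bounded_cball bounded_cball]])
    moreover have "closed L"
    proof -
      have "affine_curve ?Q = {p. (snd p)\<^sup>2 = poly ?Q (fst p)}" by (auto simp: affine_curve_def)
      then show ?thesis unfolding L_def
        by (auto intro!: closed_Int closed_Collect_eq continuous_intros closed_Times)
    qed
    ultimately show ?thesis by (simp add: compact_eq_bounded_closed)
  qed
  then have "compact (F inf_patch ` L)"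
    by (rule compact_continuous_image[rotated]) (rule continuous_on_subset[OF cont], auto simp: L_def)
  then obtain C where C: "\<And>q. q \<in> L \<Longrightarrow> norm (F inf_patch q) \<le> C"
    by (meson bounded_iff compact_imp_bounded imageI)
  show thesis
  proof (rule that[of "max C 0"])
    fix q assume q: "q \<in> affine_curve D" "1 \<le> norm (fst q)"
    then have nz: "fst q \<noteq> 0" by auto
    have "flip (m + 2) q \<in> L"
      using flip_affine[OF q(1) nz] q(2) by (auto simp: L_def mem_Times_iff norm_divide divide_le_eq_1)
    then have "norm (F inf_patch (flip (m + 2) q)) \<le> max C 0" using C by (meson max.coboundedI1)
    moreover have "norm (F finite_patch q) = norm (fst q) ^ (k * m) * norm (F inf_patch (flip (m + 2) q))"
    proof -
      have "F finite_patch q = (- (fst q ^ m)) ^ k * F inf_patch (flip (m + 2) q)"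
        using glued q(1) nz unfolding glued_def by blast
      then show ?thesis by (simp add: norm_mult norm_power mult.commute flip: power_mult)
    qed
    ultimately show "norm (F finite_patch q) \<le> max C 0 * norm (fst q) ^ (k * m)"
      by (simp only: mult.commute[of "norm (fst q) ^ (k * m)"]) (rule mult_right_mono, simp_all)
  qed simp
qed

definition involution :: "complex \<times> complex \<Rightarrow> complex \<times> complex" where
  "involution q = (fst q, - snd q)"

lemma involution_affine: "involution q \<in> affine_curve P \<longleftrightarrow> q \<in> affine_curve P"
  by (cases q) (auto simp: involution_def affine_curve_def)

lemma involution_simps [simp]: "fst (involution q) = fst q" "snd (involution q) = - snd q" "involution (involution q) = q"
  by (auto simp: involution_def)

lemma involution_continuous: "continuous_on S involution"
  unfolding involution_def by (intro continuous_intros)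

lemma involution_chart:
  assumes V: "(V, fst) \<in> affine_charts P"
  shows "(involution ` V, fst) \<in> affine_charts P"
    and "\<And>z. z \<in> fst ` V \<Longrightarrow> inv_into (involution ` V) fst z = involution (inv_into V fst z)"
    and "fst ` involution ` V = fst ` V"
proof -
  have inj: "inj_on fst (involution ` V)" using affine_charts_inj[OF V] by (auto simp: inj_on_def)
  have nz: "snd q \<noteq> 0" if "q \<in> V" for q using V that fst_neq_snd by (auto simp: affine_charts_def)
  obtain T where T: "open T" "V = affine_curve P \<inter> T"
    using affine_charts_openin[OF V] by (auto simp: openin_open)
  have "involution ` V = affine_curve P \<inter> involution -` T"
  proof (rule set_eqI)
    fix q
    have "q \<in> involution ` V \<longleftrightarrow> involution q \<in> V" by (metis involution_simps(3) imageE imageI)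
    then show "q \<in> involution ` V \<longleftrightarrow> q \<in> affine_curve P \<inter> involution -` T"
      using T(2) involution_affine by auto
  qed
  moreover have "open (involution -` T)" using T(1) involution_continuous by (intro open_vimage)
  ultimately have "openin (top_of_set (affine_curve P)) (involution ` V)" by (simp add: openin_open_Int)
  moreover have "\<forall>(x, y)\<in>involution ` V. y \<noteq> 0" using nz by (auto simp: involution_def)
  ultimately show "(involution ` V, fst) \<in> affine_charts P" using inj by (auto simp: affine_charts_def)
  show "inv_into (involution ` V) fst z = involution (inv_into V fst z)" if "z \<in> fst ` V" for z
    by (rule inv_into_f_eq[OF inj]) (use inv_into_into[OF that] f_inv_into_f[OF that] in auto)
  show "fst ` involution ` V = fst ` V" by (simp add: image_image)
qed

text \<open>The square of the odd part \<open>f (x, y) - f (x, - y)\<close> is a polynomial in \<open>x\<close> of degree at most \<open>2 k m\<close>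
that vanishes at the \<open>2 m + 4\<close> roots of \<open>D\<close>. So the odd part is zero and \<open>f\<close> is a polynomial in
\<open>x\<close>.\<close>

lemma low_degree_section:
  assumes \<omega>: "represents k \<omega> F" and glued: "glued k F" and reg: "regular F"
    and cont: "\<And>P \<iota>. (P, \<iota>) \<in> patches D \<Longrightarrow> continuous_on (affine_curve P) (F \<iota>)"
    and km: "k * m < m + 2"
  obtains p where "degree p \<le> k * m"
    "\<And>P \<iota> q. (P, \<iota>) \<in> patches D \<Longrightarrow> q \<in> affine_curve P \<Longrightarrow> F \<iota> q = poly_function k p 0 \<iota> q"
proof -
  define f where "f = F finite_patch"
  have cf: "continuous_on (affine_curve D) f" using cont[OF finite_patch_in] by (simp add: f_def)
  have cf': "continuous_on (affine_curve D) (\<lambda>q. f (involution q))"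
    by (rule continuous_on_compose2[OF cf involution_continuous]) (auto simp: involution_affine)
  have hf: "(\<lambda>z. f (inv_into V fst z)) holomorphic_on fst ` V" if "(V, fst) \<in> affine_charts D" for V
    using reg finite_patch_in that unfolding regular_def f_def by blast
  have hf': "(\<lambda>z. f (involution (inv_into V fst z))) holomorphic_on fst ` V" if V: "(V, fst) \<in> affine_charts D" for V
    using hf[OF involution_chart(1)[OF V]] involution_chart(2)[OF V] unfolding involution_chart(3)[OF V]
    by (simp cong: holomorphic_cong)
  obtain C where C: "C \<ge> 0" "\<And>q. q \<in> affine_curve D \<Longrightarrow> 1 \<le> norm (fst q) \<Longrightarrow> norm (f q) \<le> C * norm (fst q) ^ (k * m)"
    using section_growth[OF glued cont[OF inf_patch_in]] unfolding f_def by metis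
  have C': "norm (f (involution q)) \<le> C * norm (fst q) ^ (k * m)" if "q \<in> affine_curve D" "1 \<le> norm (fst q)" for q
    using C(2)[of "involution q"] that by (simp add: involution_affine)
  obtain p2 where p2: "degree p2 \<le> 2 * (k * m)" "\<And>q. q \<in> affine_curve D \<Longrightarrow> (f q - f (involution q))\<^sup>2 = poly p2 (fst q)"
  proof (rule even_function_polynomial[of "\<lambda>q. (f q - f (involution q))\<^sup>2" "(2 * C)\<^sup>2" "2 * (k * m)"])
    show "continuous_on (affine_curve D) (\<lambda>q. (f q - f (involution q))\<^sup>2)"
      using cf cf' by (intro continuous_intros)
    show "(\<lambda>z. (f (inv_into V fst z) - f (involution (inv_into V fst z)))\<^sup>2) holomorphic_on fst ` V"
      if "(V, fst) \<in> affine_charts D" for V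
      using hf[OF that] hf'[OF that] by (intro holomorphic_intros)
    show "(f (x, - y) - f (involution (x, - y)))\<^sup>2 = (f (x, y) - f (involution (x, y)))\<^sup>2" for x y
      by (simp add: involution_def power2_commute)
    fix q assume q: "q \<in> affine_curve D" "1 \<le> norm (fst q)"
    have "norm (f q - f (involution q)) \<le> 2 * C * norm (fst q) ^ (k * m)"
      using norm_triangle_ineq4[of "f q" "f (involution q)"] C(2)[OF q] C'[OF q] by simp
    then have "(norm (f q - f (involution q)))\<^sup>2 \<le> (2 * C * norm (fst q) ^ (k * m))\<^sup>2" by (intro power_mono) auto
    then show "norm ((f q - f (involution q))\<^sup>2) \<le> (2 * C)\<^sup>2 * norm (fst q) ^ (2 * (k * m))"
      by (simp add: norm_power power_mult_distrib mult.commute[of 2] flip: power_mult)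
  qed blast
  have "p2 = 0"
  proof (rule ccontr)
    assume p0: "p2 \<noteq> 0"
    have "{x. poly D x = 0} \<subseteq> {x. poly p2 x = 0}"
    proof clarify
      fix x assume "poly D x = 0"
      then have "(x, 0) \<in> affine_curve D" by (simp add: affine_curve_def)
      from p2(2)[OF this] show "poly p2 x = 0" by (simp add: involution_def)
    qed
    then have "card {x. poly D x = 0} \<le> card {x. poly p2 x = 0}"
      by (rule card_mono[OF poly_roots_finite[OF p0]])
    also have "\<dots> \<le> degree p2" by (rule card_poly_roots_bound[OF p0])
    finally show False using p2(1) card_roots_rsquarefree[OF rsq] deg km by simp
  qed
  then have inv: "f (involution q) = f q" if "q \<in> affine_curve D" for q using p2(2)[OF that] by simp
  obtain p where p: "degree p \<le> k * m" "\<And>q. q \<in> affine_curve D \<Longrightarrow> f q = poly p (fst q)"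
    by (rule even_function_polynomial[OF cf _ hf C(2)]) (use inv in \<open>auto simp: involution_def\<close>)
  let ?G = "poly_function k p 0"
  have G: "glued k ?G" by (rule poly_function_glued[OF p(1)]) simp
  have fin: "F finite_patch q = ?G finite_patch q" if "q \<in> affine_curve D" for q
    using p(2)[OF that] by (simp add: f_def)
  have inf_ne: "F inf_patch q = ?G inf_patch q" if q: "q \<in> affine_curve (reflect_poly D)" "fst q \<noteq> 0" for q
  proof -
    have e: "inf_patch q = finite_patch (flip (m + 2) q)" using q by (simp add: infinite_eq_finite_patch)
    have r: "flip (m + 2) q \<in> affine_curve D" using q by (rule flip_reflected_affine)
    show ?thesis
      using glued_overlap[OF glued inf_patch_in q(1) finite_patch_in r e]
        glued_overlap[OF G inf_patch_in q(1) finite_patch_in r e] fin[OF r] by simp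
  qed
  \<comment> \<open>The points at infinity are limits of points of the finite patch.\<close>
  have inf_0: "F inf_patch q = ?G inf_patch q" if q: "q \<in> affine_curve (reflect_poly D)" "fst q = 0" for q
  proof -
    have "(snd q)\<^sup>2 = lead_coeff D" using q by (auto simp: affine_curve_def)
    moreover have "D \<noteq> 0" using deg by auto
    ultimately have "snd q \<noteq> 0" by auto
    then obtain V where "(V, fst) \<in> affine_charts (reflect_poly D)" "(fst q, snd q) \<in> V"
      using affine_chart_fst[of "fst q" "snd q" "reflect_poly D"] q(1) by (metis prod.collapse)
    then have V: "(V, fst) \<in> affine_charts (reflect_poly D)" "q \<in> V" by simp_all
    let ?d = "\<lambda>z. F inf_patch (inv_into V fst z) - ?G inf_patch (inv_into V fst z)"
    have "?d holomorphic_on fst ` V"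
      using reg poly_function_regular[of k p 0] inf_patch_in V(1) unfolding regular_def
      by (intro holomorphic_intros) blast+
    moreover have op: "open (fst ` V)" using affine_chart_open[OF patch(1)[OF inf_patch_in] V(1)] .
    moreover have z: "0 \<in> fst ` V" using V(2) q(2) by force
    ultimately have "isCont ?d 0"
      using holomorphic_on_imp_continuous_on continuous_on_eq_continuous_at by blast
    then have l: "?d \<midarrow>0\<rightarrow> ?d 0" by (simp add: isCont_def)
    have "\<forall>\<^sub>F z in at 0. ?d z = 0"
    proof -
      have "\<forall>\<^sub>F z in at 0. z \<in> fst ` V - {0}" using op z by (intro eventually_at_in_open)
      then show ?thesis
      proof eventually_elim
        case (elim z)
        then have z': "z \<in> fst ` V" "z \<noteq> 0" by auto
        have "inv_into V fst z \<in> affine_curve (reflect_poly D)" "fst (inv_into V fst z) = z"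
          using inv_into_into[OF z'(1)] f_inv_into_f[OF z'(1)] chart_subset[OF V(1)] by auto
        then show ?case using inf_ne[of "inv_into V fst z"] z'(2) by simp
      qed
    qed
    then have "?d \<midarrow>0\<rightarrow> 0" by (rule tendsto_eventually)
    then have "?d 0 = 0" using l LIM_unique by blast
    moreover have "inv_into V fst 0 = q" using inv_into_f_eq[OF affine_charts_inj[OF V(1)] V(2)] q(2) by simp
    ultimately show ?thesis by simp
  qed
  show thesis
  proof (rule that[OF p(1)])
    fix P \<iota> q assume P: "(P, \<iota>) \<in> patches D" "q \<in> affine_curve P"
    then consider "P = D" "\<iota> = finite_patch" | "P = reflect_poly D" "\<iota> = inf_patch"
      by (auto simp: patches)
    then show "F \<iota> q = ?G \<iota> q"
    proof cases
      case 1
      then show ?thesis using fin P(2) by simp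
    next
      case 2
      then show ?thesis using inf_ne inf_0 P(2) by (cases "fst q = 0") auto
    qed
  qed
qed

end

text \<open>The coefficient is a polynomial \<open>p\<close> in \<open>x\<close> of degree at most 2. If its degree is less than 2, both
points at infinity are zeros. Otherwise \<open>p\<close> has a root, all of its roots coincide by uniqueness of the
zero, and \<open>p\<close> is a square.\<close>

lemma genus_2_quadratic_is_square:
  assumes D: "totally_real 2 D" and \<omega>: "k_differential (hyperelliptic_curve D) 2 \<omega>"
    and zero: "zeros (hyperelliptic_curve D) \<omega> = {P0}"
  shows "\<not> primitive_k_differential (hyperelliptic_curve D) 2 \<omega>"
proof -
  interpret curve D 1
    using D by unfold_locales (auto simp: totally_real_def)
  have "holomorphic_section surf 2 \<omega>" using \<omega> unfolding k_differential_def by (rule conjunct1)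
  then obtain F where F: "represents 2 \<omega> F" "glued 2 F" "regular F"
    "\<And>P \<iota>. (P, \<iota>) \<in> patches D \<Longrightarrow> continuous_on (affine_curve P) (F \<iota>)"
    using section_function by metis
  obtain p where p: "degree p \<le> 2 * 1"
    "\<And>P \<iota> q. (P, \<iota>) \<in> patches D \<Longrightarrow> q \<in> affine_curve P \<Longrightarrow> F \<iota> q = poly_function 2 p 0 \<iota> q"
    using low_degree_section[OF F] by auto
  have unique: "\<iota> q = \<kappa> r" if "(P, \<iota>) \<in> patches D" "q \<in> affine_curve P" "F \<iota> q = 0"
    "(Q, \<kappa>) \<in> patches D" "r \<in> affine_curve Q" "F \<kappa> r = 0" for P \<iota> q Q \<kappa> r
    using zeros_iff[OF F(1,2) that(1,2)] zeros_iff[OF F(1,2) that(4,5)] that(3,6) zero by auto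
  have c2: "coeff p 2 \<noteq> 0"
  proof
    assume c: "coeff p 2 = 0"
    have z: "F inf_patch (0, v) = 0" if "(0, v) \<in> affine_curve (reflect_poly D)" for v
    proof -
      have "poly (reverse_poly (2 * 1) p) 0 = 0" using poly_reverse_poly_0[of p "2 * 1"] p(1) c by simp
      then show ?thesis
        unfolding p(2)[OF inf_patch_in that] poly_function_simps by (simp add: reverse_poly_def[of _ 0])
    qed
    define v where "v = csqrt (lead_coeff D)"
    have "D \<noteq> 0" using deg by auto
    then have "v \<noteq> 0" by (simp add: v_def)
    have v: "(0, v) \<in> affine_curve (reflect_poly D)" "(0, - v) \<in> affine_curve (reflect_poly D)"
      by (auto simp: v_def affine_curve_def)
    have "inf_patch (0, v) = inf_patch (0, - v)"
      by (rule unique[OF inf_patch_in v(1) z[OF v(1)] inf_patch_in v(2) z[OF v(2)]])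
    then show False using \<open>v \<noteq> 0\<close> by (simp add: infinite_patch_def)
  qed
  have deg_p: "degree p = 2" using c2 p(1) le_degree[of p 2] by simp
  have fin: "F finite_patch q = poly p (fst q)" if "q \<in> affine_curve D" for q
    unfolding p(2)[OF finite_patch_in that] poly_function_simps by simp
  have roots: "a = b" if "poly p a = 0" "poly p b = 0" for a b
  proof -
    have q: "(x, csqrt (poly D x)) \<in> affine_curve D" for x by (simp add: affine_curve_def)
    have "finite_patch (a, csqrt (poly D a)) = finite_patch (b, csqrt (poly D b))"
      by (rule unique[OF finite_patch_in q _ finite_patch_in q]) (use fin[OF q] that in auto)
    then show ?thesis by (simp add: finite_patch_def)
  qed
  obtain a where a: "poly p a = 0" using deg_p alg_closed_imp_poly_has_root[of p] by auto
  obtain p1 where p1: "p = [:- a, 1:] * p1" using a by (meson dvdE poly_eq_0_iff_dvd)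
  have "degree p1 = 1"
  proof -
    have "p1 \<noteq> 0" using deg_p p1 by auto
    then show ?thesis using deg_p degree_linear_mult[of p1 a] p1 by simp
  qed
  then obtain b where b: "poly p1 b = 0" using alg_closed_imp_poly_has_root[of p1] by auto
  then have "b = a" using roots[of b a] a unfolding p1 by simp
  then obtain p2 where p2: "p1 = [:- a, 1:] * p2" using b by (meson dvdE poly_eq_0_iff_dvd)
  have "degree p2 = 0"
  proof -
    have "p2 \<noteq> 0" using \<open>degree p1 = 1\<close> p2 by auto
    then show ?thesis using \<open>degree p1 = 1\<close> degree_linear_mult[of p2 a] p2 by simp
  qed
  then obtain c where c: "p2 = [:c:]" by (meson degree_eq_zeroE)
  define s where "s = csqrt c"
  define A where "A = [:- (s * a), s:]"
  have pA: "p = A\<^sup>2"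
  proof -
    have "c = s * s" by (simp add: s_def flip: power2_eq_square)
    then show ?thesis unfolding p1 p2 c A_def by (simp add: power2_eq_square algebra_simps)
  qed
  have s0: "s \<noteq> 0" using pA deg_p by (auto simp: A_def)
  have degA: "degree A \<le> 1 * 1" by (simp add: A_def)
  have q0: "(a + 1, csqrt (poly D (a + 1))) \<in> affine_curve D" by (simp add: affine_curve_def)
  obtain \<eta> where \<eta>: "k_differential surf 1 \<eta>" "represents 1 \<eta> (poly_function 1 A 0)"
    by (rule poly_section[OF degA _ q0]) (use s0 in \<open>auto simp: A_def algebra_simps\<close>)
  have "represents (2 * 1) \<omega> F" using F(1) by simp
  from tensor_power_iff[OF \<eta>(2) this] have "is_tensor_power surf \<eta> 2 \<omega>"
  proof (rule iffD2, intro allI impI ballI)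
    fix P \<iota> q assume P: "(P, \<iota>) \<in> patches D" "q \<in> affine_curve P"
    have e: "F \<iota> q = poly_function 2 p 0 \<iota> q" using p(2)[OF P] .
    have inf: "poly (reverse_poly 2 p) u = (poly (reverse_poly 1 A) u)\<^sup>2" for u
    proof (cases "u = 0")
      case True
      then show ?thesis using poly_reverse_poly_0[of p 2] poly_reverse_poly_0[of A 1] deg_p degA
        by (simp add: pA A_def power2_eq_square numeral_2_eq_2)
    next
      case False
      then show ?thesis using poly_reverse_poly[of p 2 u] poly_reverse_poly[of A 1 u] deg_p degA
        by (simp add: pA power_mult_distrib)
    qed
    show "F \<iota> q = poly_function 1 A 0 \<iota> q ^ 2"
      unfolding e poly_function_def using inf[of "fst q"]
      by (simp add: pA reverse_poly_def[of _ 0])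
  qed
  then have "\<exists>k' j \<eta>. 0 < k' \<and> k' < 2 \<and> j * k' = 2 \<and> k_differential surf k' \<eta> \<and> is_tensor_power surf \<eta> j \<omega>"
    using \<eta>(1) by (intro exI[of _ 1] exI[of _ 2] exI[of _ \<eta>]) simp
  then show ?thesis unfolding primitive_k_differential_def by blast
qed


section \<open>The classification\<close>

theorem mainTheorem2:
  fixes g k :: nat
  assumes "g \<ge> 2" and "k \<ge> 1"
  shows "(\<exists>D \<omega>. totally_real g D \<and>
            primitive_k_differential (hyperelliptic_curve D) k \<omega> \<and>
            has_unique_zero_of_order (hyperelliptic_curve D) \<omega> (k * (2 * g - 2)))
         \<longleftrightarrow> (g, k) \<noteq> (2, 2)"
proof
  assume "\<exists>D \<omega>. totally_real g D \<and> primitive_k_differential (hyperelliptic_curve D) k \<omega> \<and>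
    has_unique_zero_of_order (hyperelliptic_curve D) \<omega> (k * (2 * g - 2))"
  then obtain D \<omega> where D: "totally_real g D" and prim: "primitive_k_differential (hyperelliptic_curve D) k \<omega>"
    and zero: "has_unique_zero_of_order (hyperelliptic_curve D) \<omega> (k * (2 * g - 2))"
    by blast
  obtain p where "zeros (hyperelliptic_curve D) \<omega> = {p}"
    using zero unfolding has_unique_zero_of_order_def by blast
  moreover have "k_differential (hyperelliptic_curve D) k \<omega>"
    using prim unfolding primitive_k_differential_def by (rule conjunct1)
  ultimately show "(g, k) \<noteq> (2, 2)"
    using genus_2_quadratic_is_square D prim by auto
next
  assume ne: "(g, k) \<noteq> (2, 2)"
  define m where "m = g - 1"
  have m: "m \<ge> 1" "g = m + 1" "2 * g - 2 = 2 * m" using assms(1) by (auto simp: m_def)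
  have "\<exists>D \<omega>. totally_real (m + 1) D \<and> primitive_k_differential (hyperelliptic_curve D) k \<omega> \<and>
    has_unique_zero_of_order (hyperelliptic_curve D) \<omega> (k * (2 * m))"
  proof (cases "k = 1")
    case True
    then show ?thesis using exists_abelian[OF m(1)] by simp
  next
    case False
    then have k: "k \<ge> 2" using assms(2) by simp
    have "k * m \<ge> m + 2"
    proof (cases "m = 1")
      case True
      then show ?thesis using ne k m(2) by simp
    next
      case False
      then have "m + 2 \<le> 2 * m" using m(1) by simp
      also have "\<dots> \<le> k * m" using k by (rule mult_right_mono) simp
      finally show ?thesis .
    qed
    with m(1) k show ?thesis by (rule exists_primitive)
  qed
  then show "\<exists>D \<omega>. totally_real g D \<and> primitive_k_differential (hyperelliptic_curve D) k \<omega> \<and>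
    has_unique_zero_of_order (hyperelliptic_curve D) \<omega> (k * (2 * g - 2))"
    unfolding m(2,3) by simp
qed

end
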